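(* Let $N,n,k$ be positive integers. The eigenspace decomposition of $\mathcal H_N(n,k)$ with respect to the operator $H_{\mathrm{CS}}=\mathrm{Tr}((XY)^2)$ is $$\mathcal H_N(n,k)=\bigoplus_\lambda\widetilde{\mathcal H}_N(\lambda),$$ where the sum is over all admissible $\lambda=(\lambda_1\ge\cdots\ge\lambda_N)\in\mathbb N^N$; the eigenvalue of $H_{\mathrm{CS}}$ on $\widetilde{\mathcal H}_N(\lambda)$ is $$\sum_{i=1}^N(\lambda_i-k)(\lambda_i-k+N+1-2i).$$
   Context: Let $\mathbb C[X,A]$ be the polynomial ring in the entries of an $N\times N$ matrix $X=(X^i_j)$ and an $n\times N$ matrix $A=(A^a_i)$, and $$\mathcal H_N(n,k)=\{f\in\mathbb C[X,A]: f(gXg^{-1},Ag^{-1})=\det(g)^{-k}f(X,A)\ \forall g\in GL_N(\mathbb C)\}.$$ Put $Y^i_j=\partial/\partial X^j_i$, $B^i_a=\partial/\partial A^a_i$, $(XY)^i_j=\sum_lX^i_lY^l_j$, and $\mathrm{Tr}((XY)^2)=\sum_{i,j}(XY)^i_j(XY)^j_i$ (an operator preserving $\mathcal H_N(n,k)$). The operators forming the $(n+N)\times(n+N)$ matrix $\begin{pmatrix} AB & AY \\ X B & X Y \end{pmatrix}$ (e.g. $(AB)^a_b=\sum_iA^a_iB^i_b$, $(AY)^a_j=\sum_iA^a_iY^i_j$, $(XB)^i_b=\sum_jX^i_jB^j_b$) satisfy the $\mathfrak{gl}_{N+n}$ relations and act on $\mathbb C[X,A]$; together with the commuting right action of $GL_N$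 on the stacked $(n+N)\times N$ matrix $\binom AX$ one has $\mathbb C[X,A]=\bigoplus_{\lambda=(\lambda_1\ge\dots\ge\lambda_N)\in\mathbb N^N}V^{N+n}_\lambda\otimes(V^N_\lambda)^*$, where $V^M_\lambda$ is the irreducible $GL_M$-module of highest weight $\lambda$ (padded by zeros). $\widetilde{\mathcal H}_N(\lambda)$ is the intersection of $\mathcal H_N(n,k)$ with the summand $V^{N+n}_\lambda\otimes(V^N_\lambda)^*$. $\lambda$ is called admissible if $\lambda_i\ge k$ for all $1\le i\le N$ and $\lambda_i\ge\lambda_{i+n}+k$ for all $1\le i\le N-n$. *)

theory Defs
  imports
    Complex_Main
    "HOL-Library.Poly_Mapping"
    "Jordan_Normal_Form.Determinant"
begin

text \<open>
  The polynomial ring \<open>\<complex>[X,A]\<close>: an element maps monomials (exponent vectors) to coefficients.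
  Rows and columns are indexed from 0, so \<open>XV i j\<close> with \<open>i, j < N\<close> stands for \<open>X\<^sup>i\<^sub>j\<close>
  and \<open>AV a i\<close> with \<open>a < n\<close>, \<open>i < N\<close> for \<open>A\<^sup>a\<^sub>i\<close> (upper index = row).
  The type has variables for all natural indices; \<open>poly_ring N n\<close> carves out \<open>\<complex>[X,A]\<close>.
\<close>

datatype entry = XV nat nat | AV nat nat

type_synonym cpoly = "(entry \<Rightarrow>\<^sub>0 nat) \<Rightarrow>\<^sub>0 complex"

definition entries :: "nat \<Rightarrow> nat \<Rightarrow> entry set" where
  "entries N n = {XV i j | i j. i < N \<and> j < N} \<union> {AV a i | a i. a < n \<and> i < N}"

definition poly_ring :: "nat \<Rightarrow> nat \<Rightarrow> cpoly set" where
  "poly_ring N n = {f. \<forall>m \<in> Poly_Mapping.keys f. Poly_Mapping.keys m \<subseteq> entries N n}"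

definition smult_poly :: "complex \<Rightarrow> cpoly \<Rightarrow> cpoly" where
  "smult_poly c f = Poly_Mapping.map (\<lambda>a. c * a) f"

lemma lookup_smult_poly:
  "Poly_Mapping.lookup (smult_poly c f) m = c * Poly_Mapping.lookup f m"
  by (simp add: smult_poly_def Poly_Mapping.map.rep_eq when_def)

global_interpretation cpoly: Vector_Spaces.vector_space smult_poly
  by unfold_locales
    (auto intro!: poly_mapping_eqI simp: lookup_smult_poly lookup_add algebra_simps)

definition var :: "entry \<Rightarrow> cpoly" where
  "var v = Poly_Mapping.single (Poly_Mapping.single v 1) 1"

definition pdiff :: "entry \<Rightarrow> cpoly \<Rightarrow> cpoly" where
  "pdiff v f = (\<Sum>m \<in> Poly_Mapping.keys f.
     Poly_Mapping.single (m - Poly_Mapping.single v 1)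
       (of_nat (Poly_Mapping.lookup m v) * Poly_Mapping.lookup f m))"

fun entry_value :: "complex mat \<Rightarrow> complex mat \<Rightarrow> entry \<Rightarrow> complex" where
  "entry_value X A (XV i j) = X $$ (i, j)"
| "entry_value X A (AV a i) = A $$ (a, i)"

definition eval_poly :: "cpoly \<Rightarrow> complex mat \<Rightarrow> complex mat \<Rightarrow> complex" where
  "eval_poly f X A = (\<Sum>m \<in> Poly_Mapping.keys f.
     Poly_Mapping.lookup f m *
       (\<Prod>v \<in> Poly_Mapping.keys m. entry_value X A v ^ Poly_Mapping.lookup m v))"

text \<open>
  In \<open>cov_space\<close>, \<open>h\<close> is the inverse of \<open>g\<close>.  As \<open>\<complex>\<close> is infinite, the identity of polynomials in
  \<open>(X, A)\<close> is expressed as an identity of values at all matrices.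
\<close>

definition cov_space :: "nat \<Rightarrow> nat \<Rightarrow> nat \<Rightarrow> cpoly set" where
  "cov_space N n k = {f \<in> poly_ring N n.
     \<forall>g \<in> carrier_mat N N. \<forall>h \<in> carrier_mat N N.
       g * h = 1\<^sub>m N \<and> h * g = 1\<^sub>m N \<longrightarrow>
       (\<forall>X \<in> carrier_mat N N. \<forall>A \<in> carrier_mat n N.
          eval_poly f (g * X * h) (A * h) = det g powi (- int k) * eval_poly f X A)}"

definition opX :: "nat \<Rightarrow> nat \<Rightarrow> cpoly \<Rightarrow> cpoly" where
  "opX i j f = var (XV i j) * f"

definition opA :: "nat \<Rightarrow> nat \<Rightarrow> cpoly \<Rightarrow> cpoly" where
  "opA a i f = var (AV a i) * f"

definition opY :: "nat \<Rightarrow> nat \<Rightarrow> cpoly \<Rightarrow> cpoly" where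
  "opY i j = pdiff (XV j i)"

definition opB :: "nat \<Rightarrow> nat \<Rightarrow> cpoly \<Rightarrow> cpoly" where
  "opB i a = pdiff (AV a i)"

definition opXY :: "nat \<Rightarrow> nat \<Rightarrow> nat \<Rightarrow> cpoly \<Rightarrow> cpoly" where
  "opXY N i j f = (\<Sum>l<N. opX i l (opY l j f))"

definition opAB :: "nat \<Rightarrow> nat \<Rightarrow> nat \<Rightarrow> cpoly \<Rightarrow> cpoly" where
  "opAB N a b f = (\<Sum>i<N. opA a i (opB i b f))"

definition opAY :: "nat \<Rightarrow> nat \<Rightarrow> nat \<Rightarrow> cpoly \<Rightarrow> cpoly" where
  "opAY N a j f = (\<Sum>i<N. opA a i (opY i j f))"

definition opXB :: "nat \<Rightarrow> nat \<Rightarrow> nat \<Rightarrow> cpoly \<Rightarrow> cpoly" where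
  "opXB N i b f = (\<Sum>j<N. opX i j (opB j b f))"

definition H_CS :: "nat \<Rightarrow> cpoly \<Rightarrow> cpoly" where
  "H_CS N f = (\<Sum>i<N. \<Sum>j<N. opXY N i j (opXY N j i f))"

text \<open>
  The block matrix of operators.  Its entry \<open>(p, q)\<close> is the action of the matrix unit \<open>E\<^bsub>pq\<^esub>\<close> of
  \<open>gl\<^bsub>N+n\<^esub>\<close>; the rows \<open>p < n\<close> belong to \<open>A\<close> and the rows \<open>n \<le> p < n + N\<close> to \<open>X\<close>.
\<close>

definition gl_op :: "nat \<Rightarrow> nat \<Rightarrow> nat \<Rightarrow> nat \<Rightarrow> cpoly \<Rightarrow> cpoly" where
  "gl_op N n p q =
     (if p < n then (if q < n then opAB N p q else opAY N p (q - n))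
      else (if q < n then opXB N (p - n) q else opXY N (p - n) (q - n)))"

definition gl_submodule :: "nat \<Rightarrow> nat \<Rightarrow> cpoly set \<Rightarrow> bool" where
  "gl_submodule N n W \<longleftrightarrow> cpoly.subspace W \<and> W \<subseteq> poly_ring N n \<and>
     (\<forall>p < n + N. \<forall>q < n + N. \<forall>f \<in> W. gl_op N n p q f \<in> W)"

definition gl_irreducible :: "nat \<Rightarrow> nat \<Rightarrow> cpoly set \<Rightarrow> bool" where
  "gl_irreducible N n W \<longleftrightarrow> gl_submodule N n W \<and> W \<noteq> {0} \<and>
     (\<forall>U. gl_submodule N n U \<and> U \<subseteq> W \<longrightarrow> U = {0} \<or> U = W)"

text \<open>
  Weights are functions \<open>nat \<Rightarrow> nat\<close> indexed from 1, as in \<open>\<lambda>\<^sub>1 \<ge> \<lambda>\<^sub>2 \<ge> \<dots>\<close>; since the matrix units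
  are indexed from 0, \<open>E\<^bsub>pp\<^esub>\<close> carries the weight \<open>lam (Suc p)\<close>.
\<close>

definition highest_weight_vector :: "nat \<Rightarrow> nat \<Rightarrow> (nat \<Rightarrow> nat) \<Rightarrow> cpoly \<Rightarrow> bool" where
  "highest_weight_vector N n lam v \<longleftrightarrow> v \<noteq> 0 \<and>
     (\<forall>p q. p < q \<and> q < n + N \<longrightarrow> gl_op N n p q v = 0) \<and>
     (\<forall>p < n + N. gl_op N n p p v = smult_poly (of_nat (lam (Suc p))) v)"

text \<open>
  In the multiplicity-free decomposition of \<open>\<complex>[X,A]\<close> under the commuting actions of \<open>GL\<^bsub>N+n\<^esub>\<close> and
  \<open>GL\<^sub>N\<close>, the summand \<open>V\<^sub>\<lambda> \<otimes> (V\<^sub>\<lambda>)\<^sup>*\<close> is the sum of all submodules isomorphic to the irreducible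
  \<open>gl\<^bsub>N+n\<^esub>\<close>-module of highest weight \<open>\<lambda>\<close>, i.e. its isotypic component.
\<close>

definition isotypic_summand :: "nat \<Rightarrow> nat \<Rightarrow> (nat \<Rightarrow> nat) \<Rightarrow> cpoly set" where
  "isotypic_summand N n lam = cpoly.span
     (\<Union>{W. gl_irreducible N n W \<and> (\<exists>v \<in> W. highest_weight_vector N n lam v)})"

definition cov_summand :: "nat \<Rightarrow> nat \<Rightarrow> nat \<Rightarrow> (nat \<Rightarrow> nat) \<Rightarrow> cpoly set" where
  "cov_summand N n k lam = cov_space N n k \<inter> isotypic_summand N n lam"

text \<open>
  \<open>\<lambda> \<in> \<nat>\<^sup>N\<close> is represented by its extension by zero outside \<open>{1..N}\<close>, which is also its padding to
  a weight of \<open>gl\<^bsub>N+n\<^esub>\<close>.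
\<close>

definition partitions :: "nat \<Rightarrow> (nat \<Rightarrow> nat) set" where
  "partitions N = {lam. (\<forall>i. i \<notin> {1..N} \<longrightarrow> lam i = 0) \<and>
     (\<forall>i \<in> {1..N}. \<forall>j \<in> {1..N}. i \<le> j \<longrightarrow> lam j \<le> lam i)}"

definition admissible :: "nat \<Rightarrow> nat \<Rightarrow> nat \<Rightarrow> (nat \<Rightarrow> nat) \<Rightarrow> bool" where
  "admissible N n k lam \<longleftrightarrow> (\<forall>i \<in> {1..N}. lam i \<ge> k) \<and>
     (\<forall>i. 1 \<le> i \<and> i + n \<le> N \<longrightarrow> lam i \<ge> lam (i + n) + k)"

text \<open>
  Internal direct sum: \<open>V\<close> is a subspace, and each element of \<open>V\<close> is in a unique way a finite sum of
  elements of the subspaces \<open>W i \<subseteq> V\<close>, \<open>i \<in> I\<close>.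
\<close>

definition is_direct_sum :: "cpoly set \<Rightarrow> 'i set \<Rightarrow> ('i \<Rightarrow> cpoly set) \<Rightarrow> bool" where
  "is_direct_sum V I W \<longleftrightarrow> cpoly.subspace V \<and>
     (\<forall>i \<in> I. cpoly.subspace (W i) \<and> W i \<subseteq> V) \<and>
     (\<forall>f \<in> V. \<exists>!c. (\<forall>i \<in> I. c i \<in> W i) \<and> (\<forall>i. i \<notin> I \<longrightarrow> c i = 0) \<and>
        finite {i. c i \<noteq> 0} \<and> f = (\<Sum>i \<in> {i. c i \<noteq> 0}. c i))"

text \<open>
  \<open>E\<close> consists of eigenvectors of \<open>T\<close> for \<open>c\<close> (and 0); \<open>E \<noteq> {0}\<close> makes \<open>c\<close> an actual eigenvalue.
\<close>

definition has_eigenvalue_on :: "(cpoly \<Rightarrow> cpoly) \<Rightarrow> cpoly set \<Rightarrow> complex \<Rightarrow> bool" where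
  "has_eigenvalue_on T E c \<longleftrightarrow> E \<noteq> {0} \<and> (\<forall>f \<in> E. T f = smult_poly c f)"

end

theory Submission
  imports Defs
begin

text \<open>
  Stack \<open>A\<close> on top of \<open>X\<close>; let \<open>E p q\<close> be the row operators of \<open>gl\<^bsub>N+n\<^esub>\<close>, \<open>E' i j\<close> those of the rows of
  \<open>X\<close> only, and \<open>F i j\<close> the column operators of \<open>gl\<^sub>N\<close>, which commute with the row operators.  For the
  Fischer inner product the adjoint of \<open>E p q\<close> is \<open>E q p\<close>, and likewise for \<open>F\<close>; hence lowering
  spans of highest weight vectors are irreducible, and the polynomial ring is the orthogonal sum of its
  isotypic components.  A joint highest weight vector for \<open>E\<close> and \<open>F\<close> contains a monomial in the diagonal
  variables (Gaussian elimination), so both of its weights agree.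

  Covariance of \<open>f\<close> is equivalent to \<open>F i j f = E' j i f + k \<delta> f\<close>.  This condition passes to the isotypic
  components, and it expresses \<open>H_CS\<close> through the Casimir operator of \<open>F\<close>, which differs from that of
  \<open>E\<close> by a multiple of the Euler operator and therefore is a scalar on each component.

  A nonzero covariant in the component of \<open>\<lambda>\<close> generates a joint highest weight vector for \<open>F\<close> and \<open>E'\<close> of
  weights \<open>\<lambda>\<close> and \<open>\<lambda> - k\<close>, and a second elimination shows that these weights interlace, i.e. that \<open>\<lambda>\<close> is
  admissible.  Conversely, for admissible \<open>\<lambda>\<close> a product of minors is such a joint vector \<open>w\<close>; the
  \<open>E'\<close>-module and the \<open>F\<close>-module generated by \<open>w\<close> are dual to each other up to \<open>det ^ k\<close>, and the
  canonical invariant of their tensor product is a nonzero covariant.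
\<close>


section \<open>Polynomials and the Fischer inner product\<close>

text \<open>Covariants in the component of \<open>lam\<close> correspond to gl_N-maps from V_(lam -
  k) into the restriction of V_lam from gl_(N+n). By branching n times, V_mu occurs there exactly
  when lam_i >= mu_i >= lam_(i+n) for all i, with lam padded by zeros. For mu = lam - k the left
  inequality is automatic and the right one is admissibility; the bound lam_i >= k comes from the
  padding. Likewise \<open>H_CS\<close> is the Casimir operator of the rows of X, whose value on
  V_mu is the sum of mu_i (mu_i + N + 1 - 2i); this is the origin of the eigenvalue. Neither
  branching nor complete reducibility nor Schur's lemma is quoted. Orthogonal complements of
  submodules are stable, and every nonzero stable subspace contains a highest weight vector because
  weights are natural numbers; these two facts replace the theory. \<open>isotypic_summand\<close>
  refers to gl_(N+n) only, so the role of F has to be derived: as E and F commute, the highest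
  weight vectors of one weight for one algebra form a module for the other, which contains a joint
  highest weight vector.\<close>

abbreviation coef :: "cpoly \<Rightarrow> (entry \<Rightarrow>\<^sub>0 nat) \<Rightarrow> complex" where
  "coef \<equiv> Poly_Mapping.lookup"

abbreviation expo :: "(entry \<Rightarrow>\<^sub>0 nat) \<Rightarrow> entry \<Rightarrow> nat" where
  "expo \<equiv> Poly_Mapping.lookup"

abbreviation mon :: "entry \<Rightarrow> entry \<Rightarrow>\<^sub>0 nat" where
  "mon v \<equiv> Poly_Mapping.single v (Suc 0)"

abbreviation lin :: "(cpoly \<Rightarrow> cpoly) \<Rightarrow> bool" where
  "lin \<equiv> Vector_Spaces.linear smult_poly smult_poly"

lemma expo_mon: "expo (mon v) w = (if w = v then 1 else 0)"
  by (simp add: lookup_single when_def)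

lemma mon_add_diff: "0 < expo m v \<Longrightarrow> mon v + (m - mon v) = m"
  by (rule poly_mapping_eqI) (auto simp: lookup_add lookup_minus expo_mon)

lemma mon_diff_add: "mon v + m - mon v = m"
  by (rule poly_mapping_eqI) (auto simp: lookup_add lookup_minus expo_mon)

lemma coef_var_mult:
  "coef (var v * f) m = (if 0 < expo m v then coef f (m - mon v) else 0)"
proof -
  have "coef (var v * f) m = (\<Sum>l. (1 when mon v = l) * (\<Sum>q. coef f q when m = l + q))"
    by (simp add: lookup_mult var_def lookup_single)
  also have "\<dots> = (\<Sum>q. coef f q when m = mon v + q)"
    by (simp add: when_mult)
  also have "\<dots> = (if 0 < expo m v then coef f (m - mon v) else 0)"
  proof (cases "0 < expo m v")
    case True
    have "m = mon v + q \<longleftrightarrow> m - mon v = q" for q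
      using mon_add_diff[OF True] mon_diff_add[of v q] by auto
    then show ?thesis using True by simp
  next
    case False
    then have "m \<noteq> mon v + q" for q
      by (auto simp: lookup_add expo_mon)
    then show ?thesis using False by simp
  qed
  finally show ?thesis .
qed

lemma coef_pdiff: "coef (pdiff v f) m = of_nat (Suc (expo m v)) * coef f (m + mon v)"
proof -
  have "coef (pdiff v f) m = (\<Sum>l\<in>Poly_Mapping.keys f.
      (of_nat (expo l v) * coef f l) when l - mon v = m)"
    unfolding pdiff_def lookup_sum by (simp add: lookup_single)
  also have "\<dots> = (\<Sum>l\<in>Poly_Mapping.keys f.
      if l = m + mon v then of_nat (Suc (expo m v)) * coef f (m + mon v) else 0)"
  proof (rule sum.cong[OF refl])
    fix l
    show "(of_nat (expo l v) * coef f l when l - mon v = m) =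
      (if l = m + mon v then of_nat (Suc (expo m v)) * coef f (m + mon v) else 0)"
    proof (cases "expo l v = 0")
      case True
      then have "l \<noteq> m + mon v" by (auto simp: lookup_add expo_mon)
      then show ?thesis using True by (simp add: when_def)
    next
      case False
      then have "l - mon v = m \<longleftrightarrow> l = m + mon v"
        using mon_add_diff[of l v] mon_diff_add[of v m] by (auto simp: add.commute)
      then show ?thesis by (auto simp: when_def lookup_add expo_mon)
    qed
  qed
  also have "\<dots> = of_nat (Suc (expo m v)) * coef f (m + mon v)"
    by (auto simp: in_keys_iff)
  finally show ?thesis .
qed

lemma smult_conv_mult: "smult_poly c f = Poly_Mapping.single 0 c * f"
  unfolding smult_poly_def by (rule mult_map_scale_conv_mult)

lemma mult_smult_right: "f * smult_poly c g = smult_poly c (f * g)"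
  by (simp add: smult_conv_mult mult.left_commute)

lemma linI:
  assumes "\<And>f g. T (f + g) = T f + T g" "\<And>c f. T (smult_poly c f) = smult_poly c (T f)"
  shows "lin T"
  using assms cpoly.vector_space_axioms by (simp add: Vector_Spaces.linear_iff)

lemma lin_add: "lin T \<Longrightarrow> T (f + g) = T f + T g"
  and lin_smult: "lin T \<Longrightarrow> T (smult_poly c f) = smult_poly c (T f)"
  by (simp_all add: Vector_Spaces.linear_iff)

lemma lin_zero: "lin T \<Longrightarrow> T 0 = 0"
  by (metis add_cancel_left_right lin_add)

lemma lin_diff: "lin T \<Longrightarrow> T (f - g) = T f - T g"
  by (metis add_diff_cancel diff_add_cancel lin_add)

lemma lin_sum: "lin T \<Longrightarrow> T (sum f A) = (\<Sum>a\<in>A. T (f a))"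
  by (induction A rule: infinite_finite_induct) (simp_all add: lin_zero lin_add)

lemma lin_comp: "lin S \<Longrightarrow> lin T \<Longrightarrow> lin (\<lambda>f. S (T f))"
  by (rule linI) (simp_all add: lin_add lin_smult)

lemma lin_sumI: "(\<And>a. a \<in> A \<Longrightarrow> lin (T a)) \<Longrightarrow> lin (\<lambda>f. \<Sum>a\<in>A. T a f)"
  by (rule linI)
    (simp_all add: lin_add lin_smult sum.distrib cpoly.scale_sum_right)

lemma lin_pdiff: "lin (pdiff v)"
  by (rule linI; rule poly_mapping_eqI)
    (simp_all add: coef_pdiff lookup_add lookup_smult_poly algebra_simps)

lemma pdiff_commute: "pdiff v (pdiff w f) = pdiff w (pdiff v f)"
  by (rule poly_mapping_eqI)
    (auto simp: coef_pdiff lookup_add expo_mon add.assoc add.commute[of "mon v"])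

lemma pdiff_var_mult: "pdiff v (var w * f) = (if v = w then f else 0) + var w * pdiff v f"
proof (rule poly_mapping_eqI)
  fix m
  show "coef (pdiff v (var w * f)) m = coef ((if v = w then f else 0) + var w * pdiff v f) m"
  proof (cases "v = w")
    case True
    have "coef (pdiff v (var w * f)) m = of_nat (Suc (expo m v)) * coef f m"
      using True mon_diff_add[of v m]
      by (simp add: coef_pdiff coef_var_mult lookup_add expo_mon add.commute)
    moreover have "0 < expo m v \<Longrightarrow> m - mon v + mon v = m"
      using mon_add_diff[of m v] by (simp add: add.commute)
    ultimately show ?thesis using True
      by (auto simp: coef_pdiff coef_var_mult lookup_add lookup_minus expo_mon algebra_simps
          of_nat_diff Suc_leI)
  next
    case False
    have "0 < expo m w \<Longrightarrow> m + mon v - mon w = m - mon w + mon v"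
      using False by (intro poly_mapping_eqI) (auto simp: lookup_add lookup_minus expo_mon)
    then show ?thesis using False
      by (auto simp: coef_pdiff coef_var_mult lookup_add lookup_minus expo_mon)
  qed
qed

text \<open>A matrix unit of the gl acting on the span of all variables. Every operator below is a
  sum of these, so all commutation relations reduce to \<open>dop_commutator\<close>.\<close>

definition dop :: "entry \<Rightarrow> entry \<Rightarrow> cpoly \<Rightarrow> cpoly" where
  "dop a b f = var a * pdiff b f"

lemma lin_dop: "lin (dop a b)"
  unfolding dop_def by (rule linI)
    (simp_all add: lin_add[OF lin_pdiff] lin_smult[OF lin_pdiff] mult_smult_right algebra_simps)

lemma coef_dop: "coef (dop a b f) m =
  (if 0 < expo m a then of_nat (Suc (expo (m - mon a) b)) * coef f (m - mon a + mon b) else 0)"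
  by (simp add: dop_def coef_var_mult coef_pdiff)

lemma coef_dop_same: "coef (dop a a f) m = of_nat (expo m a) * coef f m"
  using mon_add_diff[of m a]
  by (auto simp: coef_dop lookup_minus expo_mon add.commute)

text \<open>Normal ordering. The second-order part is symmetric in the two pairs, so it cancels in
  \<open>dop_commutator\<close>; \<open>casimir_relation\<close> compares such parts as
  well.\<close>

lemma dop_dop: "dop a b (dop c d f) =
  (if b = c then dop a d f else 0) + var a * (var c * pdiff b (pdiff d f))"
  by (auto simp: dop_def pdiff_var_mult algebra_simps)

lemma dop_commutator: "dop a b (dop c d f) =
  dop c d (dop a b f) + (if b = c then dop a d f else 0) - (if d = a then dop c b f else 0)"
  by (simp add: dop_dop pdiff_commute[of b d] mult.left_commute)

definition mfact :: "(entry \<Rightarrow>\<^sub>0 nat) \<Rightarrow> complex" where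
  "mfact m = (\<Prod>v\<in>Poly_Mapping.keys m. of_nat (fact (expo m v)))"

text \<open>The Fischer inner product, for which multiplication by a variable is adjoint to
  differentiation with respect to it.\<close>

definition ip :: "cpoly \<Rightarrow> cpoly \<Rightarrow> complex" where
  "ip f g = (\<Sum>m\<in>Poly_Mapping.keys f. mfact m * coef f m * cnj (coef g m))"

lemma mfact_superset:
  "finite E \<Longrightarrow> Poly_Mapping.keys m \<subseteq> E \<Longrightarrow> mfact m = (\<Prod>v\<in>E. of_nat (fact (expo m v)))"
  unfolding mfact_def by (rule prod.mono_neutral_left) (auto simp: in_keys_iff)

lemma mfact_add_mon: "mfact (m + mon v) = of_nat (Suc (expo m v)) * mfact m"
proof -
  let ?E = "insert v (Poly_Mapping.keys m)"
  have k: "Poly_Mapping.keys (m + mon v) \<subseteq> ?E"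
    using keys_add[of m "mon v"] by auto
  have "mfact (m + mon v) = (\<Prod>w\<in>?E. of_nat (fact (expo (m + mon v) w)))"
    by (rule mfact_superset[OF _ k]) simp
  also have "\<dots> = of_nat (fact (Suc (expo m v))) * (\<Prod>w\<in>?E - {v}. of_nat (fact (expo m w)))"
    by (subst prod.remove[of _ v]) (auto simp: lookup_add expo_mon intro!: prod.cong)
  also have "\<dots> = of_nat (Suc (expo m v)) * (\<Prod>w\<in>?E. of_nat (fact (expo m w)))"
    by (subst (2) prod.remove[of _ v]) (auto simp: algebra_simps)
  also have "(\<Prod>w\<in>?E. of_nat (fact (expo m w))) = mfact m"
    by (rule mfact_superset[symmetric]) auto
  finally show ?thesis .
qed

lemma ip_superset:
  "finite K \<Longrightarrow> Poly_Mapping.keys f \<subseteq> K \<Longrightarrow> ip f g = (\<Sum>m\<in>K. mfact m * coef f m * cnj (coef g m))"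
  unfolding ip_def by (rule sum.mono_neutral_left) (auto simp: in_keys_iff)

lemma mfact_pos: "\<exists>r>0. mfact m = of_real r"
proof
  show "0 < (\<Prod>v\<in>Poly_Mapping.keys m. fact (expo m v) :: real) \<and>
    mfact m = of_real (\<Prod>v\<in>Poly_Mapping.keys m. fact (expo m v) :: real)"
    unfolding mfact_def by (auto intro!: prod_pos)
qed

lemma ip_commute: "ip g f = cnj (ip f g)"
proof -
  let ?K = "Poly_Mapping.keys f \<union> Poly_Mapping.keys g"
  have "cnj (mfact m) = mfact m" for m
    using mfact_pos[of m] by auto
  then show ?thesis
    using ip_superset[of ?K f g] ip_superset[of ?K g f] by (simp add: mult_ac)
qed

lemma ip_add_left: "ip (f + g) h = ip f h + ip g h"
proof -
  let ?K = "Poly_Mapping.keys f \<union> Poly_Mapping.keys g"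
  show ?thesis
    using ip_superset[of ?K f h] ip_superset[of ?K g h] ip_superset[of ?K "f + g" h] keys_add[of f g]
    by (simp add: lookup_add algebra_simps sum.distrib)
qed

lemma keys_smult_subset: "Poly_Mapping.keys (smult_poly c f) \<subseteq> Poly_Mapping.keys f"
  by (auto simp: in_keys_iff lookup_smult_poly)

lemma ip_smult_left: "ip (smult_poly c f) h = c * ip f h"
proof -
  have "ip (smult_poly c f) h =
      (\<Sum>m\<in>Poly_Mapping.keys f. mfact m * coef (smult_poly c f) m * cnj (coef h m))"
    by (rule ip_superset[OF _ keys_smult_subset]) simp
  then show ?thesis
    by (simp add: ip_def lookup_smult_poly sum_distrib_left mult_ac)
qed

lemma ip_add_right: "ip h (f + g) = ip h f + ip h g"
  by (metis complex_cnj_add ip_add_left ip_commute)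

lemma ip_smult_right: "ip h (smult_poly c f) = cnj c * ip h f"
  by (metis complex_cnj_mult ip_commute ip_smult_left)

lemma ip_zero_left [simp]: "ip 0 f = 0"
  by (simp add: ip_def)

lemma ip_zero_right [simp]: "ip f 0 = 0"
  by (simp add: ip_def)

lemma ip_sum_left: "ip (sum f A) h = (\<Sum>a\<in>A. ip (f a) h)"
  by (induction A rule: infinite_finite_induct) (simp_all add: ip_add_left)

lemma ip_sum_right: "ip h (sum f A) = (\<Sum>a\<in>A. ip h (f a))"
  by (induction A rule: infinite_finite_induct) (simp_all add: ip_add_right)

lemma ip_diff_left: "ip (f - g) h = ip f h - ip g h"
  by (metis add_diff_cancel diff_add_cancel ip_add_left)

lemma ip_self:
  assumes "f \<noteq> 0" shows "\<exists>r>0. ip f f = of_real r"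
proof -
  obtain r where r: "\<And>m. r m > 0" "\<And>m. mfact m = of_real (r m)"
    using mfact_pos by metis
  have "ip f f = of_real (\<Sum>m\<in>Poly_Mapping.keys f. r m * (cmod (coef f m))\<^sup>2)"
    unfolding ip_def of_real_sum
    by (rule sum.cong) (auto simp: r(2) mult.assoc simp flip: complex_norm_square)
  moreover have "0 < (\<Sum>m\<in>Poly_Mapping.keys f. r m * (cmod (coef f m))\<^sup>2)"
    using assms r(1) by (intro sum_pos) (auto simp: in_keys_iff)
  ultimately show ?thesis by blast
qed

lemma ip_self_eq_0: "ip f f = 0 \<longleftrightarrow> f = 0"
  using ip_self[of f] by (cases "f = 0") auto

lemma ip_adj_var: "ip (var v * f) g = ip f (pdiff v g)"
proof -
  have inj: "inj_on (\<lambda>m. m + mon v) A" for A by (simp add: inj_on_def)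
  have sub: "Poly_Mapping.keys (var v * f) \<subseteq> (\<lambda>m. m + mon v) ` Poly_Mapping.keys f"
  proof
    fix m assume "m \<in> Poly_Mapping.keys (var v * f)"
    then have "0 < expo m v" "m - mon v \<in> Poly_Mapping.keys f"
      by (auto simp: in_keys_iff coef_var_mult split: if_splits)
    then show "m \<in> (\<lambda>m. m + mon v) ` Poly_Mapping.keys f"
      using mon_add_diff[of m v] by (auto simp: add.commute intro!: rev_image_eqI[of "m - mon v"])
  qed
  have "ip (var v * f) g = (\<Sum>m\<in>(\<lambda>m. m + mon v) ` Poly_Mapping.keys f.
      mfact m * coef (var v * f) m * cnj (coef g m))"
    by (rule ip_superset[OF _ sub]) simp
  also have "\<dots> = (\<Sum>m\<in>Poly_Mapping.keys f.
      mfact (m + mon v) * coef (var v * f) (m + mon v) * cnj (coef g (m + mon v)))"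
    by (subst sum.reindex[OF inj]) simp
  also have "\<dots> = ip f (pdiff v g)"
    unfolding ip_def
  proof (rule sum.cong[OF refl])
    fix m
    have "coef (var v * f) (m + mon v) = coef f m"
      using mon_diff_add[of v m] by (simp add: coef_var_mult lookup_add expo_mon add.commute)
    then show "mfact (m + mon v) * coef (var v * f) (m + mon v) * cnj (coef g (m + mon v)) =
      mfact m * coef f m * cnj (coef (pdiff v g) m)"
      by (simp add: mfact_add_mon coef_pdiff)
  qed
  finally show ?thesis .
qed

lemma ip_adj_pdiff: "ip (pdiff v f) g = ip f (var v * g)"
  by (metis ip_adj_var ip_commute)

lemma ip_dop: "ip (dop a b f) g = ip f (dop b a g)"
  by (simp add: dop_def ip_adj_var ip_adj_pdiff)


section \<open>Highest weight vectors\<close>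

lemma nonzero_coef: "f \<noteq> 0 \<Longrightarrow> \<exists>m. coef f m \<noteq> 0"
  by (metis poly_mapping_eqI lookup_zero)

lemma smult_sub: "smult_poly (a - b) f = smult_poly a f - smult_poly b f"
  by (rule cpoly.scale_left_diff_distrib)

text \<open>One interface for the row, column and twisted actions. \<open>adj\<close> is the
  unitarity that stands in for complete reducibility; \<open>e p q\<close> with p < q is a raising
  operator.\<close>

locale gl_action =
  fixes e :: "nat \<Rightarrow> nat \<Rightarrow> cpoly \<Rightarrow> cpoly" and L :: nat
  assumes lin_e: "p < L \<Longrightarrow> q < L \<Longrightarrow> lin (e p q)"
    and comm: "p < L \<Longrightarrow> q < L \<Longrightarrow> r < L \<Longrightarrow> s < L \<Longrightarrow> e p q (e r s f) =
      e r s (e p q f) + (if q = r then e p s f else 0) - (if s = p then e r q f else 0)"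
    and adj: "p < L \<Longrightarrow> q < L \<Longrightarrow> ip (e p q f) g = ip f (e q p g)"
begin

definition stable :: "cpoly set \<Rightarrow> bool" where
  "stable W \<longleftrightarrow> (\<forall>p<L. \<forall>q<L. \<forall>f\<in>W. e p q f \<in> W)"

definition hw :: "(nat \<Rightarrow> complex) \<Rightarrow> cpoly \<Rightarrow> bool" where
  "hw c v \<longleftrightarrow> (\<forall>p q. p < q \<and> q < L \<longrightarrow> e p q v = 0) \<and> (\<forall>p<L. e p p v = smult_poly (c p) v)"

lemma hw_raise: "hw c v \<Longrightarrow> p < q \<Longrightarrow> q < L \<Longrightarrow> e p q v = 0"
  and hw_cartan: "hw c v \<Longrightarrow> p < L \<Longrightarrow> e p p v = smult_poly (c p) v"
  by (auto simp: hw_def)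

text \<open>Generated by lowering operators alone, so that inductions over it meet only one kind of
  operator; for a highest weight vector \<open>v\<close>, \<open>low_closed\<close> shows that it is
  the full module.\<close>

inductive_set low :: "cpoly \<Rightarrow> cpoly set" for v where
  base: "v \<in> low v"
| step: "x \<in> low v \<Longrightarrow> q < p \<Longrightarrow> p < L \<Longrightarrow> e p q x \<in> low v"
| add: "x \<in> low v \<Longrightarrow> y \<in> low v \<Longrightarrow> x + y \<in> low v"
| scale: "x \<in> low v \<Longrightarrow> smult_poly c x \<in> low v"

lemma subspace_low: "cpoly.subspace (low v)"
  unfolding cpoly.subspace_def
proof (intro conjI ballI allI)
  show "0 \<in> low v" using low.scale[OF low.base, of 0 v] by simp
qed (auto intro: low.intros)

lemma low_closed:
  assumes "hw c v" and "x \<in> low v"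
  shows "p < L \<Longrightarrow> q < L \<Longrightarrow> e p q x \<in> low v"
  using assms(2)
proof (induction x arbitrary: p q)
  case base
  consider "p < q" | "p = q" | "q < p" by linarith
  then show ?case
  proof cases
    case 1
    then show ?thesis using hw_raise[OF assms(1)] base cpoly.subspace_0[OF subspace_low] by simp
  next
    case 2
    then show ?thesis using hw_cartan[OF assms(1)] base by (auto intro: low.intros)
  next
    case 3
    then show ?thesis using base by (auto intro: low.intros)
  qed
next
  \<comment> \<open>\<open>e p q\<close> is moved past the outermost lowering operator; the
    commutator terms apply other matrix units to the shorter word, hence the induction over
    arbitrary indices.\<close>
  case (step x s r)
  have s: "s < L" using step.hyps by simp
  have "e r s (e p q x) \<in> low v"
    using step.IH[OF step.prems] step.hyps by (auto intro: low.step)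
  moreover have "(if q = r then e p s x else 0) \<in> low v"
    using step.IH[OF step.prems(1) s] cpoly.subspace_0[OF subspace_low] by simp
  moreover have "(if s = p then e r q x else 0) \<in> low v"
    using step.IH[OF step.hyps(3) step.prems(2)] cpoly.subspace_0[OF subspace_low] by simp
  ultimately show ?case
    unfolding comm[OF step.prems step.hyps(3) s]
    by (intro cpoly.subspace_diff cpoly.subspace_add subspace_low)
qed (auto simp: lin_add[OF lin_e] lin_smult[OF lin_e] intro: low.intros)

lemma stable_low: "hw c v \<Longrightarrow> stable (low v)"
  using low_closed by (auto simp: stable_def)

lemma low_subset:
  assumes "cpoly.subspace W" "stable W" "v \<in> W"
  shows "low v \<subseteq> W"
proof
  fix x assume "x \<in> low v"
  then show "x \<in> W"
    using assms by induction
      (auto simp: stable_def cpoly.subspace_add cpoly.subspace_scale)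
qed

text \<open>The adjoint of a lowering operator is a raising operator, which kills
  \<open>v\<close>.\<close>

lemma low_ip_raise:
  assumes "x \<in> low u" and "\<And>p q. p < q \<Longrightarrow> q < L \<Longrightarrow> e p q v = 0" and "ip u v = 0"
  shows "ip x v = 0"
  using assms(1)
proof induction
  case (step x q p)
  then show ?case using adj[of p q x v] assms(2)[of q p] by simp
qed (simp_all add: assms ip_add_left ip_smult_left)

text \<open>Lowering operators on the side of \<open>y\<close> become raising operators on
  \<open>x\<close>, which stay inside \<open>low u\<close>.\<close>

lemma low_orth:
  assumes "hw c u" "hw d v" "ip u v = 0" "x \<in> low u" "y \<in> low v"
  shows "ip x y = 0"
  using assms(5,4)
proof (induction y arbitrary: x)
  case base
  then show ?case using low_ip_raise hw_raise[OF assms(2)] assms(3) by blast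
next
  case (step y q p)
  have "ip x (e p q y) = ip (e q p x) y"
    using adj[of q p x y] step.hyps by simp
  then show ?case using step low_closed[OF assms(1)] by simp
qed (simp_all add: ip_add_right ip_smult_right)

lemma hw_orth:
  assumes "hw (\<lambda>p. of_nat (c p)) u" "hw (\<lambda>p. of_nat (d p)) v" "p < L" "c p \<noteq> d p"
  shows "ip u v = 0"
  using adj[OF assms(3,3), of u v] hw_cartan[OF assms(1,3)] hw_cartan[OF assms(2,3)] assms(4)
  by (auto simp: ip_smult_left ip_smult_right)

text \<open>The commutator gives |e q p v|^2 = (c p - c q) |v|^2, and the Fischer norm is
  positive.\<close>

lemma hw_dominant:
  assumes "hw (\<lambda>p. of_nat (c p)) v" "v \<noteq> 0" "p < q" "q < L"
  shows "c q \<le> c p"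
proof -
  have pq: "p < L" using assms by simp
  have "e p q (e q p v) = smult_poly (of_nat (c p) - of_nat (c q)) v"
    using comm[OF pq assms(4,4) pq, of v] hw_raise[OF assms(1,3,4)] assms(3)
      hw_cartan[OF assms(1) pq] hw_cartan[OF assms(1) assms(4)] lin_zero[OF lin_e[OF assms(4) pq]]
    by (simp add: smult_sub)
  then have "ip (e q p v) (e q p v) = (of_nat (c p) - of_nat (c q)) * ip v v"
    using adj[OF assms(4) pq, of v "e q p v"] by (simp add: ip_smult_right)
  moreover obtain r where r: "r > 0" "ip v v = of_real r" using ip_self[OF assms(2)] by blast
  moreover obtain t where t: "t \<ge> 0" "ip (e q p v) (e q p v) = of_real t"
    using ip_self[of "e q p v"] by (cases "e q p v = 0") force+
  ultimately have "complex_of_real t = complex_of_real ((real (c p) - real (c q)) * r)"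
    by simp
  then have "t = (real (c p) - real (c q)) * r" by (simp only: of_real_eq_iff)
  then have "real (c p) - real (c q) \<ge> 0"
    using r(1) t(1) by (auto simp: zero_le_mult_iff)
  then show ?thesis by simp
qed

end

locale gl_weight_action = gl_action +
  fixes wt :: "nat \<Rightarrow> (entry \<Rightarrow>\<^sub>0 nat) \<Rightarrow> nat"
  assumes coef_diag: "p < L \<Longrightarrow> coef (e p p f) m = of_nat (wt p m) * coef f m"
begin

definition wvec :: "(nat \<Rightarrow> nat) \<Rightarrow> cpoly \<Rightarrow> bool" where
  "wvec c v \<longleftrightarrow> (\<forall>p<L. e p p v = smult_poly (of_nat (c p)) v)"

lemma wvec_wt: "wvec c v \<Longrightarrow> p < L \<Longrightarrow> coef v m \<noteq> 0 \<Longrightarrow> wt p m = c p"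
  using coef_diag[of p v m] by (auto simp: wvec_def lookup_smult_poly)

text \<open>A nonzero element of \<open>W\<close> with the fewest monomials is a weight vector: a
  diagonal operator minus the weight of one of its monomials yields an element of \<open>W\<close>
  with fewer monomials, hence 0.\<close>

lemma wvec_exists:
  assumes W: "cpoly.subspace W" "stable W" and "\<exists>x\<in>W. x \<noteq> 0"
  shows "\<exists>v\<in>W. v \<noteq> 0 \<and> (\<exists>c. wvec c v)"
proof -
  obtain x where x: "x \<in> W" "x \<noteq> 0"
    and min: "\<And>y. y \<in> W \<Longrightarrow> y \<noteq> 0 \<Longrightarrow> card (Poly_Mapping.keys x) \<le> card (Poly_Mapping.keys y)"
    using ex_has_least_nat[of "\<lambda>x. x \<in> W \<and> x \<noteq> 0" _ "\<lambda>x. card (Poly_Mapping.keys x)"] assms(3)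
    by blast
  obtain m where m: "m \<in> Poly_Mapping.keys x"
    using nonzero_coef[OF x(2)] by (auto simp: in_keys_iff)
  have "e p p x = smult_poly (of_nat (wt p m)) x" if p: "p < L" for p
  proof -
    define y where "y = e p p x - smult_poly (of_nat (wt p m)) x"
    have "y \<in> W"
      using x W p by (auto simp: y_def stable_def intro!: cpoly.subspace_diff cpoly.subspace_scale)
    moreover have "Poly_Mapping.keys y \<subseteq> Poly_Mapping.keys x - {m}"
      by (auto simp: y_def in_keys_iff lookup_minus coef_diag[OF p] lookup_smult_poly)
    then have "card (Poly_Mapping.keys y) < card (Poly_Mapping.keys x)"
      by (metis card_Diff1_less card_mono finite_Diff finite_keys le_less_trans m)
    ultimately have "y = 0" using min[of y] by force
    then show ?thesis by (simp add: y_def)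
  qed
  then have "wvec (\<lambda>p. wt p m) x" by (simp add: wvec_def)
  then show ?thesis using x by blast
qed

text \<open>Raising by \<open>e p q\<close> moves one unit of weight from position q to position p
  and lowers the sum of \<open>p * c p\<close> by q - p. As this sum is a natural number, a weight
  vector minimizing it is killed by all raising operators.\<close>

lemma hw_exists:
  assumes W: "cpoly.subspace W" "stable W" and "\<exists>x\<in>W. x \<noteq> 0"
  shows "\<exists>v\<in>W. v \<noteq> 0 \<and> (\<exists>c::nat \<Rightarrow> nat. hw (\<lambda>p. of_nat (c p)) v)"
proof -
  let ?h = "\<lambda>(v, c). \<Sum>p<L. p * c p :: nat"
  let ?P = "\<lambda>(v, c). v \<in> W \<and> v \<noteq> 0 \<and> wvec c v"
  have "\<exists>z. ?P z" using wvec_exists[OF assms] by auto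
  then obtain z where z: "?P z" "\<forall>y. ?P y \<longrightarrow> ?h z \<le> ?h y"
    using ex_has_least_nat[of ?P _ ?h] by blast
  obtain v c where vc: "z = (v, c)" by (cases z)
  have v: "v \<in> W" "v \<noteq> 0" "wvec c v" using z(1) vc by auto
  have min: "(\<Sum>p<L. p * c p) \<le> (\<Sum>p<L. p * d p)" if "y \<in> W" "y \<noteq> 0" "wvec d y" for y d
    using spec[OF z(2), of "(y, d)"] that vc by simp
  have "e p q v = 0" if pq: "p < q" "q < L" for p q
  proof (rule ccontr)
    assume nz: "e p q v \<noteq> 0"
    let ?y = "e p q v"
    have p: "p < L" using pq by simp
    have ev: "e r r ?y = smult_poly (of_nat (c r) + (if r = p then 1 else 0) - (if r = q then 1 else 0)) ?y"
      if r: "r < L" for r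
      using comm[OF r r p pq(2), of v] v(3) r pq lin_smult[OF lin_e[OF p pq(2)]]
      by (auto simp: wvec_def smult_sub cpoly.scale_left_distrib)
    obtain m where m: "coef ?y m \<noteq> 0" using nonzero_coef[OF nz] by blast
    have wt: "(of_nat (wt r m) :: complex) =
        of_nat (c r) + (if r = p then 1 else 0) - (if r = q then 1 else 0)" if r: "r < L" for r
      using arg_cong[OF ev[OF r], of "\<lambda>f. coef f m"] m
      by (simp add: coef_diag[OF r] lookup_smult_poly)
    \<comment> \<open>Transferred to the integers because subtraction of naturals truncates.\<close>
    have wt': "int (wt r m) = int (c r) + (if r = p then 1 else 0) - (if r = q then 1 else 0)"
      if r: "r < L" for r
    proof -
      have "(of_int (int (wt r m)) :: complex) =
        of_int (int (c r) + (if r = p then 1 else 0) - (if r = q then 1 else 0))"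
        using wt[OF r] by simp
      then show ?thesis by (simp only: of_int_eq_iff)
    qed
    have "e r r ?y = smult_poly (of_nat (wt r m)) ?y" if "r < L" for r
      using ev[OF that] wt[OF that] by simp
    then have "wvec (\<lambda>r. wt r m) ?y" by (simp add: wvec_def)
    then have le: "(\<Sum>r<L. r * c r) \<le> (\<Sum>r<L. r * wt r m)"
      using min[of ?y] nz v(1) W(2) p pq by (auto simp: stable_def)
    have "int (\<Sum>r<L. r * wt r m) = (\<Sum>r<L. int r * int (c r)
        + (if r = p then int r else 0) - (if r = q then int r else 0))"
      unfolding of_nat_sum by (rule sum.cong) (auto simp: wt' algebra_simps)
    also have "\<dots> = int (\<Sum>r<L. r * c r) + int p - int q"
      using p pq by (simp add: sum.distrib sum_subtractf)
    finally show False using le pq by linarith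
  qed
  then have "hw (\<lambda>p. of_nat (c p)) v" using v(3) by (auto simp: hw_def wvec_def)
  then show ?thesis using v by blast
qed

text \<open>A submodule of a lowering span contains a highest weight vector; were it not proportional to
  the generator, it could be made orthogonal to it, hence to the whole span.\<close>

lemma low_irreducible:
  assumes v: "hw (\<lambda>p. of_nat (c p)) v"
    and U: "cpoly.subspace U" "stable U" "U \<subseteq> low v" "\<exists>x\<in>U. x \<noteq> 0"
  shows "U = low v"
proof -
  obtain u d where u: "u \<in> U" "u \<noteq> 0" "hw (\<lambda>p. of_nat (d p)) u"
    using hw_exists[OF U(1,2,4)] by blast
  have orth: "y = 0" if "y \<in> low v" "hw b y" "ip y v = 0" for y b
    using low_orth[OF that(2) v that(3) low.base that(1)] by (simp add: ip_self_eq_0)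
  have uv: "ip u v \<noteq> 0" using orth[of u] u U(3) by auto
  have vv: "ip v v \<noteq> 0" using uv by (auto simp: ip_self_eq_0)
  have eq: "c p = d p" if "p < L" for p using hw_orth[OF u(3) v that] uv by metis
  define y where "y = u - smult_poly (ip u v / ip v v) v"
  have "y = 0"
  proof (rule orth)
    show "y \<in> low v"
      unfolding y_def using u(1) U(3)
      by (intro cpoly.subspace_diff cpoly.subspace_scale subspace_low low.base) auto
    show "hw (\<lambda>p. of_nat (c p)) y"
      using u(3) v eq unfolding hw_def y_def
      by (auto simp: lin_diff[OF lin_e] lin_smult[OF lin_e] cpoly.scale_right_diff_distrib mult.commute)
    show "ip y v = 0" using vv by (simp add: y_def ip_diff_left ip_smult_left)
  qed
  then have u_eq: "u = smult_poly (ip u v / ip v v) v" by (simp add: y_def)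
  have "smult_poly (ip v v / ip u v) (smult_poly (ip u v / ip v v) v) = v"
    using uv vv by simp
  then have "smult_poly (ip v v / ip u v) u = v" by (simp flip: u_eq)
  then have "v \<in> U" using cpoly.subspace_scale[OF U(1) u(1)] by metis
  then show ?thesis using low_subset[OF U(1,2)] U(3) by blast
qed

end


section \<open>The operators on polynomials in a matrix of variables\<close>

text \<open>Applied to \<open>stk n\<close> this gives the row operators and, with the two indices
  exchanged, the column operators, so that one set of lemmas serves both.\<close>

definition matop :: "(nat \<Rightarrow> nat \<Rightarrow> entry) \<Rightarrow> nat \<Rightarrow> nat \<Rightarrow> nat \<Rightarrow> cpoly \<Rightarrow> cpoly" where
  "matop z K p q f = (\<Sum>i<K. dop (z p i) (z q i) f)"

lemma lin_matop: "lin (matop z K p q)"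
  unfolding matop_def[abs_def] by (intro lin_sumI lin_dop)

lemma coef_matop_diag:
  "coef (matop z K p p f) m = of_nat (\<Sum>i<K. expo m (z p i)) * coef f m"
  by (simp add: matop_def lookup_sum coef_dop_same sum_distrib_right)

lemma ip_matop: "ip (matop z K p q f) g = ip f (matop z K q p g)"
  by (simp add: matop_def ip_sum_left ip_sum_right ip_dop)

lemma matop_commutator:
  assumes inj: "\<And>p i q j. z p i = z q j \<longleftrightarrow> p = q \<and> i = j"
  shows "matop z K p q (matop z K r s f) = matop z K r s (matop z K p q f) +
    (if q = r then matop z K p s f else 0) - (if s = p then matop z K r q f else 0)"
proof -
  have "matop z K p q (matop z K r s f) =
      (\<Sum>i<K. \<Sum>j<K. dop (z p i) (z q i) (dop (z r j) (z s j) f))"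
    by (simp add: matop_def lin_sum[OF lin_dop])
  also have "\<dots> = (\<Sum>i<K. \<Sum>j<K. dop (z r j) (z s j) (dop (z p i) (z q i) f)
      + (if j = i then (if q = r then dop (z p i) (z s i) f else 0) else 0)
      - (if j = i then (if s = p then dop (z r i) (z q i) f else 0) else 0))"
    by (intro sum.cong refl) (subst dop_commutator, auto simp: inj)
  also have "\<dots> = (\<Sum>i<K. \<Sum>j<K. dop (z r j) (z s j) (dop (z p i) (z q i) f)) +
      (if q = r then matop z K p s f else 0) - (if s = p then matop z K r q f else 0)"
    by (simp add: sum.distrib sum_subtractf matop_def)
  also have "(\<Sum>i<K. \<Sum>j<K. dop (z r j) (z s j) (dop (z p i) (z q i) f)) =
      matop z K r s (matop z K p q f)"
    by (subst sum.swap) (simp add: matop_def lin_sum[OF lin_dop])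
  finally show ?thesis .
qed

lemma matop_weight_action:
  assumes "\<And>p i q j. z p i = z q j \<longleftrightarrow> p = q \<and> i = j"
  shows "gl_weight_action (matop z K) L (\<lambda>p m. \<Sum>i<K. expo m (z p i))"
  by (intro gl_weight_action.intro gl_action.intro gl_weight_action_axioms.intro)
    (rule lin_matop matop_commutator ip_matop coef_matop_diag assms)+

text \<open>The commutators produce the correction \<open>dop (z p i) (z q j)\<close> once with
  either sign; the index bounds guarantee that both occurrences are in range and cancel.\<close>

lemma matop_commute_transpose:
  assumes inj: "\<And>p i q j. z p i = z q j \<longleftrightarrow> p = q \<and> i = j"
    and "p < M" "q < M" "i < K" "j < K"
  shows "matop z K p q (matop (\<lambda>i p. z p i) M i j f) = matop (\<lambda>i p. z p i) M i j (matop z K p q f)"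
proof -
  have "matop z K p q (matop (\<lambda>i p. z p i) M i j f) =
      (\<Sum>l<K. \<Sum>r<M. dop (z p l) (z q l) (dop (z r i) (z r j) f))"
    by (simp add: matop_def lin_sum[OF lin_dop])
  also have "\<dots> = (\<Sum>l<K. \<Sum>r<M. dop (z r i) (z r j) (dop (z p l) (z q l) f)
      + (if r = q then (if l = i then dop (z p i) (z q j) f else 0) else 0)
      - (if r = p then (if l = j then dop (z p i) (z q j) f else 0) else 0))"
    by (intro sum.cong refl) (subst dop_commutator, auto simp: inj)
  also have "\<dots> = (\<Sum>l<K. \<Sum>r<M. dop (z r i) (z r j) (dop (z p l) (z q l) f))"
    using assms(2-5) by (simp add: sum.distrib sum_subtractf)
  also have "\<dots> = matop (\<lambda>i p. z p i) M i j (matop z K p q f)"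
    by (subst sum.swap) (simp add: matop_def lin_sum[OF lin_dop])
  finally show ?thesis .
qed

lemma keys_minus_mon: "Poly_Mapping.keys (m - mon v) \<subseteq> Poly_Mapping.keys m"
  by (auto simp: in_keys_iff lookup_minus)

text \<open>Suppose that \<open>f\<close> stays nonzero when the variables outside \<open>S\<close> are set to 0.  If \<open>f\<close> is invariant under the flow
  of \<open>\<Sum>i. a i \<partial>/\<partial>(b i)\<close> and the flow preserves \<open>S\<close>, the variable \<open>b c\<close> can be eliminated as well:
  the flow moves it to 0 where the pivot \<open>a c\<close> does not vanish.\<close>

lemma slice_step:
  fixes a b :: "nat \<Rightarrow> entry"
  assumes f: "(\<Sum>i\<in>I. dop (a i) (b i) f) = 0" and "finite I" "c \<in> I"
    and b: "\<And>i. i \<in> I \<Longrightarrow> b i = b c \<Longrightarrow> i = c" and ab: "\<And>i. i \<in> I \<Longrightarrow> a i \<noteq> b c"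
    and S: "\<And>i. i \<in> I \<Longrightarrow> a i \<in> S \<Longrightarrow> b i \<in> S" and ac: "a c \<in> S"
    and ex: "\<exists>m. coef f m \<noteq> 0 \<and> Poly_Mapping.keys m \<subseteq> S"
  shows "\<exists>m. coef f m \<noteq> 0 \<and> Poly_Mapping.keys m \<subseteq> S - {b c}"
proof -
  obtain m where m: "coef f m \<noteq> 0" "Poly_Mapping.keys m \<subseteq> S"
    and min: "\<And>l. coef f l \<noteq> 0 \<Longrightarrow> Poly_Mapping.keys l \<subseteq> S \<Longrightarrow> expo m (b c) \<le> expo l (b c)"
    using ex_has_least_nat[of "\<lambda>m. coef f m \<noteq> 0 \<and> Poly_Mapping.keys m \<subseteq> S" _ "\<lambda>m. expo m (b c)"] ex
    by blast
  show ?thesis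
  proof (cases "expo m (b c) = 0")
    case True
    then show ?thesis using m by (auto simp: in_keys_iff)
  next
    case False
    \<comment> \<open>One factor \<open>b c\<close> of \<open>m\<close> is traded for the pivot
      \<open>a c\<close>. In the coefficient of \<open>l\<close> the summand \<open>c\<close>
      contributes a nonzero multiple of \<open>coef f m\<close>; the other summands involve
      monomials over \<open>S\<close> with a smaller exponent of \<open>b c\<close>, whose
      coefficients vanish by minimality.\<close>
    define l where "l = m - mon (b c) + mon (a c)"
    have lS: "Poly_Mapping.keys l \<subseteq> S"
      using keys_add[of "m - mon (b c)" "mon (a c)"] keys_minus_mon[of m "b c"] m(2) ac
      by (auto simp: l_def)
    have "coef (dop (a i) (b i) f) l = 0" if i: "i \<in> I - {c}" for i
    proof (cases "0 < expo l (a i)")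
      case True
      let ?r = "l - mon (a i) + mon (b i)"
      have "a i \<in> S" using True lS by (auto simp: in_keys_iff)
      then have "b i \<in> S" using S i by blast
      then have "Poly_Mapping.keys ?r \<subseteq> S"
        using keys_add[of "l - mon (a i)" "mon (b i)"] keys_minus_mon[of l "a i"] lS by auto
      moreover have "expo ?r (b c) < expo m (b c)"
        using b[of i] ab[of i] ab[of c] i \<open>c \<in> I\<close> False
        by (auto simp: l_def lookup_add lookup_minus expo_mon)
      ultimately have "coef f ?r = 0" using min[of ?r] by force
      then show ?thesis by (simp add: coef_dop)
    qed (simp add: coef_dop)
    then have "coef (\<Sum>i\<in>I. dop (a i) (b i) f) l = coef (dop (a c) (b c) f) l"
      unfolding lookup_sum using \<open>finite I\<close> \<open>c \<in> I\<close> by (subst sum.remove[of _ c]) auto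
    moreover have "l - mon (a c) = m - mon (b c)"
      using mon_diff_add[of "a c" "m - mon (b c)"] by (simp add: l_def add.commute)
    moreover have "m - mon (b c) + mon (b c) = m"
      using mon_add_diff[of m "b c"] False by (simp add: add.commute)
    moreover have "0 < expo l (a c)" by (simp add: l_def lookup_add expo_mon)
    ultimately have False using f m(1) False by (simp add: coef_dop del: of_nat_Suc)
    then show ?thesis ..
  qed
qed

text \<open>Clears a row or column one position \<open>j\<close> after the other, with the pivot
  index \<open>c\<close> kept. Cleared positions are not refilled because \<open>b j i\<close> meets
  \<open>b k c\<close> only for i = c and j = k.\<close>

lemma slice_steps:
  fixes a b :: "nat \<Rightarrow> nat \<Rightarrow> entry"
  assumes "finite J"
    and f: "\<And>j. j \<in> J \<Longrightarrow> (\<Sum>i\<in>I. dop (a j i) (b j i) f) = 0" and I: "finite I" "c \<in> I"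
    and b: "\<And>i j k. i \<in> I \<Longrightarrow> j \<in> J \<Longrightarrow> k \<in> J \<Longrightarrow> b j i = b k c \<Longrightarrow> i = c \<and> j = k"
    and ab: "\<And>i j k. i \<in> I \<Longrightarrow> j \<in> J \<Longrightarrow> k \<in> J \<Longrightarrow> a j i \<noteq> b k c"
    and S: "\<And>i j. i \<in> I \<Longrightarrow> j \<in> J \<Longrightarrow> a j i \<in> S \<Longrightarrow> b j i \<in> S" and ac: "\<And>j. j \<in> J \<Longrightarrow> a j c \<in> S"
    and ex: "\<exists>m. coef f m \<noteq> 0 \<and> Poly_Mapping.keys m \<subseteq> S"
  shows "\<exists>m. coef f m \<noteq> 0 \<and> Poly_Mapping.keys m \<subseteq> S - (\<lambda>j. b j c) ` J"
  using assms(1,2) b ab S ac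
proof (induction J rule: finite_induct)
  case empty
  then show ?case using ex by simp
next
  case (insert j J)
  let ?S = "S - (\<lambda>j. b j c) ` J"
  have "\<exists>m. coef f m \<noteq> 0 \<and> Poly_Mapping.keys m \<subseteq> ?S - {b j c}"
  proof (rule slice_step[where a = "a j" and b = "b j" and I = I])
    show "\<exists>m. coef f m \<noteq> 0 \<and> Poly_Mapping.keys m \<subseteq> ?S"
      by (rule insert.IH) (rule insert.prems; simp)+
    show "b j i \<in> ?S" if "i \<in> I" "a j i \<in> ?S" for i
      using that insert.prems(4)[of i j] insert.prems(2)[of i j] insert.hyps(2) by auto
    show "a j c \<in> ?S"
      using insert.prems(5)[of j] insert.prems(3)[of c j] I(2) by auto
    show "i = c" if "i \<in> I" "b j i = b j c" for i
      using insert.prems(2)[of i j j] that by auto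
    show "a j i \<noteq> b j c" if "i \<in> I" for i
      using insert.prems(3)[of i j j] that by auto
  qed (use I insert.prems(1) in auto)
  moreover have "?S - {b j c} = S - (\<lambda>j. b j c) ` insert j J" by auto
  ultimately show ?case by simp
qed

section \<open>The stacked matrix with its row and column operators\<close>

definition stk :: "nat \<Rightarrow> nat \<Rightarrow> nat \<Rightarrow> entry" where
  "stk n p i = (if p < n then AV p i else XV (p - n) i)"

lemma stk_inj: "stk n p i = stk n q j \<longleftrightarrow> p = q \<and> i = j"
  by (auto simp: stk_def)

lemma entries_stk: "entries N n = {stk n p i | p i. p < n + N \<and> i < N}"
proof (intro equalityI subsetI)
  fix v assume "v \<in> entries N n"
  then consider i j where "v = XV i j" "i < N" "j < N" | a i where "v = AV a i" "a < n" "i < N"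
    by (auto simp: entries_def)
  then show "v \<in> {stk n p i | p i. p < n + N \<and> i < N}"
  proof cases
    case 1
    then have "v = stk n (n + i) j \<and> n + i < n + N \<and> j < N" by (simp add: stk_def)
    then show ?thesis by blast
  next
    case 2
    then have "v = stk n a i \<and> a < n + N \<and> i < N" by (simp add: stk_def)
    then show ?thesis by blast
  qed
qed (auto simp: entries_def stk_def)

lemma gl_op_stk: "gl_op N n p q = matop (stk n) N p q"
  by (rule ext) (auto simp: gl_op_def matop_def opAB_def opAY_def opXB_def opXY_def opX_def opA_def
      opY_def opB_def dop_def stk_def)

locale matrix_poly =
  fixes N n :: nat
begin

abbreviation M :: nat where "M \<equiv> n + N"

abbreviation E :: "nat \<Rightarrow> nat \<Rightarrow> cpoly \<Rightarrow> cpoly" where "E \<equiv> gl_op N n"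

definition F :: "nat \<Rightarrow> nat \<Rightarrow> cpoly \<Rightarrow> cpoly" where
  "F = matop (\<lambda>i p. stk n p i) M"

definition E' :: "nat \<Rightarrow> nat \<Rightarrow> cpoly \<Rightarrow> cpoly" where
  "E' i j = E (n + i) (n + j)"

definition wtE :: "nat \<Rightarrow> (entry \<Rightarrow>\<^sub>0 nat) \<Rightarrow> nat" where
  "wtE p m = (\<Sum>i<N. expo m (stk n p i))"

definition wtF :: "nat \<Rightarrow> (entry \<Rightarrow>\<^sub>0 nat) \<Rightarrow> nat" where
  "wtF i m = (\<Sum>p<M. expo m (stk n p i))"

sublocale E: gl_weight_action E M wtE
proof -
  have eq: "E = matop (stk n) N" by (intro ext) (simp add: gl_op_stk)
  show "gl_weight_action E M wtE"
    unfolding eq wtE_def[abs_def] by (rule matop_weight_action) (rule stk_inj)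
qed

sublocale F: gl_weight_action F N wtF
  unfolding F_def wtF_def[abs_def] by (rule matop_weight_action) (auto simp: stk_inj)

sublocale E': gl_weight_action E' N "\<lambda>i. wtE (n + i)"
proof (intro gl_weight_action.intro gl_action.intro gl_weight_action_axioms.intro)
  show "E' p q (E' r s f) = E' r s (E' p q f) + (if q = r then E' p s f else 0) -
      (if s = p then E' r q f else 0)" if "p < N" "q < N" "r < N" "s < N" for p q r s f
    using E.comm[of "n + p" "n + q" "n + r" "n + s" f] that by (simp add: E'_def)
qed (simp_all add: E'_def E.adj E.coef_diag E.lin_e)

lemma EF_commute: "p < M \<Longrightarrow> q < M \<Longrightarrow> i < N \<Longrightarrow> j < N \<Longrightarrow> E p q (F i j f) = F i j (E p q f)"
  unfolding F_def gl_op_stk by (rule matop_commute_transpose) (auto simp: stk_inj)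

lemma E'F_commute:
  "p < N \<Longrightarrow> q < N \<Longrightarrow> i < N \<Longrightarrow> j < N \<Longrightarrow> E' p q (F i j f) = F i j (E' p q f)"
  by (simp add: E'_def EF_commute)

text \<open>Gaussian elimination at the level of monomials, with pivots \<open>(c, c)\<close>; only rows from \<open>n0\<close> on
  may be added to lower rows.\<close>

lemma pivot_monomial:
  assumes f: "f \<in> poly_ring N n" "f \<noteq> 0"
    and F0: "\<And>i j. i < j \<Longrightarrow> j < N \<Longrightarrow> F i j f = 0"
    and E0: "\<And>p q. n0 \<le> p \<Longrightarrow> p < q \<Longrightarrow> q < M \<Longrightarrow> E p q f = 0"
  shows "\<exists>m. coef f m \<noteq> 0 \<and> Poly_Mapping.keys m \<subseteq>
    {stk n p i | p i. p < M \<and> i < N \<and> (if p < n0 then i \<le> p else i < n0 \<or> i = p)}"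
proof -
  \<comment> \<open>The positions left after the pivots below \<open>c\<close>: a processed row has
    no entry right of the diagonal, and a processed column with index at least \<open>n0\<close>
    keeps only its diagonal entry.\<close>
  define P where "P c p i \<longleftrightarrow> p < M \<and> i < N \<and>
    (if p < n0 then i \<le> p \<or> c \<le> p else i < n0 \<or> i = p \<or> c \<le> p \<and> c \<le> i)" for c p i
  define S where "S c = {stk n p i | p i. P c p i}" for c
  have S_iff: "stk n p i \<in> S c \<longleftrightarrow> P c p i" for p i c by (simp add: S_def stk_inj)
  have "\<exists>m. coef f m \<noteq> 0 \<and> Poly_Mapping.keys m \<subseteq> S c" if "c \<le> N" for c
    using that
  proof (induction c)
    case 0
    obtain m where m: "coef f m \<noteq> 0" using nonzero_coef[OF f(2)] by blast
    have "S 0 = entries N n" by (auto simp: S_def P_def entries_stk)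
    then have "Poly_Mapping.keys m \<subseteq> S 0"
      using f(1) m by (simp add: poly_ring_def in_keys_iff)
    then show ?case using m by blast
  next
    case (Suc c)
    then have c: "c < N" by simp
    \<comment> \<open>Row \<open>c\<close> clears the column below the pivot if row operations from
      it are allowed; then column \<open>c\<close> clears the row to the right of the pivot in
      either case.\<close>
    define T where "T = (if n0 \<le> c then S c - (\<lambda>q. stk n q c) ` {c<..<M} else S c)"
    have T_iff: "stk n p i \<in> T \<longleftrightarrow> P c p i \<and> \<not> (n0 \<le> c \<and> i = c \<and> c < p)" for p i
      by (auto simp: T_def S_iff stk_inj P_def)
    have T: "\<exists>m. coef f m \<noteq> 0 \<and> Poly_Mapping.keys m \<subseteq> T"
    proof (cases "n0 \<le> c")
      case True
      have "\<exists>m. coef f m \<noteq> 0 \<and> Poly_Mapping.keys m \<subseteq> S c - (\<lambda>q. stk n q c) ` {c<..<M}"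
      proof (rule slice_steps[where a = "\<lambda>q i. stk n c i" and I = "{..<N}"])
        show "(\<Sum>i<N. dop (stk n c i) (stk n q i) f) = 0" if "q \<in> {c<..<M}" for q
          using E0[of c q] True that by (simp add: gl_op_stk matop_def)
        show "\<exists>m. coef f m \<noteq> 0 \<and> Poly_Mapping.keys m \<subseteq> S c"
          using Suc by simp
        show "stk n q i \<in> S c" if "q \<in> {c<..<M}" "stk n c i \<in> S c" for i q
          using that True by (auto simp: S_iff P_def)
        show "stk n c c \<in> S c" using c True by (simp add: S_iff P_def)
      qed (use c in \<open>simp_all add: stk_inj\<close>)
      then show ?thesis using True by (simp add: T_def)
    next
      case False
      then show ?thesis using Suc by (simp add: T_def)
    qed
    have "\<exists>m. coef f m \<noteq> 0 \<and> Poly_Mapping.keys m \<subseteq> T - (\<lambda>j. stk n c j) ` {c<..<N}"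
    proof (rule slice_steps[where a = "\<lambda>j p. stk n p c" and b = "\<lambda>j p. stk n p j" and I = "{..<M}"])
      show "(\<Sum>p<M. dop (stk n p c) (stk n p j) f) = 0" if "j \<in> {c<..<N}" for j
        using F0[of c j] that by (simp add: F_def matop_def)
      show "stk n p j \<in> T" if "p \<in> {..<M}" "j \<in> {c<..<N}" "stk n p c \<in> T" for p j
        using that unfolding T_iff P_def by (auto split: if_splits)
      show "stk n c c \<in> T" using c unfolding T_iff P_def by auto
      show "\<exists>m. coef f m \<noteq> 0 \<and> Poly_Mapping.keys m \<subseteq> T" by (rule T)
    qed (use c in \<open>simp_all add: stk_inj\<close>)
    moreover have "T - (\<lambda>j. stk n c j) ` {c<..<N} \<subseteq> S (Suc c)"
    proof
      fix v assume v: "v \<in> T - (\<lambda>j. stk n c j) ` {c<..<N}"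
      then have "v \<in> S c" by (auto simp: T_def split: if_splits)
      then obtain p i where pi: "v = stk n p i" by (auto simp: S_def)
      have "P c p i" "\<not> (n0 \<le> c \<and> i = c \<and> c < p)" "\<not> (p = c \<and> c < i)"
        using v unfolding pi Diff_iff T_iff by (auto simp: P_def)
      then have "P (Suc c) p i" by (auto simp: P_def split: if_splits)
      then show "v \<in> S (Suc c)" unfolding pi S_iff .
    qed
    ultimately show ?case by (meson subset_trans)
  qed
  then obtain m where m: "coef f m \<noteq> 0" "Poly_Mapping.keys m \<subseteq> S N" by blast
  have "S N \<subseteq> {stk n p i | p i. p < M \<and> i < N \<and> (if p < n0 then i \<le> p else i < n0 \<or> i = p)}"
    unfolding S_def
  proof (intro Collect_mono impI, elim exE conjE)
    fix v p i assume "v = stk n p i" "P N p i"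
    then have "v = stk n p i \<and> p < M \<and> i < N \<and> (if p < n0 then i \<le> p else i < n0 \<or> i = p)"
      by (auto simp: P_def split: if_splits)
    then show "\<exists>p i. v = stk n p i \<and> p < M \<and> i < N \<and> (if p < n0 then i \<le> p else i < n0 \<or> i = p)"
      by blast
  qed
  then show ?thesis using m by blast
qed

text \<open>With \<open>n0 = 0\<close> the surviving monomial contains diagonal variables only, so
  its row and column degrees coincide, and rows from N on are empty.\<close>

lemma joint_weight_eq:
  assumes f: "f \<in> poly_ring N n" "f \<noteq> 0"
    and E: "E.hw (\<lambda>p. of_nat (c p)) f" and F: "F.hw (\<lambda>p. of_nat (d p)) f" and p: "p < M"
  shows "c p = (if p < N then d p else 0)"
proof -
  obtain m where m: "coef f m \<noteq> 0" "Poly_Mapping.keys m \<subseteq> {stk n p i | p i. p < M \<and> i < N \<and> i = p}"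
    using pivot_monomial[OF f, of 0] E.hw_raise[OF E] F.hw_raise[OF F] by auto
  have off: "expo m (stk n p i) = 0" if "p \<noteq> i" for p i
    using m(2) that by (auto simp: stk_inj simp flip: not_in_keys_iff_lookup_eq_zero)
  have "c p = wtE p m"
    using E.wvec_wt[of c f p m] E m(1) p by (auto simp: E.hw_def E.wvec_def)
  also have "\<dots> = (\<Sum>i<N. if i = p then expo m (stk n p p) else 0)"
    unfolding wtE_def by (rule sum.cong) (auto simp: off)
  also have "\<dots> = (if p < N then expo m (stk n p p) else 0)" by simp
  finally have c: "c p = (if p < N then expo m (stk n p p) else 0)" .
  have "d p = expo m (stk n p p)" if "p < N"
  proof -
    have "d p = wtF p m"
      using F.wvec_wt[of d f p m] F m(1) that by (auto simp: F.hw_def F.wvec_def)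
    also have "\<dots> = (\<Sum>i<M. if i = p then expo m (stk n p p) else 0)"
      unfolding wtF_def by (rule sum.cong) (auto simp: off)
    finally show ?thesis using p by simp
  qed
  then show ?thesis using c by simp
qed

text \<open>With \<open>n0 = n\<close>, column i + n of the surviving monomial contains only its
  diagonal variable. This lies in row i of X, so the column degree \<open>d (i + n)\<close> is one
  summand of the row degree \<open>c i\<close>.\<close>

lemma interlacing:
  assumes f: "f \<in> poly_ring N n" "f \<noteq> 0"
    and E': "E'.hw (\<lambda>p. of_nat (c p)) f" and F: "F.hw (\<lambda>p. of_nat (d p)) f" and i: "i + n < N"
  shows "d (i + n) \<le> c i"
proof -
  have E0: "E p q f = 0" if "n \<le> p" "p < q" "q < M" for p q
    using E'.hw_raise[OF E', of "p - n" "q - n"] that by (simp add: E'_def)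
  obtain m where m: "coef f m \<noteq> 0"
    "Poly_Mapping.keys m \<subseteq> {stk n p i | p i. p < M \<and> i < N \<and> (if p < n then i \<le> p else i < n \<or> i = p)}"
    using pivot_monomial[OF f, of n] E0 F.hw_raise[OF F] by auto
  have off: "expo m (stk n p (i + n)) = 0" if "p \<noteq> i + n" for p
    using m(2) that by (auto simp: stk_inj simp flip: not_in_keys_iff_lookup_eq_zero split: if_splits)
  have "d (i + n) = wtF (i + n) m"
    using F.wvec_wt[of d f "i + n" m] F m(1) i by (auto simp: F.hw_def F.wvec_def)
  also have "\<dots> = (\<Sum>p<M. if p = i + n then expo m (stk n (i + n) (i + n)) else 0)"
    unfolding wtF_def by (rule sum.cong) (auto simp: off)
  also have "\<dots> = expo m (stk n (n + i) (i + n))" using i by (simp add: add.commute)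
  also have "\<dots> \<le> wtE (n + i) m"
    unfolding wtE_def using i by (intro member_le_sum) auto
  also have "wtE (n + i) m = c i"
    using E'.wvec_wt[of c f i m] E' m(1) i by (auto simp: E'.hw_def E'.wvec_def)
  finally show ?thesis .
qed

end


section \<open>Isotypic components\<close>

lemma normalize_ip:
  assumes "y \<noteq> 0" shows "\<exists>c. c \<noteq> 0 \<and> ip (smult_poly c y) (smult_poly c y) = 1"
proof -
  obtain r where r: "r > 0" "ip y y = of_real r" using ip_self[OF assms] by blast
  have "(1 / sqrt r) * ((1 / sqrt r) * r) = 1"
    using r(1) by (simp add: real_div_sqrt)
  then have "complex_of_real ((1 / sqrt r) * ((1 / sqrt r) * r)) = 1" by simp
  then have "ip (smult_poly (of_real (1 / sqrt r)) y) (smult_poly (of_real (1 / sqrt r)) y) = 1"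
    by (simp only: ip_smult_left ip_smult_right complex_cnj_complex_of_real r(2) of_real_mult)
  moreover have "complex_of_real (1 / sqrt r) \<noteq> 0" using r(1) by simp
  ultimately show ?thesis by blast
qed

lemma sum_mult_delta: "finite B \<Longrightarrow> b \<in> B \<Longrightarrow> (\<Sum>a\<in>B. h a * (if a = b then 1 else 0)) = (h b :: complex)"
proof -
  assume B: "finite B" "b \<in> B"
  have "(\<Sum>a\<in>B. h a * (if a = b then 1 else 0)) = (\<Sum>a\<in>B. if a = b then h a else 0)"
    by (rule sum.cong) auto
  then show ?thesis using B by simp
qed

text \<open>Gram-Schmidt by induction on the set of permitted monomials: the vectors without the
  monomial \<open>m\<close> form a subspace of codimension at most one, so at most one basis vector
  is added.\<close>

lemma orthonormal_basis:
  assumes "finite K" and "cpoly.subspace V" and "V \<subseteq> {x. Poly_Mapping.keys x \<subseteq> K}"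
  shows "\<exists>B. finite B \<and> B \<subseteq> V \<and> (\<forall>b\<in>B. \<forall>b'\<in>B. ip b b' = (if b = b' then 1 else 0)) \<and>
    (\<forall>x\<in>V. x = (\<Sum>b\<in>B. smult_poly (ip x b) b))"
  using assms
proof (induction K arbitrary: V rule: finite_induct)
  case empty
  then have "V \<subseteq> {0}"
    by (auto intro!: poly_mapping_eqI simp flip: not_in_keys_iff_lookup_eq_zero)
  then show ?case by (intro exI[of _ "{}"]) auto
next
  case (insert m K)
  define U where "U = {x \<in> V. coef x m = 0}"
  have subU: "cpoly.subspace U"
    using insert.prems(1) unfolding cpoly.subspace_def
    by (auto simp: U_def lookup_add lookup_smult_poly)
  have "U \<subseteq> {x. Poly_Mapping.keys x \<subseteq> K}"
    using insert.prems(2) by (auto simp: U_def in_keys_iff)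
  from insert.IH[OF subU this] obtain B where B: "finite B" "B \<subseteq> U"
    and on: "\<forall>b\<in>B. \<forall>b'\<in>B. ip b b' = (if b = b' then 1 else 0)"
    and ex: "\<forall>x\<in>U. x = (\<Sum>b\<in>B. smult_poly (ip x b) b)"
    by (elim exE conjE) (rule that)
  have BV: "B \<subseteq> V" using B(2) by (auto simp: U_def)
  show ?case
  proof (cases "U = V")
    case True
    then show ?thesis using B on ex by (intro exI[of _ B] conjI) simp_all
  next
    case False
    then obtain x where x: "x \<in> V" "coef x m \<noteq> 0" by (auto simp: U_def)
    define y where "y = x - (\<Sum>b\<in>B. smult_poly (ip x b) b)"
    have "(\<Sum>b\<in>B. smult_poly (ip x b) b) \<in> U"
      using B(2) by (intro cpoly.subspace_sum cpoly.subspace_scale subU) auto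
    then have y: "y \<in> V" "coef y m \<noteq> 0"
      using x cpoly.subspace_diff[OF insert.prems(1)] by (auto simp: y_def U_def lookup_minus)
    then have y0: "y \<noteq> 0" by auto
    have yB: "ip y b = 0" if "b \<in> B" for b
      using that B(1) by (simp add: y_def ip_diff_left ip_sum_left ip_smult_left on sum_mult_delta)
    obtain c where c: "c \<noteq> 0" "ip (smult_poly c y) (smult_poly c y) = 1"
      using normalize_ip[OF y0] by blast
    define u where "u = smult_poly c y"
    have u: "u \<in> V" "coef u m \<noteq> 0" "ip u u = 1"
      using y c cpoly.subspace_scale[OF insert.prems(1)] by (auto simp: u_def lookup_smult_poly)
    have uB: "ip u b = 0" "ip b u = 0" if "b \<in> B" for b
      using yB[OF that] ip_commute[of u b] by (auto simp: u_def ip_smult_left)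
    have "u \<notin> B" using uB(1)[of u] u(3) by auto
    have "z = (\<Sum>b\<in>insert u B. smult_poly (ip z b) b)" if z: "z \<in> V" for z
    proof -
      define t where "t = coef z m / coef u m"
      have "z - smult_poly t u \<in> U"
        using z u cpoly.subspace_diff[OF insert.prems(1)] cpoly.subspace_scale[OF insert.prems(1)]
        by (auto simp: U_def t_def lookup_minus lookup_smult_poly)
      from bspec[OF ex this] have "z - smult_poly t u = (\<Sum>b\<in>B. smult_poly (ip z b) b)"
        using uB by (simp add: ip_diff_left ip_smult_left)
      then have z_eq: "z = smult_poly t u + (\<Sum>b\<in>B. smult_poly (ip z b) b)"
        by (simp add: algebra_simps)
      have "ip z u = t"
        by (subst z_eq) (simp add: ip_add_left ip_smult_left ip_sum_left uB u(3))
      moreover have "(\<Sum>b\<in>insert u B. smult_poly (ip z b) b) =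
          smult_poly (ip z u) u + (\<Sum>b\<in>B. smult_poly (ip z b) b)"
        using \<open>u \<notin> B\<close> B(1) by simp
      ultimately show ?thesis using z_eq by argo
    qed
    moreover have "ip b b' = (if b = b' then 1 else 0)" if "b \<in> insert u B" "b' \<in> insert u B" for b b'
      using that on uB u(3) \<open>u \<notin> B\<close> by auto
    ultimately show ?thesis
      using B(1) BV u(1) by (intro exI[of _ "insert u B"] conjI ballI) blast+
  qed
qed

lemma subspace_keys: "cpoly.subspace {f. Poly_Mapping.keys f \<subseteq> K}"
  unfolding cpoly.subspace_def
proof (intro conjI ballI allI)
  fix x y :: cpoly and c
  assume "x \<in> {f. Poly_Mapping.keys f \<subseteq> K}" "y \<in> {f. Poly_Mapping.keys f \<subseteq> K}"
  then show "x + y \<in> {f. Poly_Mapping.keys f \<subseteq> K}" using keys_add[of x y] by auto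
next
  fix x :: cpoly and c
  assume "x \<in> {f. Poly_Mapping.keys f \<subseteq> K}"
  then show "smult_poly c x \<in> {f. Poly_Mapping.keys f \<subseteq> K}" using keys_smult_subset[of c x] by auto
qed simp

section \<open>Finite-dimensional pieces of bounded degree\<close>

context matrix_poly
begin

text \<open>Bounding the total degree leaves finitely many monomials, so that
  \<open>orthonormal_basis\<close> applies; E and F respect the bound.\<close>

definition mons :: "nat \<Rightarrow> (entry \<Rightarrow>\<^sub>0 nat) set" where
  "mons D = {m. Poly_Mapping.keys m \<subseteq> entries N n \<and> (\<Sum>v\<in>entries N n. expo m v) \<le> D}"

definition polyD :: "nat \<Rightarrow> cpoly set" where
  "polyD D = {f. Poly_Mapping.keys f \<subseteq> mons D}"

lemma finite_entries: "finite (entries N n)"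
proof -
  have "entries N n = (\<lambda>(p, i). stk n p i) ` ({..<M} \<times> {..<N})"
    by (auto simp: entries_stk)
  then show ?thesis by simp
qed

lemma finite_mons: "finite (mons D)"
proof (rule finite_imageD)
  have "restrict (expo m) (entries N n) \<in> entries N n \<rightarrow>\<^sub>E {..D}" if "m \<in> mons D" for m
  proof (rule restrict_PiE_iff[THEN iffD2], rule ballI)
    fix v assume "v \<in> entries N n"
    then have "expo m v \<le> (\<Sum>v\<in>entries N n. expo m v)"
      using finite_entries by (intro member_le_sum) auto
    then show "expo m v \<in> {..D}" using that by (simp add: mons_def)
  qed
  then have "(\<lambda>m. restrict (expo m) (entries N n)) ` mons D \<subseteq> entries N n \<rightarrow>\<^sub>E {..D}" by blast
  then show "finite ((\<lambda>m. restrict (expo m) (entries N n)) ` mons D)"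
    by (rule finite_subset) (simp add: finite_PiE finite_entries)
  show "inj_on (\<lambda>m. restrict (expo m) (entries N n)) (mons D)"
  proof (rule inj_onI)
    fix l m assume lm: "l \<in> mons D" "m \<in> mons D"
      and eq: "restrict (expo l) (entries N n) = restrict (expo m) (entries N n)"
    show "l = m"
    proof (rule poly_mapping_eqI)
      fix v
      show "expo l v = expo m v"
      proof (cases "v \<in> entries N n")
        case True
        then show ?thesis using fun_cong[OF eq, of v] by simp
      next
        case False
        then have "v \<notin> Poly_Mapping.keys l" "v \<notin> Poly_Mapping.keys m" using lm by (auto simp: mons_def)
        then show ?thesis by (simp add: in_keys_iff)
      qed
    qed
  qed
qed

lemma subspace_polyD: "cpoly.subspace (polyD D)"
  unfolding polyD_def by (rule subspace_keys)

lemma subspace_poly_ring: "cpoly.subspace (poly_ring N n)"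
proof -
  have "poly_ring N n = {f. Poly_Mapping.keys f \<subseteq> {m. Poly_Mapping.keys m \<subseteq> entries N n}}"
    by (auto simp: poly_ring_def)
  then show ?thesis using subspace_keys by simp
qed

lemma polyD_poly_ring: "polyD D \<subseteq> poly_ring N n"
  by (auto simp: polyD_def mons_def poly_ring_def)

lemma poly_ring_polyD:
  assumes "f \<in> poly_ring N n" shows "\<exists>D. f \<in> polyD D"
proof
  let ?D = "\<Sum>m\<in>Poly_Mapping.keys f. \<Sum>v\<in>entries N n. expo m v"
  have "(\<Sum>v\<in>entries N n. expo m v) \<le> ?D" if "m \<in> Poly_Mapping.keys f" for m
    using that by (intro member_le_sum) auto
  then show "f \<in> polyD ?D" using assms by (auto simp: polyD_def mons_def poly_ring_def)
qed

lemma dop_keys: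
  assumes "m \<in> Poly_Mapping.keys (dop a b f)"
  shows "0 < expo m a \<and> m - mon a + mon b \<in> Poly_Mapping.keys f"
  using assms by (auto simp: in_keys_iff coef_dop split: if_splits)

lemma dop_poly_ring:
  assumes "a \<in> entries N n" "f \<in> poly_ring N n" shows "dop a b f \<in> poly_ring N n"
proof -
  have "Poly_Mapping.keys m \<subseteq> entries N n" if "m \<in> Poly_Mapping.keys (dop a b f)" for m
  proof -
    have "Poly_Mapping.keys (m - mon a + mon b) \<subseteq> entries N n"
      using dop_keys[OF that] assms(2) by (auto simp: poly_ring_def)
    moreover have "Poly_Mapping.keys m \<subseteq> insert a (Poly_Mapping.keys (m - mon a + mon b))"
      by (auto simp: in_keys_iff lookup_add lookup_minus expo_mon split: if_splits)
    ultimately show ?thesis using assms(1) by auto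
  qed
  then show ?thesis by (auto simp: poly_ring_def)
qed

lemma dop_polyD:
  assumes ab: "a \<in> entries N n" "b \<in> entries N n" and f: "f \<in> polyD D" shows "dop a b f \<in> polyD D"
proof -
  have "m \<in> mons D" if m: "m \<in> Poly_Mapping.keys (dop a b f)" for m
  proof -
    let ?l = "m - mon a + mon b"
    have l: "0 < expo m a" "?l \<in> mons D" using dop_keys[OF m] f by (auto simp: polyD_def)
    \<comment> \<open>A unit is added on each side to avoid the truncated subtraction in
      \<open>?l\<close>.\<close>
    have "(\<Sum>v\<in>entries N n. expo ?l v + (if v = a then 1 else 0)) =
        (\<Sum>v\<in>entries N n. expo m v + (if v = b then 1 else 0))"
      using l(1) by (intro sum.cong) (auto simp: lookup_add lookup_minus expo_mon)
    then have "(\<Sum>v\<in>entries N n. expo ?l v) = (\<Sum>v\<in>entries N n. expo m v)"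
      using ab finite_entries by (simp add: sum.distrib)
    moreover have "Poly_Mapping.keys m \<subseteq> entries N n"
      using dop_poly_ring[OF ab(1), of f b] polyD_poly_ring f m by (auto simp: poly_ring_def)
    ultimately show ?thesis using l(2) by (simp add: mons_def)
  qed
  then show ?thesis by (auto simp: polyD_def)
qed

lemma stk_entries: "p < M \<Longrightarrow> i < N \<Longrightarrow> stk n p i \<in> entries N n"
  by (auto simp: entries_stk)

lemma E_polyD: "p < M \<Longrightarrow> q < M \<Longrightarrow> f \<in> polyD D \<Longrightarrow> E p q f \<in> polyD D"
  unfolding gl_op_stk matop_def
  by (rule cpoly.subspace_sum[OF subspace_polyD]) (auto intro!: dop_polyD stk_entries)

lemma F_polyD: "i < N \<Longrightarrow> j < N \<Longrightarrow> f \<in> polyD D \<Longrightarrow> F i j f \<in> polyD D"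
  unfolding F_def matop_def
  by (rule cpoly.subspace_sum[OF subspace_polyD]) (auto intro!: dop_polyD stk_entries)

lemma E_poly_ring: "p < M \<Longrightarrow> q < M \<Longrightarrow> f \<in> poly_ring N n \<Longrightarrow> E p q f \<in> poly_ring N n"
  using poly_ring_polyD E_polyD polyD_poly_ring by blast

lemma F_poly_ring: "i < N \<Longrightarrow> j < N \<Longrightarrow> f \<in> poly_ring N n \<Longrightarrow> F i j f \<in> poly_ring N n"
  using poly_ring_polyD F_polyD polyD_poly_ring by blast

lemma gl_submodule_iff:
  "gl_submodule N n W \<longleftrightarrow> cpoly.subspace W \<and> W \<subseteq> poly_ring N n \<and> E.stable W"
  by (auto simp: gl_submodule_def E.stable_def)

lemma highest_weight_vector_iff:
  "highest_weight_vector N n lam v \<longleftrightarrow> v \<noteq> 0 \<and> E.hw (\<lambda>p. of_nat (lam (Suc p))) v"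
  by (simp add: highest_weight_vector_def E.hw_def)

lemma low_poly_ring: "v \<in> poly_ring N n \<Longrightarrow> E.low v \<subseteq> poly_ring N n"
  by (rule E.low_subset) (auto simp: E.stable_def subspace_poly_ring E_poly_ring)

lemma gl_irreducible_low:
  assumes v: "v \<in> poly_ring N n" "v \<noteq> 0" "E.hw (\<lambda>p. of_nat (c p)) v"
  shows "gl_irreducible N n (E.low v)"
  unfolding gl_irreducible_def gl_submodule_iff
proof (intro conjI allI impI)
  show "E.low v \<noteq> {0}" using E.low.base[of v] v(2) by auto
  fix U assume "(cpoly.subspace U \<and> U \<subseteq> poly_ring N n \<and> E.stable U) \<and> U \<subseteq> E.low v"
  then show "U = {0} \<or> U = E.low v"
    using E.low_irreducible[OF v(3), of U] cpoly.subspace_0[of U] by blast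
qed (use v E.subspace_low low_poly_ring E.stable_low in auto)

lemma gl_irreducible_eq_low:
  assumes "gl_irreducible N n W" "v \<in> W" "v \<noteq> 0" "E.hw (\<lambda>p. of_nat (c p)) v"
  shows "W = E.low v"
proof -
  have W: "cpoly.subspace W" "W \<subseteq> poly_ring N n" "E.stable W"
    and irr: "\<And>U. gl_submodule N n U \<Longrightarrow> U \<subseteq> W \<Longrightarrow> U = {0} \<or> U = W"
    using assms(1) by (auto simp: gl_irreducible_def gl_submodule_iff)
  have sub: "E.low v \<subseteq> W" using E.low_subset W assms(2) by blast
  moreover have "gl_submodule N n (E.low v)"
    using sub W(2) E.stable_low[OF assms(4)] E.subspace_low by (auto simp: gl_submodule_iff)
  ultimately show ?thesis using irr E.low.base[of v] assms(3) by blast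
qed

section \<open>Decomposition of the polynomial ring into isotypic components\<close>

abbreviation Iso :: "(nat \<Rightarrow> nat) \<Rightarrow> cpoly set" where
  "Iso \<equiv> isotypic_summand N n"

text \<open>The vector 0 is included, so that F maps this set into itself.\<close>

definition hwvs :: "(nat \<Rightarrow> nat) \<Rightarrow> cpoly set" where
  "hwvs lam = {v \<in> poly_ring N n. E.hw (\<lambda>p. of_nat (lam (Suc p))) v}"

text \<open>An irreducible submodule is the lowering span of any highest weight vector in it, and
  conversely. Unlike irreducible submodules, lowering spans permit the inductions below.\<close>

lemma Iso_span: "Iso lam = cpoly.span (\<Union>v\<in>hwvs lam. E.low v)"
proof
  have "W \<subseteq> (\<Union>v\<in>hwvs lam. E.low v)"
    if "gl_irreducible N n W" "v \<in> W" "highest_weight_vector N n lam v" for W v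
  proof -
    have "v \<in> hwvs lam"
      using that by (auto simp: hwvs_def highest_weight_vector_iff gl_irreducible_def gl_submodule_iff)
    then show ?thesis
      using gl_irreducible_eq_low[OF that(1,2)] that(3) by (auto simp: highest_weight_vector_iff)
  qed
  then show "Iso lam \<subseteq> cpoly.span (\<Union>v\<in>hwvs lam. E.low v)"
    unfolding isotypic_summand_def by (intro cpoly.span_mono) blast
  have "E.low v \<subseteq> Iso lam" if "v \<in> hwvs lam" for v
  proof (cases "v = 0")
    case True
    have "E.low 0 \<subseteq> {0}"
      by (rule E.low_subset) (auto simp: E.stable_def lin_zero[OF E.lin_e] cpoly.subspace_def)
    then show ?thesis using True cpoly.span_zero by (auto simp: isotypic_summand_def)
  next
    case False
    then have "gl_irreducible N n (E.low v)" "highest_weight_vector N n lam v"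
      using that gl_irreducible_low by (auto simp: hwvs_def highest_weight_vector_iff)
    then show ?thesis
      unfolding isotypic_summand_def using E.low.base[of v] by (intro subset_trans[OF _ cpoly.span_superset]) blast
  qed
  then show "cpoly.span (\<Union>v\<in>hwvs lam. E.low v) \<subseteq> Iso lam"
    by (intro cpoly.span_minimal) (auto simp: isotypic_summand_def)
qed

lemma subspace_Iso: "cpoly.subspace (Iso lam)"
  by (simp add: isotypic_summand_def)

lemma low_Iso: "v \<in> hwvs lam \<Longrightarrow> x \<in> E.low v \<Longrightarrow> x \<in> Iso lam"
  unfolding Iso_span by (rule cpoly.span_base) blast

lemma Iso_induct [consumes 1, case_names subspace low]:
  assumes "x \<in> Iso lam" "cpoly.subspace {x. P x}"
    and "\<And>v x. v \<in> hwvs lam \<Longrightarrow> x \<in> E.low v \<Longrightarrow> P x"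
  shows "P x"
  using assms(1) unfolding Iso_span
  by (rule cpoly.span_induct) (use assms in auto)

lemma Iso_poly_ring: "Iso lam \<subseteq> poly_ring N n"
proof
  fix x assume "x \<in> Iso lam"
  then show "x \<in> poly_ring N n"
    by (induction rule: Iso_induct) (use low_poly_ring subspace_poly_ring in \<open>auto simp: hwvs_def\<close>)
qed

lemma subspace_lin_vimage: "lin T \<Longrightarrow> cpoly.subspace W \<Longrightarrow> cpoly.subspace {x. T x \<in> W}"
  by (auto simp: cpoly.subspace_def lin_zero lin_add lin_smult)

lemma Iso_E: "x \<in> Iso lam \<Longrightarrow> p < M \<Longrightarrow> q < M \<Longrightarrow> E p q x \<in> Iso lam"
proof (induction rule: Iso_induct)
  case subspace
  then show ?case
    by (cases "p < M \<and> q < M")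
      (auto intro!: subspace_lin_vimage E.lin_e subspace_Iso)
next
  case (low v x)
  then show ?case using E.low_closed[of _ v x p q] low_Iso[of v lam] by (auto simp: hwvs_def)
qed

lemma hwvs_F: "v \<in> hwvs lam \<Longrightarrow> i < N \<Longrightarrow> j < N \<Longrightarrow> F i j v \<in> hwvs lam"
  by (auto simp: hwvs_def F_poly_ring E.hw_def EF_commute lin_zero[OF F.lin_e] lin_smult[OF F.lin_e])

text \<open>As F commutes with E, it maps the lowering span of \<open>v\<close> into that of
  \<open>F i j v\<close>, which is again in \<open>hwvs lam\<close>.\<close>

lemma Iso_F: "x \<in> Iso lam \<Longrightarrow> i < N \<Longrightarrow> j < N \<Longrightarrow> F i j x \<in> Iso lam"
proof (induction rule: Iso_induct)
  case subspace
  then show ?case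
    by (cases "i < N \<and> j < N")
      (auto intro!: subspace_lin_vimage F.lin_e subspace_Iso)
next
  case (low v x)
  have "F i j x \<in> E.low (F i j v)"
    using low(2)
    by induction (auto simp: EF_commute[symmetric] low lin_add[OF F.lin_e] lin_smult[OF F.lin_e]
        intro: E.low.intros)
  then show ?case using hwvs_F low low_Iso by blast
qed

lemma Iso_orth_hw:
  assumes "E.hw (\<lambda>p. of_nat (c p)) u" "p < M" "c p \<noteq> lam (Suc p)" "x \<in> Iso lam" "y \<in> E.low u"
  shows "ip x y = 0"
  using assms(4)
proof (induction rule: Iso_induct)
  case subspace
  show ?case by (auto simp: cpoly.subspace_def ip_add_left ip_smult_left)
next
  case (low v x)
  then have v: "E.hw (\<lambda>p. of_nat (lam (Suc p))) v" by (simp add: hwvs_def)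
  have "ip v u = 0" using E.hw_orth[OF v assms(1,2)] assms(3) by simp
  then show ?case using E.low_orth[OF v assms(1) _ low(2) assms(5)] by simp
qed

lemma Iso_orth:
  assumes "lam \<in> partitions N" "mu \<in> partitions N" "lam \<noteq> mu" "x \<in> Iso lam" "y \<in> Iso mu"
  shows "ip x y = 0"
proof -
  obtain i where i: "lam i \<noteq> mu i" using assms(3) by auto
  then have "i \<in> {1..N}" using assms(1,2) unfolding partitions_def by (metis (mono_tags, lifting) mem_Collect_eq)
  then have p: "i - 1 < M" "Suc (i - 1) = i" by auto
  show ?thesis
    using assms(5)
  proof (induction rule: Iso_induct)
    case subspace
    show ?case by (auto simp: cpoly.subspace_def ip_add_right ip_smult_right)
  next
    case (low v y)
    then have "E.hw (\<lambda>p. of_nat (mu (Suc p))) v" by (simp add: hwvs_def)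
    from Iso_orth_hw[OF this p(1) _ assms(4) low(2)] show ?case using i p(2) by simp
  qed
qed

lemma Iso_hw_weight:
  assumes "u \<in> Iso lam" "u \<noteq> 0" "E.hw (\<lambda>p. of_nat (c p)) u" "p < M"
  shows "c p = lam (Suc p)"
  using Iso_orth_hw[OF assms(3,4) _ assms(1) E.low.base] assms(2) ip_self_eq_0 by blast

text \<open>The F-highest vectors of weight \<open>d\<close> in the component form an E-module. A
  joint highest weight vector in it has E-weight \<open>lam\<close> and F-weight \<open>d\<close>,
  which agree by \<open>joint_weight_eq\<close>.\<close>

lemma Iso_F_weight:
  assumes x: "x \<in> Iso lam" "x \<noteq> 0" "F.hw (\<lambda>p. of_nat (d p)) x" and p: "p < N"
  shows "d p = lam (Suc p)"
proof -
  let ?Q = "{y \<in> Iso lam. F.hw (\<lambda>p. of_nat (d p)) y}"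
  have "cpoly.subspace ?Q"
    using subspace_Iso[of lam] unfolding cpoly.subspace_def F.hw_def
    by (auto simp: lin_add[OF F.lin_e] lin_smult[OF F.lin_e] lin_zero[OF F.lin_e]
        cpoly.scale_right_distrib mult.commute)
  moreover have "E.stable ?Q"
    by (auto simp: E.stable_def Iso_E F.hw_def EF_commute[symmetric] lin_zero[OF E.lin_e] lin_smult[OF E.lin_e])
  ultimately obtain u c where u: "u \<in> Iso lam" "F.hw (\<lambda>p. of_nat (d p)) u" "u \<noteq> 0"
    "E.hw (\<lambda>p. of_nat (c p)) u"
    using E.hw_exists[of ?Q] x by blast
  have "p < M" using p by simp
  then show ?thesis
    using Iso_hw_weight[OF u(1,3,4)] joint_weight_eq[OF _ u(3,4,2)] u(1) Iso_poly_ring p by fastforce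
qed

text \<open>Monotonicity is \<open>hw_dominant\<close>. That the weight vanishes from N on is seen
  on a joint highest weight vector in the F-module of E-highest vectors of weight
  \<open>c\<close>.\<close>

lemma hw_partition:
  assumes u: "u \<in> poly_ring N n" "u \<noteq> 0" "E.hw (\<lambda>p. of_nat (c p)) u"
  shows "\<exists>lam\<in>partitions N. u \<in> hwvs lam"
proof -
  define lam where "lam i = (if 1 \<le> i \<and> i \<le> N then c (i - 1) else 0)" for i
  have zero: "c p = 0" if "N \<le> p" "p < M" for p
  proof -
    let ?Q = "{y \<in> poly_ring N n. E.hw (\<lambda>p. of_nat (c p)) y}"
    have "cpoly.subspace ?Q"
      using subspace_poly_ring unfolding cpoly.subspace_def E.hw_def
      by (auto simp: lin_add[OF E.lin_e] lin_smult[OF E.lin_e] lin_zero[OF E.lin_e]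
          cpoly.scale_right_distrib mult.commute)
    moreover have "F.stable ?Q"
      by (auto simp: F.stable_def F_poly_ring E.hw_def EF_commute lin_zero[OF F.lin_e] lin_smult[OF F.lin_e])
    ultimately obtain w d where "w \<in> poly_ring N n" "E.hw (\<lambda>p. of_nat (c p)) w" "w \<noteq> 0"
      "F.hw (\<lambda>p. of_nat (d p)) w"
      using F.hw_exists[of ?Q] u by blast
    from joint_weight_eq[OF this(1,3,2,4) that(2)] show ?thesis using that by simp
  qed
  have "c q \<le> c p" if "p < q" "q < M" for p q using E.hw_dominant[OF u(3,2) that] .
  then have "lam j \<le> lam i" if "i \<in> {1..N}" "j \<in> {1..N}" "i \<le> j" for i j
    using that by (cases "i = j") (auto simp: lam_def)
  then have "lam \<in> partitions N" by (auto simp: partitions_def lam_def)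
  moreover have "lam (Suc p) = c p" if "p < M" for p
    using zero[of p] that by (auto simp: lam_def)
  then have "u \<in> hwvs lam" using u by (auto simp: hwvs_def E.hw_def)
  ultimately show ?thesis by blast
qed

text \<open>The part of \<open>f\<close> orthogonal to the span, taken within a bounded degree, lies
  in an E-stable complement. Were it nonzero, this complement would contain a highest weight vector,
  which belongs to the span.\<close>

lemma poly_ring_span_Iso:
  assumes "f \<in> poly_ring N n"
  shows "f \<in> cpoly.span (\<Union>lam\<in>partitions N. Iso lam)"
proof -
  obtain D where D: "f \<in> polyD D" using poly_ring_polyD[OF assms] by blast
  define S where "S = polyD D \<inter> cpoly.span (\<Union>lam\<in>partitions N. Iso lam)"
  have subS: "cpoly.subspace S"
    unfolding S_def by (intro cpoly.subspace_inter subspace_polyD cpoly.subspace_span)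
  have ES: "E p q x \<in> S" if "p < M" "q < M" "x \<in> S" for p q x
  proof -
    have "x \<in> cpoly.span (\<Union>lam\<in>partitions N. Iso lam)" using that by (simp add: S_def)
    then have "E p q x \<in> cpoly.span (\<Union>lam\<in>partitions N. Iso lam)"
    proof (rule cpoly.span_induct)
      show "cpoly.subspace {x. E p q x \<in> cpoly.span (\<Union>lam\<in>partitions N. Iso lam)}"
        by (intro subspace_lin_vimage E.lin_e that cpoly.subspace_span)
    qed (use Iso_E[OF _ that(1,2)] in \<open>auto intro!: cpoly.span_base\<close>)
    then show ?thesis using that E_polyD by (simp add: S_def)
  qed
  have "S \<subseteq> {x. Poly_Mapping.keys x \<subseteq> mons D}" by (auto simp: S_def polyD_def)
  from orthonormal_basis[OF finite_mons subS this] obtain B where B: "finite B" "B \<subseteq> S"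
    "\<forall>b\<in>B. \<forall>b'\<in>B. ip b b' = (if b = b' then 1 else 0)"
    "\<forall>x\<in>S. x = (\<Sum>b\<in>B. smult_poly (ip x b) b)"
    by (elim exE conjE) (rule that)
  define s where "s = (\<Sum>b\<in>B. smult_poly (ip f b) b)"
  have s: "s \<in> S" unfolding s_def using B(2) by (intro cpoly.subspace_sum cpoly.subspace_scale subS) auto
  let ?Q = "{x \<in> polyD D. \<forall>y\<in>S. ip x y = 0}"
  have fs: "f - s \<in> ?Q"
  proof -
    have "ip (f - s) b = 0" if "b \<in> B" for b
      using that B(1,3) by (simp add: s_def ip_diff_left ip_sum_left ip_smult_left sum_mult_delta)
    then have "ip (f - s) (\<Sum>b\<in>B. smult_poly (ip y b) b) = 0" for y
      by (simp add: ip_sum_right ip_smult_right)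
    then have "ip (f - s) y = 0" if "y \<in> S" for y using bspec[OF B(4) that] by metis
    then show ?thesis
      using D s cpoly.subspace_diff[OF subspace_polyD] by (simp add: S_def)
  qed
  have "f = s"
  proof (rule ccontr)
    assume "f \<noteq> s"
    then have "f - s \<noteq> 0" by simp
    then have "\<exists>x\<in>?Q. x \<noteq> 0" using fs by blast
    moreover have "cpoly.subspace ?Q"
      using subspace_polyD[of D] unfolding cpoly.subspace_def
      by (auto simp: ip_add_left ip_smult_left)
    moreover have "E.stable ?Q"
      using ES by (auto simp: E.stable_def E_polyD E.adj)
    ultimately obtain u c where u: "u \<in> ?Q" "u \<noteq> 0" "E.hw (\<lambda>p. of_nat (c p)) u"
      using E.hw_exists[of ?Q] by blast
    then obtain lam where "lam \<in> partitions N" "u \<in> hwvs lam"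
      using hw_partition[of u c] polyD_poly_ring by blast
    then have "u \<in> cpoly.span (\<Union>lam\<in>partitions N. Iso lam)"
      using low_Iso[OF _ E.low.base, of u lam] by (intro cpoly.span_base) blast
    then have "u \<in> S" using u(1) by (simp add: S_def)
    then have "ip u u = 0" using u(1) by simp
    then show False using u(2) by (simp add: ip_self_eq_0)
  qed
  then show ?thesis using s by (simp add: S_def)
qed

lemma Iso_decomposition:
  assumes "f \<in> poly_ring N n"
  shows "\<exists>g L. finite L \<and> L \<subseteq> partitions N \<and> (\<forall>lam\<in>L. g lam \<in> Iso lam) \<and> f = sum g L"
  using poly_ring_span_Iso[OF assms]
proof (induction rule: cpoly.span_induct_alt)
  case base
  show ?case by (intro exI[of _ "\<lambda>_. 0"] exI[of _ "{}"]) simp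
next
  case (step c x y)
  obtain mu where mu: "mu \<in> partitions N" "x \<in> Iso mu" using step.hyps by blast
  obtain g L where g: "finite L" "L \<subseteq> partitions N" "\<And>lam. lam \<in> L \<Longrightarrow> g lam \<in> Iso lam" "y = sum g L"
    using step.IH by blast
  define h where "h lam = (if lam \<in> L then g lam else 0) + (if lam = mu then smult_poly c x else 0)" for lam
  have "sum h (insert mu L) = (\<Sum>lam\<in>insert mu L. if lam \<in> L then g lam else 0) + smult_poly c x"
    using g(1) by (simp add: h_def sum.distrib)
  also have "(\<Sum>lam\<in>insert mu L. if lam \<in> L then g lam else 0) = sum g L"
    using g(1) by (intro sum.mono_neutral_cong_right) auto
  finally have "smult_poly c x + y = sum h (insert mu L)" using g(4) by simp
  moreover have "h lam \<in> Iso lam" if "lam \<in> insert mu L" for lam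
    using g(3) mu(2) subspace_Iso[of lam]
    by (auto simp: h_def cpoly.subspace_0 intro!: cpoly.subspace_add cpoly.subspace_scale)
  ultimately show ?case using g(1,2) mu(1)
    by (intro exI[of _ h] exI[of _ "insert mu L"]) auto
qed

lemma Iso_independent:
  assumes "finite L" "L \<subseteq> partitions N" "\<And>lam. lam \<in> L \<Longrightarrow> g lam \<in> Iso lam" "sum g L = 0" "mu \<in> L"
  shows "g mu = 0"
proof -
  have "ip (g mu) (g lam) = (if lam = mu then ip (g mu) (g mu) else 0)" if "lam \<in> L" for lam
    using Iso_orth[of mu lam "g mu" "g lam"] assms that by auto
  then have "ip (g mu) (sum g L) = (\<Sum>lam\<in>L. if lam = mu then ip (g mu) (g mu) else 0)"
    unfolding ip_sum_right by (intro sum.cong) auto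
  then have "ip (g mu) (sum g L) = ip (g mu) (g mu)" using assms(1,5) by simp
  then show ?thesis using assms(4) by (simp add: ip_self_eq_0)
qed

end


section \<open>The Casimir operators\<close>

lemma of_nat_mult_smult: "of_nat k * f = smult_poly (of_nat k) f"
  by (simp add: smult_conv_mult)

lemma smult_sum_left: "smult_poly (sum c A) f = (\<Sum>a\<in>A. smult_poly (c a) f)"
  by (rule cpoly.scale_sum_left)

text \<open>The summand is the value of \<open>E p q (E q p v)\<close> on a highest weight vector.
  \<open>l p\<close> occurs positively for m - 1 - p values of q and negatively p times.\<close>

lemma casimir_sum:
  fixes l :: "nat \<Rightarrow> complex"
  shows "(\<Sum>p<m. \<Sum>q<m. if p < q then l p - l q else if p = q then (l p)\<^sup>2 else 0) =
    (\<Sum>p<m. (l p)\<^sup>2 + (of_nat m - 1 - 2 * of_nat p) * l p)"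
proof (induction m)
  case (Suc m)
  let ?g = "\<lambda>p q. if p < q then l p - l q else if p = q then (l p)\<^sup>2 else 0"
  have "(\<Sum>p<Suc m. \<Sum>q<Suc m. ?g p q) = (\<Sum>p<m. (\<Sum>q<m. ?g p q) + (l p - l m)) + (l m)\<^sup>2"
    by simp
  also have "\<dots> = (\<Sum>p<m. ((l p)\<^sup>2 + (of_nat m - 1 - 2 * of_nat p) * l p) + l p) - of_nat m * l m + (l m)\<^sup>2"
    by (simp only: sum.distrib Suc.IH sum_subtractf) simp
  also have "\<dots> = (\<Sum>p<Suc m. (l p)\<^sup>2 + (of_nat (Suc m) - 1 - 2 * of_nat p) * l p)"
    by (simp add: algebra_simps sum.distrib sum_subtractf)
  finally show ?case .
qed simp

context matrix_poly
begin

definition CE :: "cpoly \<Rightarrow> cpoly" where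
  "CE f = (\<Sum>p<M. \<Sum>q<M. E p q (E q p f))"

definition CF :: "cpoly \<Rightarrow> cpoly" where
  "CF f = (\<Sum>i<N. \<Sum>j<N. F i j (F j i f))"

definition Eu :: "cpoly \<Rightarrow> cpoly" where
  "Eu f = (\<Sum>i<N. F i i f)"

lemma Eu_E: "Eu f = (\<Sum>p<M. E p p f)"
  unfolding Eu_def F_def gl_op_stk matop_def by (rule sum.swap)

text \<open>After normal ordering both Casimir operators have the same second-order part; the
  first-order parts are M and N times the Euler operator.\<close>

lemma casimir_relation: "CE f = CF f + smult_poly (of_nat n) (Eu f)"
proof -
  define T where "T p q i j = var (stk n p i) * (var (stk n q j) *
    pdiff (stk n q i) (pdiff (stk n p j) f))" for p q i j
  define D where "D p i = dop (stk n p i) (stk n p i) f" for p i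
  have Eu: "Eu f = (\<Sum>p<M. \<Sum>i<N. D p i)"
    by (simp add: Eu_E gl_op_stk matop_def D_def)
  have "E p q (E q p f) = (\<Sum>i<N. D p i) + (\<Sum>i<N. \<Sum>j<N. T p q i j)" for p q
  proof -
    have "E p q (E q p f) = (\<Sum>i<N. \<Sum>j<N. (if i = j then D p i else 0) + T p q i j)"
      by (simp add: gl_op_stk matop_def lin_sum[OF lin_dop] dop_dop stk_inj D_def T_def cong: if_cong)
    then show ?thesis by (simp add: sum.distrib)
  qed
  then have "CE f = (\<Sum>p<M. \<Sum>q<M. \<Sum>i<N. D p i) + (\<Sum>p<M. \<Sum>q<M. \<Sum>i<N. \<Sum>j<N. T p q i j)"
    by (simp add: CE_def sum.distrib)
  also have "(\<Sum>p<M. \<Sum>q<M. \<Sum>i<N. D p i) = of_nat M * Eu f"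
    unfolding Eu by (subst sum.swap) simp
  finally have CE: "CE f = of_nat M * Eu f + (\<Sum>p<M. \<Sum>q<M. \<Sum>i<N. \<Sum>j<N. T p q i j)" .
  have "F i j (F j i f) = (\<Sum>p<M. D p i) + (\<Sum>p<M. \<Sum>q<M. T p q i j)" for i j
  proof -
    have "F i j (F j i f) = (\<Sum>p<M. \<Sum>q<M. (if p = q then D p i else 0) + T p q i j)"
      by (simp add: F_def matop_def lin_sum[OF lin_dop] dop_dop stk_inj D_def T_def
          pdiff_commute[of "stk n _ j"] cong: if_cong)
    then show ?thesis by (simp add: sum.distrib)
  qed
  then have "CF f = (\<Sum>i<N. \<Sum>j<N. \<Sum>p<M. D p i) + (\<Sum>i<N. \<Sum>j<N. \<Sum>p<M. \<Sum>q<M. T p q i j)"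
    by (simp add: CF_def sum.distrib)
  also have "(\<Sum>i<N. \<Sum>j<N. \<Sum>p<M. D p i) = of_nat N * (\<Sum>i<N. \<Sum>p<M. D p i)"
    by (subst sum.swap) simp
  also have "(\<Sum>i<N. \<Sum>p<M. D p i) = Eu f" unfolding Eu by (rule sum.swap)
  also have "(\<Sum>i<N. \<Sum>j<N. \<Sum>p<M. \<Sum>q<M. T p q i j) = (\<Sum>i<N. \<Sum>p<M. \<Sum>j<N. \<Sum>q<M. T p q i j)"
    by (rule sum.cong[OF refl]) (rule sum.swap)
  also have "\<dots> = (\<Sum>p<M. \<Sum>i<N. \<Sum>j<N. \<Sum>q<M. T p q i j)" by (rule sum.swap)
  also have "\<dots> = (\<Sum>p<M. \<Sum>i<N. \<Sum>q<M. \<Sum>j<N. T p q i j)"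
    by (intro sum.cong[OF refl]) (rule sum.swap)
  also have "\<dots> = (\<Sum>p<M. \<Sum>q<M. \<Sum>i<N. \<Sum>j<N. T p q i j)"
    by (intro sum.cong[OF refl]) (rule sum.swap)
  finally show ?thesis
    unfolding CE by (simp add: of_nat_mult_smult[symmetric] algebra_simps)
qed

lemma lin_CF: "lin CF"
  unfolding CF_def[abs_def] by (rule lin_sumI)+ (simp add: lin_comp[OF F.lin_e F.lin_e])

lemma lin_Eu: "lin Eu"
  unfolding Eu_def[abs_def] by (rule lin_sumI) (simp add: F.lin_e)

lemma CF_E:
  assumes "p < M" "q < M" shows "CF (E p q f) = E p q (CF f)"
  unfolding CF_def lin_sum[OF E.lin_e[OF assms]]
  by (intro sum.cong refl) (simp add: EF_commute assms)

lemma Eu_E_commute: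
  assumes "p < M" "q < M" shows "Eu (E p q f) = E p q (Eu f)"
  unfolding Eu_def lin_sum[OF E.lin_e[OF assms]]
  by (intro sum.cong refl) (simp add: EF_commute assms)

text \<open>An operator commuting with E is determined on a lowering span by its value on the
  generator.\<close>

lemma Iso_scalar:
  assumes T: "lin T" "\<And>p q f. p < M \<Longrightarrow> q < M \<Longrightarrow> T (E p q f) = E p q (T f)"
    and hw: "\<And>v. v \<in> hwvs lam \<Longrightarrow> T v = smult_poly c v" and "x \<in> Iso lam"
  shows "T x = smult_poly c x"
  using assms(4)
proof (induction rule: Iso_induct)
  case subspace
  show ?case
    unfolding cpoly.subspace_def
    by (auto simp: lin_zero[OF T(1)] lin_add[OF T(1)] lin_smult[OF T(1)] cpoly.scale_right_distrib mult.commute)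
next
  case (low v x)
  show ?case
    using low(2)
    by induction (auto simp: hw low(1) T lin_add[OF T(1)] lin_smult[OF T(1)] lin_smult[OF E.lin_e]
        cpoly.scale_right_distrib mult.commute)
qed

lemma Iso_Eu:
  assumes "lam \<in> partitions N" "x \<in> Iso lam"
  shows "Eu x = smult_poly (\<Sum>p<N. of_nat (lam (Suc p))) x"
proof (rule Iso_scalar[OF lin_Eu Eu_E_commute _ assms(2)])
  fix v assume v: "v \<in> hwvs lam"
  have zero: "lam (Suc p) = 0" if "N \<le> p" for p using assms(1) that by (simp add: partitions_def)
  have "Eu v = (\<Sum>p<M. smult_poly (of_nat (lam (Suc p))) v)"
    unfolding Eu_E using v by (intro sum.cong) (auto simp: hwvs_def E.hw_def)
  also have "\<dots> = (\<Sum>p<N. smult_poly (of_nat (lam (Suc p))) v)"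
    by (rule sum.mono_neutral_right) (auto simp: zero)
  finally show "Eu v = smult_poly (\<Sum>p<N. of_nat (lam (Suc p))) v"
    by (simp add: smult_sum_left)
qed

text \<open>The generators of the component are highest for E and not for F, so the scalar is
  computed for \<open>CE\<close> and transported by \<open>casimir_relation\<close>.\<close>

lemma Iso_CF:
  assumes lam: "lam \<in> partitions N" and x: "x \<in> Iso lam"
  shows "CF x = smult_poly
    (\<Sum>p<N. (of_nat (lam (Suc p)))\<^sup>2 + (of_nat N - 1 - 2 * of_nat p) * of_nat (lam (Suc p))) x"
proof (rule Iso_scalar[OF lin_CF CF_E _ x])
  fix v assume v: "v \<in> hwvs lam"
  define l :: "nat \<Rightarrow> complex" where "l p = of_nat (lam (Suc p))" for p
  have hw: "E.hw l v" using v by (simp add: hwvs_def l_def[abs_def])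
  have zero: "l p = 0" if "N \<le> p" for p using lam that by (simp add: partitions_def l_def)
  have "E p q (E q p v) = smult_poly (if p < q then l p - l q else if p = q then (l p)\<^sup>2 else 0) v"
    if "p < M" "q < M" for p q
  proof -
    consider "p < q" | "p = q" | "q < p" by linarith
    then show ?thesis
    proof cases
      case 1
      then show ?thesis
        using E.comm[OF that that(2,1), of v] E.hw_raise[OF hw 1 that(2)] E.hw_cartan[OF hw] that
        by (simp add: smult_sub lin_zero[OF E.lin_e])
    next
      case 2
      then show ?thesis
        using E.hw_cartan[OF hw that(1)] lin_smult[OF E.lin_e[OF that(1,1)]] by (simp add: power2_eq_square)
    next
      case 3
      then show ?thesis using E.hw_raise[OF hw 3 that(1)] lin_zero[OF E.lin_e] that by simp
    qed
  qed
  then have "CE v = smult_poly (\<Sum>p<M. \<Sum>q<M. if p < q then l p - l q else if p = q then (l p)\<^sup>2 else 0) v"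
    by (simp add: CE_def smult_sum_left)
  then have CE: "CE v = smult_poly (\<Sum>p<M. (l p)\<^sup>2 + (of_nat M - 1 - 2 * of_nat p) * l p) v"
    by (simp only: casimir_sum)
  have Eu: "Eu v = smult_poly (\<Sum>p<M. l p) v"
    unfolding Eu_E smult_sum_left by (rule sum.cong) (auto simp: E.hw_cartan[OF hw])
  have "CF v = CE v - smult_poly (of_nat n) (Eu v)" by (simp add: casimir_relation)
  also have "\<dots> = smult_poly (\<Sum>p<M. (l p)\<^sup>2 + (of_nat N - 1 - 2 * of_nat p) * l p) v"
  proof -
    have "(\<Sum>p<M. (l p)\<^sup>2 + (of_nat M - 1 - 2 * of_nat p) * l p) - of_nat n * (\<Sum>p<M. l p) =
        (\<Sum>p<M. (l p)\<^sup>2 + (of_nat N - 1 - 2 * of_nat p) * l p)"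
      unfolding sum_distrib_left sum_subtractf[symmetric]
      by (rule sum.cong) (auto simp: algebra_simps)
    then show ?thesis unfolding CE Eu cpoly.scale_scale smult_sub[symmetric] by simp
  qed
  also have "(\<Sum>p<M. (l p)\<^sup>2 + (of_nat N - 1 - 2 * of_nat p) * l p) =
      (\<Sum>p<N. (l p)\<^sup>2 + (of_nat N - 1 - 2 * of_nat p) * l p)"
    by (rule sum.mono_neutral_right) (auto simp: zero)
  finally show "CF v = smult_poly
    (\<Sum>p<N. (of_nat (lam (Suc p)))\<^sup>2 + (of_nat N - 1 - 2 * of_nat p) * of_nat (lam (Suc p))) v"
    by (simp add: l_def)
qed

text \<open>The infinitesimal form of the covariance condition.\<close>

definition lie_cov :: "nat \<Rightarrow> cpoly \<Rightarrow> bool" where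
  "lie_cov k f \<longleftrightarrow> (\<forall>i<N. \<forall>j<N. F i j f = E' j i f + (if i = j then smult_poly (of_nat k) f else 0))"

lemma H_CS_E': "H_CS N f = (\<Sum>i<N. \<Sum>j<N. E' i j (E' j i f))"
  by (simp add: H_CS_def E'_def[abs_def] gl_op_def[abs_def])

text \<open>Covariance trades E' for F only when E' stands next to \<open>f\<close>. Commuting the
  new F to the left brings the second E' there; both exchanges together turn
  \<open>E' i j (E' j i f)\<close> into \<open>F i j (F j i f)\<close> up to terms in k.\<close>

lemma H_CS_lie_cov:
  assumes f: "lie_cov k f"
  shows "H_CS N f = CF f - smult_poly (2 * of_nat k) (Eu f) + smult_poly (of_nat k ^ 2 * of_nat N) f"
proof -
  have E'_eq: "E' j i f = F i j f - (if i = j then smult_poly (of_nat k) f else 0)" if "i < N" "j < N" for i j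
    using f that by (auto simp: lie_cov_def)
  have "E' i j (E' j i f) = F i j (F j i f) - (if i = j then smult_poly (2 * of_nat k) (F i i f)
      - smult_poly (of_nat k ^ 2) f else 0)" if ij: "i < N" "j < N" for i j
  proof -
    have "E' i j (E' j i f) = E' i j (F i j f) - (if i = j then smult_poly (of_nat k) (E' i i f) else 0)"
      using ij by (simp add: E'_eq lin_diff[OF E'.lin_e] lin_smult[OF E'.lin_e] lin_zero[OF E'.lin_e])
    also have "E' i j (F i j f) = F i j (E' i j f)" using ij by (simp add: E'F_commute)
    also have "\<dots> = F i j (F j i f) - (if i = j then smult_poly (of_nat k) (F i i f) else 0)"
      using ij by (auto simp: E'_eq lin_diff[OF F.lin_e] lin_smult[OF F.lin_e] lin_zero[OF F.lin_e])
    also have "\<dots> - (if i = j then smult_poly (of_nat k) (E' i i f) else 0) =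
        F i j (F j i f) - (if i = j then smult_poly (2 * of_nat k) (F i i f)
      - smult_poly (of_nat k ^ 2) f else 0)"
    proof (cases "i = j")
      case True
      have "smult_poly (2 * of_nat k) (F i i f) = smult_poly (of_nat k) (F i i f) + smult_poly (of_nat k) (F i i f)"
        unfolding mult_2 by (rule cpoly.scale_left_distrib)
      then show ?thesis
        using ij True by (simp add: E'_eq cpoly.scale_right_diff_distrib power2_eq_square)
    qed simp
    finally show ?thesis .
  qed
  then have "H_CS N f = (\<Sum>i<N. \<Sum>j<N. F i j (F j i f) - (if i = j then smult_poly (2 * of_nat k) (F i i f)
      - smult_poly (of_nat k ^ 2) f else 0))"
    by (simp add: H_CS_E')
  also have "\<dots> = CF f - (\<Sum>i<N. smult_poly (2 * of_nat k) (F i i f) - smult_poly (of_nat k ^ 2) f)"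
    by (simp add: sum_subtractf CF_def)
  also have "\<dots> = CF f - smult_poly (2 * of_nat k) (Eu f) + smult_poly (of_nat k ^ 2 * of_nat N) f"
    by (simp add: sum_subtractf Eu_def cpoly.scale_sum_right of_nat_mult_smult mult.commute)
  finally show ?thesis .
qed

lemma H_CS_eigenvalue:
  assumes lam: "lam \<in> partitions N" and f: "f \<in> Iso lam" "lie_cov k f"
  shows "H_CS N f = smult_poly (of_int (\<Sum>i = 1..N. (int (lam i) - int k) *
    (int (lam i) - int k + int N + 1 - 2 * int i))) f"
proof -
  let ?l = "\<lambda>p. int (lam (Suc p))"
  \<comment> \<open>At m = N this vanishes, which allows the linear terms to be rewritten in lam -
    k; the general m serves the induction.\<close>
  have zero: "(\<Sum>p<m. int N - 1 - 2 * int p) = int m * (int N - int m)" for m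
    by (induction m) (auto simp: algebra_simps)
  have "H_CS N f = smult_poly (of_int ((\<Sum>p<N. (?l p)\<^sup>2 + (int N - 1 - 2 * int p) * ?l p)
      - 2 * int k * (\<Sum>p<N. ?l p) + (int k)\<^sup>2 * int N)) f"
    by (simp add: H_CS_lie_cov[OF f(2)] Iso_CF[OF lam f(1)] Iso_Eu[OF lam f(1)]
        cpoly.scale_left_distrib cpoly.scale_left_diff_distrib)
  also have "(\<Sum>p<N. (?l p)\<^sup>2 + (int N - 1 - 2 * int p) * ?l p) - 2 * int k * (\<Sum>p<N. ?l p) + (int k)\<^sup>2 * int N =
      (\<Sum>p<N. (?l p)\<^sup>2 + (int N - 1 - 2 * int p) * ?l p - 2 * int k * ?l p + (int k)\<^sup>2)
        - int k * (\<Sum>p<N. int N - 1 - 2 * int p)"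
    unfolding zero by (simp add: sum.distrib sum_subtractf sum_distrib_left)
  also have "\<dots> = (\<Sum>p<N. (?l p - int k) * (?l p - int k + int N + 1 - 2 * int (Suc p)))"
    unfolding sum_distrib_left sum_subtractf[symmetric]
    by (rule sum.cong) (auto simp: algebra_simps power2_eq_square)
  also have "\<dots> = (\<Sum>i = 1..N. (int (lam i) - int k) * (int (lam i) - int k + int N + 1 - 2 * int i))"
    by (rule sum.reindex_bij_witness[of _ "\<lambda>i. i - 1" Suc]) auto
  finally show ?thesis .
qed

end


section \<open>Evaluation and derivatives\<close>

lemma cpoly_sum_monomials: "(\<Sum>m\<in>Poly_Mapping.keys f. Poly_Mapping.single m (coef f m)) = f"
  by (rule poly_mapping_eqI) (simp add: lookup_sum lookup_single when_def in_keys_iff)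

lemma var_mult_single: "var v * Poly_Mapping.single m c = Poly_Mapping.single (mon v + m) c"
  by (simp add: var_def mult_single)

text \<open>\<open>V\<close> confines the variables, as needed for the chain rule
  \<open>ev_has_derivative\<close> over finitely many of them.\<close>

lemma cpoly_induct [consumes 1, case_names const var add]:
  assumes "\<forall>m\<in>Poly_Mapping.keys f. Poly_Mapping.keys m \<subseteq> V"
    and const: "\<And>c. P (Poly_Mapping.single 0 c)"
    and var: "\<And>v f. v \<in> V \<Longrightarrow> P f \<Longrightarrow> P (var v * f)"
    and add: "\<And>f g. P f \<Longrightarrow> P g \<Longrightarrow> P (f + g)"
  shows "P f"
proof -
  have mono: "P (Poly_Mapping.single m c)" if "Poly_Mapping.keys m \<subseteq> V" for m c
    using that
  proof (induction "\<Sum>v\<in>Poly_Mapping.keys m. expo m v" arbitrary: m rule: less_induct)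
    case less
    show ?case
    proof (cases "m = 0")
      case False
      then obtain v where v: "expo m v \<noteq> 0" by (metis poly_mapping_eqI lookup_zero)
      let ?l = "m - mon v"
      have k: "Poly_Mapping.keys ?l \<subseteq> Poly_Mapping.keys m" by (rule keys_minus_mon)
      have "(\<Sum>w\<in>Poly_Mapping.keys ?l. expo ?l w) = (\<Sum>w\<in>Poly_Mapping.keys m. expo ?l w)"
        by (rule sum.mono_neutral_left[OF _ k]) (auto simp: in_keys_iff)
      also have "\<dots> < (\<Sum>w\<in>Poly_Mapping.keys m. expo m w)"
        by (rule sum_strict_mono_ex1)
          (use v in \<open>auto simp: lookup_minus expo_mon in_keys_iff intro!: bexI[of _ v]\<close>)
      finally have "P (Poly_Mapping.single ?l c)" using less k by blast
      moreover have "v \<in> V" using v less.prems by (auto simp: in_keys_iff)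
      ultimately have "P (var v * Poly_Mapping.single ?l c)" by (rule var[rotated])
      then show ?thesis using v by (simp add: var_mult_single mon_add_diff)
    qed (simp add: const)
  qed
  have "P (\<Sum>m\<in>K. Poly_Mapping.single m (coef f m))" if "finite K" "K \<subseteq> Poly_Mapping.keys f" for K
    using that
  proof (induction K rule: finite_induct)
    case empty
    show ?case using const[of 0] by simp
  next
    case (insert m K)
    then show ?case using add[OF mono] assms(1) by simp
  qed
  from this[of "Poly_Mapping.keys f"] show ?thesis by (simp add: cpoly_sum_monomials)
qed

lemma cpoly_induct_UNIV [case_names const var add]:
  assumes "\<And>c. P (Poly_Mapping.single 0 c)" "\<And>v f. P f \<Longrightarrow> P (var v * f)"
    "\<And>f g. P f \<Longrightarrow> P g \<Longrightarrow> P (f + g)"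
  shows "P f"
  by (rule cpoly_induct[of f UNIV]) (use assms in auto)

lemma pdiff_mult: "pdiff v (f * g) = pdiff v f * g + f * pdiff v g"
proof (induction f rule: cpoly_induct_UNIV)
  case (const c)
  have "pdiff v (Poly_Mapping.single 0 c) = 0"
    by (rule poly_mapping_eqI) (auto simp: coef_pdiff lookup_single when_def
        dest: arg_cong[of _ _ "\<lambda>m. expo m v"] simp: lookup_add expo_mon)
  then show ?case using lin_smult[OF lin_pdiff, of v c g] by (simp add: smult_conv_mult)
qed (simp_all add: lin_add[OF lin_pdiff] pdiff_var_mult mult.assoc distrib_left distrib_right)

text \<open>Evaluation at an arbitrary assignment instead of a pair of matrices, so that
  one-parameter groups become curves of assignments.\<close>

definition ev :: "cpoly \<Rightarrow> (entry \<Rightarrow> complex) \<Rightarrow> complex" where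
  "ev f x = (\<Sum>m\<in>Poly_Mapping.keys f. coef f m * (\<Prod>v\<in>Poly_Mapping.keys m. x v ^ expo m v))"

lemma eval_poly_ev: "eval_poly f X A = ev f (entry_value X A)"
  by (simp add: eval_poly_def ev_def)

lemma ev_superset: "finite K \<Longrightarrow> Poly_Mapping.keys f \<subseteq> K \<Longrightarrow>
  ev f x = (\<Sum>m\<in>K. coef f m * (\<Prod>v\<in>Poly_Mapping.keys m. x v ^ expo m v))"
  unfolding ev_def by (rule sum.mono_neutral_left) (auto simp: in_keys_iff)

lemma ev_add: "ev (f + g) x = ev f x + ev g x"
proof -
  let ?K = "Poly_Mapping.keys f \<union> Poly_Mapping.keys g"
  show ?thesis
    using ev_superset[of ?K f x] ev_superset[of ?K g x] ev_superset[of ?K "f + g" x] keys_add[of f g]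
    by (simp add: lookup_add distrib_right sum.distrib)
qed

lemma ev_zero [simp]: "ev 0 x = 0"
  by (simp add: ev_def)

lemma ev_sum: "ev (sum f A) x = (\<Sum>a\<in>A. ev (f a) x)"
  by (induction A rule: infinite_finite_induct) (simp_all add: ev_add)

lemma ev_diff: "ev (f - g) x = ev f x - ev g x"
  by (metis add_diff_cancel diff_add_cancel ev_add)

lemma ev_const: "ev (Poly_Mapping.single 0 c) x = c"
  by (cases "c = 0") (simp_all add: ev_def)

lemma monomial_value_add: "(\<Prod>w\<in>Poly_Mapping.keys (mon v + m). x w ^ expo (mon v + m) w) =
  x v * (\<Prod>w\<in>Poly_Mapping.keys m. x w ^ expo m w :: complex)"
proof -
  let ?E = "insert v (Poly_Mapping.keys m)"
  have "(\<Prod>w\<in>Poly_Mapping.keys (mon v + m). x w ^ expo (mon v + m) w) =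
      (\<Prod>w\<in>?E. x w ^ expo (mon v + m) w)"
    using keys_add[of "mon v" m] by (intro prod.mono_neutral_left) (auto simp: in_keys_iff)
  also have "\<dots> = (\<Prod>w\<in>?E. (if w = v then x v else 1) * x w ^ expo m w)"
    by (rule prod.cong) (auto simp: lookup_add expo_mon)
  also have "\<dots> = x v * (\<Prod>w\<in>?E. x w ^ expo m w)"
    by (subst prod.distrib) simp
  also have "(\<Prod>w\<in>?E. x w ^ expo m w) = (\<Prod>w\<in>Poly_Mapping.keys m. x w ^ expo m w)"
    by (rule prod.mono_neutral_right) (auto simp: in_keys_iff)
  finally show ?thesis .
qed

lemma ev_var_mult: "ev (var v * f) x = x v * ev f x"
proof -
  have "ev (var v * Poly_Mapping.single m c) x = x v * ev (Poly_Mapping.single m c) x" for m c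
    by (cases "c = 0") (simp_all add: var_mult_single ev_def monomial_value_add)
  then have "ev (var v * (\<Sum>m\<in>K. Poly_Mapping.single m (coef f m))) x =
      x v * ev (\<Sum>m\<in>K. Poly_Mapping.single m (coef f m)) x" for K
    by (simp add: sum_distrib_left ev_sum)
  from this[of "Poly_Mapping.keys f"] show ?thesis by (simp add: cpoly_sum_monomials)
qed

lemma ev_smult: "ev (smult_poly c f) x = c * ev f x"
proof (induction f rule: cpoly_induct_UNIV)
  case (const d)
  show ?case by (simp add: smult_conv_mult mult_single ev_const)
qed (simp_all add: ev_add cpoly.scale_right_distrib distrib_left ev_var_mult flip: mult_smult_right)

lemma ev_mult: "ev (f * g) x = ev f x * ev g x"
proof (induction f rule: cpoly_induct_UNIV)
  case (const c)
  show ?case using ev_smult[of c g x] by (simp add: smult_conv_mult ev_const)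
qed (simp_all add: ev_add distrib_right ev_var_mult mult.assoc)

lemma ev_var: "ev (var v) x = x v"
  using ev_var_mult[of v 1 x] ev_const[of 1 x] by simp

lemma ev_cong:
  assumes "\<forall>m\<in>Poly_Mapping.keys f. Poly_Mapping.keys m \<subseteq> V" and "\<And>v. v \<in> V \<Longrightarrow> x v = y v"
  shows "ev f x = ev f y"
  using assms(1)
  by (induction rule: cpoly_induct) (simp_all add: ev_const ev_var_mult ev_add assms(2))

lemma ev_has_derivative:
  assumes "finite V" and "\<forall>m\<in>Poly_Mapping.keys f. Poly_Mapping.keys m \<subseteq> V"
    and x: "\<And>v. v \<in> V \<Longrightarrow> ((\<lambda>t. x t v) has_field_derivative d v) (at t)"
  shows "((\<lambda>t. ev f (x t)) has_field_derivative (\<Sum>v\<in>V. d v * ev (pdiff v f) (x t))) (at t)"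
  using assms(2)
proof (induction rule: cpoly_induct)
  case (const c)
  have "pdiff v (Poly_Mapping.single 0 c) = 0" for v
    using pdiff_mult[of v "Poly_Mapping.single 0 c" 1] pdiff_mult[of v 1 1]
      lin_smult[OF lin_pdiff, of v c 1] by (simp add: smult_conv_mult)
  then show ?case by (simp add: ev_const)
next
  case (var w f)
  have "(\<Sum>v\<in>V. d v * ev (pdiff v (var w * f)) (x t)) =
      (\<Sum>v\<in>V. (if v = w then d w * ev f (x t) else 0) + x t w * (d v * ev (pdiff v f) (x t)))"
    by (rule sum.cong) (auto simp: pdiff_var_mult ev_add ev_var_mult distrib_left mult.left_commute)
  also have "\<dots> = d w * ev f (x t) + (\<Sum>v\<in>V. d v * ev (pdiff v f) (x t)) * x t w"
    using \<open>finite V\<close> var(1) by (simp add: sum.distrib sum_distrib_left mult.commute)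
  finally show ?case
    using DERIV_mult[OF x[OF var(1)] var(2)] by (simp only: ev_var_mult)
next
  case (add f g)
  then show ?case
    using DERIV_add[OF add] by (simp add: ev_add lin_add[OF lin_pdiff] distrib_left sum.distrib)
qed

text \<open>Restricted to the real line through 0 and \<open>z\<close>, real and imaginary part are
  real functions with derivative 0.\<close>

lemma zero_derivative_constant:
  fixes G :: "complex \<Rightarrow> complex"
  assumes "\<And>z. (G has_field_derivative 0) (at z)"
  shows "G z = G 0"
proof -
  have 1: "((\<lambda>s. G (of_real s * z)) has_derivative (\<lambda>h. 0)) (at s)" for s :: real
  proof -
    have "((\<lambda>s. of_real s * z) has_derivative (\<lambda>h. of_real h * z)) (at s)"
      by (auto intro!: derivative_eq_intros)
    from has_derivative_compose[OF this assms[of "of_real s * z", unfolded has_field_derivative_def]]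
    show ?thesis by simp
  qed
  have "((\<lambda>s. Re (G (of_real s * z))) has_field_derivative 0) (at s)" for s
    using has_derivative_Re[OF 1] by (simp add: has_field_derivative_def flip: lambda_zero)
  then have "Re (G (of_real 1 * z)) = Re (G (of_real 0 * z))"
    using DERIV_isconst_all[of "\<lambda>s. Re (G (of_real s * z))"] by blast
  moreover have "((\<lambda>s. Im (G (of_real s * z))) has_field_derivative 0) (at s)" for s
    using has_derivative_Im[OF 1] by (simp add: has_field_derivative_def flip: lambda_zero)
  then have "Im (G (of_real 1 * z)) = Im (G (of_real 0 * z))"
    using DERIV_isconst_all[of "\<lambda>s. Im (G (of_real s * z))"] by blast
  ultimately show ?thesis by (simp add: complex_eq_iff)
qed

context matrix_poly
begin

lemma poly_ring_keys: "f \<in> poly_ring N n \<Longrightarrow> \<forall>m\<in>Poly_Mapping.keys f. Poly_Mapping.keys m \<subseteq> entries N n"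
  by (simp add: poly_ring_def)

lemma pdiff_poly_ring:
  assumes "f \<in> poly_ring N n" shows "pdiff v f \<in> poly_ring N n"
proof -
  have "Poly_Mapping.keys m \<subseteq> entries N n" if "m \<in> Poly_Mapping.keys (pdiff v f)" for m
  proof -
    have "m + mon v \<in> Poly_Mapping.keys f" using that by (auto simp: in_keys_iff coef_pdiff)
    moreover have "Poly_Mapping.keys m \<subseteq> Poly_Mapping.keys (m + mon v)"
      by (auto simp: in_keys_iff lookup_add)
    ultimately show ?thesis using assms poly_ring_keys by blast
  qed
  then show ?thesis by (auto simp: poly_ring_def)
qed

text \<open>All partial derivatives of a polynomial vanishing everywhere vanish everywhere, so induction on
  the degree of the monomial shows that all coefficients are zero.\<close>

lemma ev_eq_0_imp_0:
  assumes "f \<in> poly_ring N n" "\<And>x. ev f x = 0" shows "f = 0"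
proof (rule poly_mapping_eqI)
  fix m
  have "coef f m = 0" if "f \<in> poly_ring N n" "\<And>x. ev f x = 0" for f m
    using that
  proof (induction "\<Sum>v\<in>entries N n. expo m v" arbitrary: f m)
    case 0
    show ?case
    proof (cases "Poly_Mapping.keys m \<subseteq> entries N n")
      case True
      have "expo m v = 0" for v
        using 0(1) True finite_entries by (cases "v \<in> entries N n") (auto simp: in_keys_iff)
      then have "m = 0" by (simp add: poly_mapping_eqI)
      have "ev f (\<lambda>_. 0) = (\<Sum>l\<in>Poly_Mapping.keys f. if l = 0 then coef f 0 else 0)"
        unfolding ev_def
      proof (rule sum.cong[OF refl])
        fix l
        show "coef f l * (\<Prod>v\<in>Poly_Mapping.keys l. 0 ^ expo l v) = (if l = 0 then coef f 0 else 0)"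
        proof (cases "l = 0")
          case False
          then obtain v where "v \<in> Poly_Mapping.keys l"
            by (metis in_keys_iff poly_mapping_eqI lookup_zero)
          then have "(\<Prod>v\<in>Poly_Mapping.keys l. (0::complex) ^ expo l v) = 0"
            by (intro prod_zero) (auto simp: in_keys_iff)
          then show ?thesis using False by simp
        qed simp
      qed
      also have "\<dots> = coef f 0" by (simp add: in_keys_iff)
      finally show ?thesis using 0(3) \<open>m = 0\<close> by simp
    next
      case False
      then show ?thesis using poly_ring_keys[OF 0(2)] by (auto simp: in_keys_iff)
    qed
  next
    case (Suc d)
    then obtain v where v: "v \<in> entries N n" "expo m v \<noteq> 0"
      by (metis nat.distinct(1) sum.neutral)
    let ?l = "m - mon v"
    have m: "?l + mon v = m" using mon_add_diff[of m v] v by (simp add: add.commute)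
    have "(\<Sum>w\<in>entries N n. expo m w) = (\<Sum>w\<in>entries N n. expo ?l w + (if w = v then 1 else 0))"
      using v by (intro sum.cong) (auto simp: lookup_minus expo_mon)
    then have d: "d = (\<Sum>w\<in>entries N n. expo ?l w)"
      using Suc.hyps(2) v finite_entries by (simp add: sum.distrib)
    have "ev (pdiff v f) x = 0" for x
    proof -
      have "((\<lambda>t. ev f (x(v := t))) has_field_derivative
          (\<Sum>w\<in>entries N n. (if w = v then 1 else 0) * ev (pdiff w f) (x(v := x v)))) (at (x v))"
        by (rule ev_has_derivative[OF finite_entries poly_ring_keys[OF Suc.prems(1)]])
          (auto intro!: derivative_eq_intros)
      moreover have "(\<Sum>w\<in>entries N n. (if w = v then 1 else 0) * ev (pdiff w f) (x(v := x v))) =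
          (\<Sum>w\<in>entries N n. if w = v then ev (pdiff v f) x else 0)"
        by (rule sum.cong) auto
      ultimately have "((\<lambda>t. 0) has_field_derivative ev (pdiff v f) x) (at (x v))"
        using v finite_entries Suc.prems(2) by simp
      then show ?thesis using DERIV_unique DERIV_const by blast
    qed
    then have "coef (pdiff v f) ?l = 0"
      using Suc.hyps(1)[OF d pdiff_poly_ring[OF Suc.prems(1)]] by blast
    then show ?case using m by (simp add: coef_pdiff del: of_nat_Suc)
  qed
  then show "coef f m = coef 0 m" using assms by simp
qed

text \<open>The vector field of the one-parameter group generated by the \<open>(i, j)\<close> matrix unit.\<close>

fun vfield :: "nat \<Rightarrow> nat \<Rightarrow> (entry \<Rightarrow> complex) \<Rightarrow> entry \<Rightarrow> complex" where
  "vfield i j x (XV r c) = (if r = i then x (XV j c) else 0) - (if c = j then x (XV r i) else 0)"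
| "vfield i j x (AV a c) = - (if c = j then x (AV a i) else 0)"

lemma vfield_stk: "vfield i j x (stk n p c) =
    (if p = n + i then x (stk n (n + j) c) else 0) - (if c = j then x (stk n p i) else 0)"
  by (auto simp: stk_def)

text \<open>The conjugation generated by e_ij adds row j of X to row i and subtracts column i of the
  stacked matrix from column j; on functions these are \<open>E' j i\<close> and
  \<open>F i j\<close>.\<close>

lemma ev_vfield:
  assumes ij: "i < N" "j < N"
  shows "(\<Sum>v\<in>entries N n. vfield i j x v * ev (pdiff v f) x) = ev (E' j i f - F i j f) x"
proof -
  have inj: "inj_on (\<lambda>(p, c). stk n p c) ({..<M} \<times> {..<N})" by (auto simp: inj_on_def stk_inj)
  have eq: "entries N n = (\<lambda>(p, c). stk n p c) ` ({..<M} \<times> {..<N})" by (auto simp: entries_stk)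
  have "(\<Sum>v\<in>entries N n. vfield i j x v * ev (pdiff v f) x) =
      (\<Sum>p<M. \<Sum>c<N. vfield i j x (stk n p c) * ev (pdiff (stk n p c) f) x)"
    unfolding eq sum.reindex[OF inj] by (simp add: sum.cartesian_product case_prod_unfold)
  also have "\<dots> = (\<Sum>p<M. \<Sum>c<N. if p = n + i then x (stk n (n + j) c) * ev (pdiff (stk n (n + i) c) f) x else 0)
      - (\<Sum>p<M. \<Sum>c<N. if c = j then x (stk n p i) * ev (pdiff (stk n p j) f) x else 0)"
    unfolding sum_subtractf[symmetric]
    by (intro sum.cong refl) (auto simp: vfield_stk algebra_simps)
  also have "(\<Sum>p<M. \<Sum>c<N. if p = n + i then x (stk n (n + j) c) * ev (pdiff (stk n (n + i) c) f) x else 0) =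
      (\<Sum>c<N. x (stk n (n + j) c) * ev (pdiff (stk n (n + i) c) f) x)"
    using ij by (subst sum.swap) simp
  also have "\<dots> = ev (E' j i f) x"
    by (simp add: E'_def gl_op_stk matop_def dop_def ev_sum ev_var_mult)
  also have "(\<Sum>p<M. \<Sum>c<N. if c = j then x (stk n p i) * ev (pdiff (stk n p j) f) x else 0) =
      ev (F i j f) x"
    using ij by (simp add: F_def matop_def dop_def ev_sum ev_var_mult)
  finally show ?thesis by (simp add: ev_diff)
qed

end


section \<open>Covariance and its infinitesimal form\<close>

lemma exp_surj:
  fixes s :: complex assumes "s \<noteq> 0" shows "\<exists>z. s = exp z"
proof -
  obtain a r where ar: "s = complex_of_real r * exp a" using complex_exp_exists by blast
  then have "r \<noteq> 0" using assms by auto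
  then consider "r > 0" | "r < 0" by linarith
  then show ?thesis
  proof cases
    case 1
    then have "s = exp (of_real (ln r) + a)" by (simp add: ar exp_add exp_of_real)
    then show ?thesis by blast
  next
    case 2
    \<comment> \<open>The sign of the real factor is absorbed by the summand i pi.\<close>
    then have "s = exp (of_real (ln (- r)) + \<i> * of_real pi + a)"
      by (simp add: ar exp_add exp_of_real)
    then show ?thesis by blast
  qed
qed

section \<open>Elementary matrices and row reduction\<close>

lemma mult_addrow_mat_index:
  fixes A :: "complex mat"
  assumes "A \<in> carrier_mat m N" "r < m" "c < N" "i < N" "j < N"
  shows "(A * addrow_mat N s i j) $$ (r, c) = A $$ (r, c) + (if c = j then s * A $$ (r, i) else 0)"
proof -
  have "(A * addrow_mat N s i j) $$ (r, c) = (\<Sum>l = 0..<N. A $$ (r, l) * addrow_mat N s i j $$ (l, c))"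
    using assms by (simp add: scalar_prod_def)
  also have "\<dots> = (\<Sum>l = 0..<N. (if l = c then A $$ (r, c) else 0) +
      (if l = i then (if c = j then s * A $$ (r, i) else 0) else 0))"
    by (rule sum.cong) (use assms in \<open>auto simp: algebra_simps\<close>)
  finally show ?thesis using assms by (simp add: sum.distrib)
qed

lemma mult_multrow_mat_index:
  fixes A :: "complex mat"
  assumes "A \<in> carrier_mat m N" "r < m" "c < N"
  shows "(A * multrow_mat N i s) $$ (r, c) = (if c = i then s else 1) * A $$ (r, c)"
proof -
  have "(A * multrow_mat N i s) $$ (r, c) = (\<Sum>l = 0..<N. A $$ (r, l) * multrow_mat N i s $$ (l, c))"
    using assms by (simp add: scalar_prod_def)
  also have "\<dots> = (\<Sum>l = 0..<N. if l = c then (if c = i then s else 1) * A $$ (r, c) else 0)"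
    by (rule sum.cong) (use assms in auto)
  finally show ?thesis using assms by simp
qed

text \<open>Gauss-Jordan reduction read backwards: \<open>P\<close> passes to \<open>g\<close> from
  the result of one row operation. Instead of swapping rows, a zero pivot is repaired by adding a
  lower row, so only transvections and diagonal matrices occur.\<close>

lemma GL_row_induct:
  fixes P :: "complex mat \<Rightarrow> bool"
  assumes one: "P (1\<^sub>m N)"
    and add: "\<And>g t i j. g \<in> carrier_mat N N \<Longrightarrow> det g \<noteq> 0 \<Longrightarrow> i < N \<Longrightarrow> j < N \<Longrightarrow> i \<noteq> j \<Longrightarrow>
      P (addrow_mat N t i j * g) \<Longrightarrow> P g"
    and mult: "\<And>g s i. g \<in> carrier_mat N N \<Longrightarrow> det g \<noteq> 0 \<Longrightarrow> i < N \<Longrightarrow> s \<noteq> 0 \<Longrightarrow>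
      P (multrow_mat N i s * g) \<Longrightarrow> P g"
    and g: "g \<in> carrier_mat N N" "det g \<noteq> 0"
  shows "P g"
proof -
  \<comment> \<open>Columns before \<open>m\<close> are already unit columns; at m = N only the
    identity is left.\<close>
  define U where "U m g \<longleftrightarrow> g \<in> carrier_mat N N \<and> det g \<noteq> 0 \<and>
    (\<forall>c<m. \<forall>r<N. g $$ (r, c) = (if r = c then 1 else 0))" for m and g :: "complex mat"
  have det_add: "det (addrow_mat N t i j * g) = det g"
    if "g \<in> carrier_mat N N" "i \<noteq> j" for g :: "complex mat" and t i j
    using det_mult[of "addrow_mat N t i j" N g] that by (simp add: det_addrow_mat)
  have det_mlt: "det (multrow_mat N i s * g) = s * det g"
    if "g \<in> carrier_mat N N" "i < N" for g :: "complex mat" and s i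
    using det_mult[of "multrow_mat N i s" N g] that by (simp add: det_multrow_mat)
  have add_ix: "(addrow_mat N t i j * g) $$ (r, c) = (if i = r then t * g $$ (j, c) + g $$ (r, c) else g $$ (r, c))"
    if "g \<in> carrier_mat N N" "r < N" "c < N" "j < N" for g :: "complex mat" and t i j r c
    using addrow_mat[OF that(1,4), of t i, symmetric] that by simp
  have mult_ix: "(multrow_mat N i s * g) $$ (r, c) = (if i = r then s * g $$ (r, c) else g $$ (r, c))"
    if "g \<in> carrier_mat N N" "r < N" "c < N" for g :: "complex mat" and s i r c
    using multrow_mat[OF that(1), of i s, symmetric] that by simp
  have step: "P g" if m: "m < N" and IH: "\<And>g. U (Suc m) g \<Longrightarrow> P g" and Ug: "U m g" for m g
  proof -
    \<comment> \<open>With pivot 1, the other entries of column m are cleared by induction on their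
      number.\<close>
    have one: "P g" if "U m g" "g $$ (m, m) = 1" for g
      using that
    proof (induction "card {r. r < N \<and> r \<noteq> m \<and> g $$ (r, m) \<noteq> 0}" arbitrary: g rule: less_induct)
      case less
      have g: "g \<in> carrier_mat N N" "det g \<noteq> 0"
        and unit: "\<And>c r. c < m \<Longrightarrow> r < N \<Longrightarrow> g $$ (r, c) = (if r = c then 1 else 0)"
        using less.prems by (auto simp: U_def)
      show ?case
      proof (cases "\<exists>r. r < N \<and> r \<noteq> m \<and> g $$ (r, m) \<noteq> 0")
        case False
        then have "U (Suc m) g" using less.prems by (auto simp: U_def less_Suc_eq)
        then show ?thesis by (rule IH)
      next
        case True
        then obtain i where i: "i < N" "i \<noteq> m" "g $$ (i, m) \<noteq> 0" by blast
        let ?h = "addrow_mat N (- g $$ (i, m)) i m * g"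
        have h: "?h \<in> carrier_mat N N" by (rule mult_carrier_mat[OF addrow_mat_carrier g(1)])
        have col: "?h $$ (r, m) = (if r = i then 0 else g $$ (r, m))" if "r < N" for r
          using that m less.prems(2) by (simp add: add_ix[OF g(1)])
        have "{r. r < N \<and> r \<noteq> m \<and> ?h $$ (r, m) \<noteq> 0} \<subset> {r. r < N \<and> r \<noteq> m \<and> g $$ (r, m) \<noteq> 0}"
        proof (rule psubsetI)
          show "{r. r < N \<and> r \<noteq> m \<and> ?h $$ (r, m) \<noteq> 0} \<subseteq> {r. r < N \<and> r \<noteq> m \<and> g $$ (r, m) \<noteq> 0}"
            by (intro Collect_mono impI) (metis col)
          have "i \<in> {r. r < N \<and> r \<noteq> m \<and> g $$ (r, m) \<noteq> 0}" "i \<notin> {r. r < N \<and> r \<noteq> m \<and> ?h $$ (r, m) \<noteq> 0}"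
            using i col[OF i(1)] by simp_all
          then show "{r. r < N \<and> r \<noteq> m \<and> ?h $$ (r, m) \<noteq> 0} \<noteq> {r. r < N \<and> r \<noteq> m \<and> g $$ (r, m) \<noteq> 0}"
            by blast
        qed
        then have "card {r. r < N \<and> r \<noteq> m \<and> ?h $$ (r, m) \<noteq> 0} < card {r. r < N \<and> r \<noteq> m \<and> g $$ (r, m) \<noteq> 0}"
          by (intro psubset_card_mono) auto
        moreover have "U m ?h"
          using h g m i unit by (auto simp: U_def det_add add_ix[OF g(1)] simp del: index_mult_mat(1))
        moreover have "?h $$ (m, m) = 1" using col[OF m] less.prems(2) i by simp
        ultimately have "P ?h" by (rule less.hyps)
        then show ?thesis using add[OF g i(1) m i(2)] by blast
      qed
    qed
    have diag: "P g" if U: "U m g" and nz: "g $$ (m, m) \<noteq> 0" for g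
    proof -
      have g: "g \<in> carrier_mat N N" "det g \<noteq> 0"
        and unit: "\<And>c r. c < m \<Longrightarrow> r < N \<Longrightarrow> g $$ (r, c) = (if r = c then 1 else 0)"
        using U by (auto simp: U_def)
      let ?s = "inverse (g $$ (m, m))"
      let ?h = "multrow_mat N m ?s * g"
      have h: "?h \<in> carrier_mat N N" by (rule mult_carrier_mat[OF multrow_mat_carrier g(1)])
      have "U m ?h"
        using h g m unit nz by (auto simp: U_def det_mlt mult_ix[OF g(1)] simp del: index_mult_mat(1))
      moreover have "?h $$ (m, m) = 1" using m nz by (simp add: mult_ix[OF g(1)])
      ultimately have "P ?h" by (rule one)
      then show ?thesis using mult[OF g m, of ?s] nz by simp
    qed
    have g: "g \<in> carrier_mat N N" "det g \<noteq> 0"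
      and unit: "\<And>c r. c < m \<Longrightarrow> r < N \<Longrightarrow> g $$ (r, c) = (if r = c then 1 else 0)"
      using Ug by (auto simp: U_def)
    show ?thesis
    proof (cases "g $$ (m, m) = 0")
      case False
      then show ?thesis using diag Ug by blast
    next
      case True
      have "\<exists>r. m < r \<and> r < N \<and> g $$ (r, m) \<noteq> 0"
      proof (rule ccontr)
        assume "\<not> ?thesis"
        then have z: "g $$ (r, m) = 0" if "m \<le> r" "r < N" for r
          using that True by (cases "r = m") auto
        \<comment> \<open>If column m vanished from the pivot on, it would be a combination of the
          unit columns before it; \<open>v\<close> records this dependency.\<close>
        define v where "v = vec N (\<lambda>c. if c < m then - g $$ (c, m) else if c = m then 1 else 0)"
        have "g *\<^sub>v v = 0\<^sub>v N"
        proof (rule eq_vecI)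
          fix r assume "r < dim_vec (0\<^sub>v N :: complex vec)"
          then have r: "r < N" by simp
          have "(g *\<^sub>v v) $ r = (\<Sum>c = 0..<N. g $$ (r, c) * v $ c)"
            using g(1) r by (simp add: scalar_prod_def v_def)
          also have "\<dots> = (\<Sum>c = 0..<N. (if c = r then (if r < m then - g $$ (r, m) else 0) else 0) +
              (if c = m then g $$ (r, m) else 0))"
            by (rule sum.cong) (use r m unit in \<open>auto simp: v_def\<close>)
          also have "\<dots> = 0" using r m z[of r] by (simp add: sum.distrib)
          finally show "(g *\<^sub>v v) $ r = 0\<^sub>v N $ r" using r by simp
        qed (use g in simp)
        moreover have "v \<in> carrier_vec N" by (simp add: v_def)
        moreover have "v $ m = 1" using m by (simp add: v_def)
        then have "v \<noteq> 0\<^sub>v N" using m by auto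
        ultimately show False using det_0_iff_vec_prod_zero[OF g(1)] g(2) by blast
      qed
      then obtain r where r: "m < r" "r < N" "g $$ (r, m) \<noteq> 0" by blast
      let ?h = "addrow_mat N 1 m r * g"
      have h: "?h \<in> carrier_mat N N" by (rule mult_carrier_mat[OF addrow_mat_carrier g(1)])
      have "U m ?h"
        using h g m r unit by (auto simp: U_def det_add add_ix[OF g(1)] simp del: index_mult_mat(1))
      moreover have "?h $$ (m, m) \<noteq> 0" using m r True by (simp add: add_ix[OF g(1)])
      ultimately have "P ?h" by (rule diag)
      then show ?thesis using add[OF g m r(2)] r(1) by blast
    qed
  qed
  have "\<forall>g. U m g \<longrightarrow> P g" if "m \<le> N" for m
    using that
  proof (induction m rule: inc_induct)
    case base
    have "g = 1\<^sub>m N" if "U N g" for g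
      using that by (intro eq_matI) (auto simp: U_def)
    then show ?case using one by blast
  next
    case (step m)
    then show ?case using \<open>\<And>m g. m < N \<Longrightarrow> (\<And>g. U (Suc m) g \<Longrightarrow> P g) \<Longrightarrow> U m g \<Longrightarrow> P g\<close> by blast
  qed
  then show ?thesis using g by (auto simp: U_def)
qed

section \<open>One-parameter groups of transvections and diagonal matrices\<close>

context matrix_poly
begin

text \<open>Conjugation by 1 + t e_ij, entry by entry. The quadratic term comes from e_ij X e_ij,
  whose only entry is X_ji at position (i, j).\<close>

fun transv :: "nat \<Rightarrow> nat \<Rightarrow> complex \<Rightarrow> (entry \<Rightarrow> complex) \<Rightarrow> entry \<Rightarrow> complex" where
  "transv i j t x (XV r c) = x (XV r c) + (if r = i then t * x (XV j c) else 0)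
     - (if c = j then t * x (XV r i) else 0) - (if r = i \<and> c = j then t\<^sup>2 * x (XV j i) else 0)"
| "transv i j t x (AV a c) = x (AV a c) - (if c = j then t * x (AV a i) else 0)"

text \<open>The parameter is the logarithm of the diagonal entry, so that the velocity is
  \<open>vfield i i\<close> at the moved point for every \<open>z\<close>; \<open>exp_surj\<close>
  recovers all nonzero entries.\<close>

fun torus :: "nat \<Rightarrow> complex \<Rightarrow> (entry \<Rightarrow> complex) \<Rightarrow> entry \<Rightarrow> complex" where
  "torus i z x (XV r c) = (if r = i then exp z else 1) * (if c = i then exp (- z) else 1) * x (XV r c)"
| "torus i z x (AV a c) = (if c = i then exp (- z) else 1) * x (AV a c)"

lemma transv_0: "transv i j 0 x = x"
proof
  fix v show "transv i j 0 x v = x v" by (cases v) auto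
qed

lemma torus_0: "torus i 0 x = x"
proof
  fix v show "torus i 0 x v = x v" by (cases v) auto
qed

lemma transv_derivative:
  assumes "i \<noteq> j"
  shows "((\<lambda>t. transv i j t x v) has_field_derivative vfield i j (transv i j t x) v) (at t)"
  using assms
  by (cases v) (auto intro!: derivative_eq_intros simp: algebra_simps power2_eq_square)

lemma torus_derivative:
  "((\<lambda>z. torus i z x v) has_field_derivative vfield i i (torus i z x) v) (at z)"
  by (cases v) (auto intro!: derivative_eq_intros simp: algebra_simps exp_minus_inverse)

lemma ev_transv_derivative:
  assumes "f \<in> poly_ring N n" "i < N" "j < N" "i \<noteq> j"
  shows "((\<lambda>t. ev f (transv i j t x)) has_field_derivative ev (E' j i f - F i j f) (transv i j t x)) (at t)"
  using ev_has_derivative[OF finite_entries poly_ring_keys[OF assms(1)],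
      where x = "\<lambda>t. transv i j t x" and d = "vfield i j (transv i j t x)" and t = t,
      OF transv_derivative[OF assms(4)]]
  by (simp add: ev_vfield assms)

lemma ev_torus_derivative:
  assumes "f \<in> poly_ring N n" "i < N"
  shows "((\<lambda>z. ev f (torus i z x)) has_field_derivative ev (E' i i f - F i i f) (torus i z x)) (at z)"
  using ev_has_derivative[OF finite_entries poly_ring_keys[OF assms(1)],
      where x = "\<lambda>z. torus i z x" and d = "vfield i i (torus i z x)" and t = z,
      OF torus_derivative]
  by (simp add: ev_vfield assms)

lemma transv_matrix:
  assumes "X \<in> carrier_mat N N" "A \<in> carrier_mat n N" "i < N" "j < N" "i \<noteq> j" "v \<in> entries N n"
  shows "entry_value (addrow_mat N t i j * X * addrow_mat N (- t) i j) (A * addrow_mat N (- t) i j) v =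
    transv i j t (entry_value X A) v"
proof -
  have gX: "addrow_mat N t i j * X \<in> carrier_mat N N"
    by (rule mult_carrier_mat[OF addrow_mat_carrier assms(1)])
  have ix: "(addrow_mat N t i j * X) $$ (r, c) = X $$ (r, c) + (if r = i then t * X $$ (j, c) else 0)"
    if "r < N" "c < N" for r c
    using addrow_mat[OF assms(1,4), of t i, symmetric] that assms(1) by simp
  show ?thesis
    using assms(6)
  proof (cases v)
    case (XV r c)
    then have rc: "r < N" "c < N" using assms(6) by (auto simp: entries_def)
    show ?thesis
      unfolding XV entry_value.simps transv.simps mult_addrow_mat_index[OF gX rc assms(3,4)]
        ix[OF rc] ix[OF rc(1) assms(3)]
      using assms(5) by (simp add: algebra_simps power2_eq_square)
  next
    case (AV a c)
    then have ac: "a < n" "c < N" using assms(6) by (auto simp: entries_def)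
    show ?thesis
      unfolding AV entry_value.simps transv.simps mult_addrow_mat_index[OF assms(2) ac assms(3,4)]
      by simp
  qed
qed

lemma torus_matrix:
  assumes "X \<in> carrier_mat N N" "A \<in> carrier_mat n N" "i < N" "v \<in> entries N n"
  shows "entry_value (multrow_mat N i (exp z) * X * multrow_mat N i (exp (- z))) (A * multrow_mat N i (exp (- z))) v =
    torus i z (entry_value X A) v"
proof -
  have gX: "multrow_mat N i (exp z) * X \<in> carrier_mat N N"
    by (rule mult_carrier_mat[OF multrow_mat_carrier assms(1)])
  have ix: "(multrow_mat N i (exp z) * X) $$ (r, c) = (if r = i then exp z else 1) * X $$ (r, c)"
    if "r < N" "c < N" for r c
    using multrow_mat[OF assms(1), of i "exp z", symmetric] that assms(1) by simp
  show ?thesis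
    using assms(4)
  proof (cases v)
    case (XV r c)
    then have rc: "r < N" "c < N" using assms(4) by (auto simp: entries_def)
    show ?thesis
      unfolding XV entry_value.simps torus.simps mult_multrow_mat_index[OF gX rc] ix[OF rc]
      by simp
  next
    case (AV a c)
    then have ac: "a < n" "c < N" using assms(4) by (auto simp: entries_def)
    show ?thesis
      unfolding AV entry_value.simps torus.simps mult_multrow_mat_index[OF assms(2) ac]
      by simp
  qed
qed

lemma ev_poly_ring_cong:
  "f \<in> poly_ring N n \<Longrightarrow> (\<And>v. v \<in> entries N n \<Longrightarrow> x v = y v) \<Longrightarrow> ev f x = ev f y"
  by (rule ev_cong[OF poly_ring_keys])

lemma addrow_mat_inverse:
  fixes t :: complex
  assumes "i < N" "j < N" "i \<noteq> j"
  shows "addrow_mat N t i j * addrow_mat N (- t) i j = 1\<^sub>m N"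
    "addrow_mat N (- t) i j * addrow_mat N t i j = 1\<^sub>m N"
  using addrow_mat_inv[OF assms, of t] addrow_mat_inv[OF assms, of "- t"] by simp_all

lemma multrow_mat_inverse:
  fixes s :: complex
  assumes "i < N" "s \<noteq> 0"
  shows "multrow_mat N i s * multrow_mat N i (inverse s) = 1\<^sub>m N"
    "multrow_mat N i (inverse s) * multrow_mat N i s = 1\<^sub>m N"
  using multrow_mat_inv[OF assms] multrow_mat_inv[OF assms(1), of "inverse s"] assms(2) by simp_all

lemma powi_exp: "exp z powi (- int k) = (exp (- (of_nat k * z)) :: complex)"
  by (simp add: power_int_minus exp_minus exp_of_nat_mult)

lemma eval_poly_transv:
  assumes "f \<in> poly_ring N n" "X \<in> carrier_mat N N" "A \<in> carrier_mat n N" "i < N" "j < N" "i \<noteq> j"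
  shows "eval_poly f (addrow_mat N t i j * X * addrow_mat N (- t) i j) (A * addrow_mat N (- t) i j) =
    ev f (transv i j t (entry_value X A))"
  unfolding eval_poly_ev by (rule ev_poly_ring_cong[OF assms(1) transv_matrix[OF assms(2-6)]])

lemma eval_poly_torus:
  assumes "f \<in> poly_ring N n" "X \<in> carrier_mat N N" "A \<in> carrier_mat n N" "i < N"
  shows "eval_poly f (multrow_mat N i (exp z) * X * multrow_mat N i (exp (- z))) (A * multrow_mat N i (exp (- z))) =
    ev f (torus i z (entry_value X A))"
  unfolding eval_poly_ev by (rule ev_poly_ring_cong[OF assms(1) torus_matrix[OF assms(2-4)]])

text \<open>Differentiating covariance at parameter 0 along both kinds of groups gives an identity
  of values, which \<open>ev_eq_0_imp_0\<close> turns into one of polynomials.\<close>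

lemma cov_space_lie_cov:
  assumes "f \<in> cov_space N n k"
  shows "lie_cov k f"
  unfolding lie_cov_def
proof (intro allI impI)
  fix i j assume ij: "i < N" "j < N"
  have f: "f \<in> poly_ring N n" using assms by (simp add: cov_space_def)
  have cov: "eval_poly f (g * X * h) (A * h) = det g powi (- int k) * eval_poly f X A"
    if "g \<in> carrier_mat N N" "h \<in> carrier_mat N N" "g * h = 1\<^sub>m N" "h * g = 1\<^sub>m N"
      "X \<in> carrier_mat N N" "A \<in> carrier_mat n N" for g h X A
    using assms that by (auto simp: cov_space_def)
  let ?g = "E' j i f - F i j f + (if i = j then smult_poly (of_nat k) f else 0)"
  have "E' j i f \<in> poly_ring N n" "F i j f \<in> poly_ring N n"
    using ij f by (simp_all add: E'_def E_poly_ring F_poly_ring)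
  then have "?g \<in> poly_ring N n"
    using f by (intro cpoly.subspace_add cpoly.subspace_diff subspace_poly_ring)
      (auto simp: cpoly.subspace_scale cpoly.subspace_0 subspace_poly_ring)
  moreover have "ev ?g x = 0" for x
  proof -
    \<comment> \<open>The matrices keep the values of the entries in range, on which elements of the
      polynomial ring depend.\<close>
    define X where "X = mat N N (\<lambda>(r, c). x (XV r c))"
    define A where "A = mat n N (\<lambda>(a, c). x (AV a c))"
    have XA: "X \<in> carrier_mat N N" "A \<in> carrier_mat n N" by (simp_all add: X_def A_def)
    let ?y = "entry_value X A"
    have "?y v = x v" if "v \<in> entries N n" for v
      using that by (auto simp: entries_def X_def A_def)
    then have "ev ?g x = ev ?g ?y"
      using ev_poly_ring_cong[OF \<open>?g \<in> poly_ring N n\<close>] by metis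
    also have "\<dots> = 0"
    proof (cases "i = j")
      case False
      have "ev f (transv i j t ?y) = ev f ?y" for t
        using cov[OF _ _ addrow_mat_inverse[OF ij False] XA, of t]
          eval_poly_transv[OF f XA ij False, of t] False
        by (simp add: det_addrow_mat eval_poly_ev)
      then have "((\<lambda>t. ev f ?y) has_field_derivative ev (E' j i f - F i j f) ?y) (at 0)"
        using ev_transv_derivative[OF f ij False, of ?y 0] by (simp add: transv_0)
      then have "ev (E' j i f - F i j f) ?y = 0" using DERIV_unique DERIV_const by blast
      then show ?thesis using False by simp
    next
      case True
      have "ev f (torus i z ?y) = exp (- (of_nat k * z)) * ev f ?y" for z
        using cov[OF _ _ multrow_mat_inverse[OF ij(1)] XA, of "exp z"]
          eval_poly_torus[OF f XA ij(1), of z] ij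
        by (simp add: det_multrow_mat eval_poly_ev powi_exp exp_minus)
      then have "((\<lambda>z. exp (- (of_nat k * z)) * ev f ?y) has_field_derivative ev (E' i i f - F i i f) ?y) (at 0)"
        using ev_torus_derivative[OF f ij(1), of ?y 0] by (simp add: torus_0)
      moreover have "((\<lambda>z. exp (- (of_nat k * z)) * ev f ?y) has_field_derivative (- of_nat k * ev f ?y)) (at 0)"
        by (auto intro!: derivative_eq_intros)
      ultimately have "ev (E' i i f - F i i f) ?y = - of_nat k * ev f ?y" using DERIV_unique by blast
      then show ?thesis using True by (simp add: ev_add ev_smult)
    qed
    finally show ?thesis .
  qed
  ultimately have "?g = 0" by (rule ev_eq_0_imp_0)
  then show "F i j f = E' j i f + (if i = j then smult_poly (of_nat k) f else 0)"
    by (simp add: algebra_simps)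
qed

lemma ev_transv_invariant:
  assumes "lie_cov k f" "f \<in> poly_ring N n" "i < N" "j < N" "i \<noteq> j"
  shows "ev f (transv i j t x) = ev f x"
proof -
  have "E' j i f - F i j f = 0" using assms by (simp add: lie_cov_def)
  then have "((\<lambda>t. ev f (transv i j t x)) has_field_derivative 0) (at t)" for t
    using ev_transv_derivative[OF assms(2-5), of x t] by simp
  from zero_derivative_constant[OF this, of t] show ?thesis by (simp add: transv_0)
qed

text \<open>Along the torus the condition reads y' = - k y, solved with the integrating factor exp
  (k z); exp z is the determinant of the diagonal matrix.\<close>

lemma ev_torus_covariant:
  assumes "lie_cov k f" "f \<in> poly_ring N n" "i < N"
  shows "ev f (torus i z x) = exp (- (of_nat k * z)) * ev f x"
proof -
  have "E' i i f - F i i f = smult_poly (- of_nat k) f"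
    using assms by (simp add: lie_cov_def)
  then have "ev (E' i i f - F i i f) y = - of_nat k * ev f y" for y by (simp only: ev_smult)
  then have d: "((\<lambda>z. ev f (torus i z x)) has_field_derivative - of_nat k * ev f (torus i z x)) (at z)" for z
    using ev_torus_derivative[OF assms(2,3), of x z] by simp
  have "((\<lambda>z. exp (of_nat k * z) * ev f (torus i z x)) has_field_derivative 0) (at z)" for z
    by (rule derivative_eq_intros d refl)+ (simp add: algebra_simps)
  from zero_derivative_constant[OF this, of z]
  have "exp (of_nat k * z) * ev f (torus i z x) = ev f x" by (simp add: torus_0)
  then show ?thesis by (simp add: exp_minus field_simps)
qed

text \<open>Covariance under \<open>e\<close> and under \<open>e * g\<close> imply covariance under \<open>g\<close>; so row reduction leaves only
  the one-parameter groups, along which the infinitesimal condition can be integrated.\<close>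

lemma lie_cov_cov_space:
  assumes f: "f \<in> poly_ring N n" and lie: "lie_cov k f"
  shows "f \<in> cov_space N n k"
proof -
  define good where "good g \<longleftrightarrow> (\<forall>h \<in> carrier_mat N N. g * h = 1\<^sub>m N \<and> h * g = 1\<^sub>m N \<longrightarrow>
       (\<forall>X \<in> carrier_mat N N. \<forall>A \<in> carrier_mat n N.
          eval_poly f (g * X * h) (A * h) = det g powi (- int k) * eval_poly f X A))" for g :: "complex mat"
  have step: "good g" if g: "g \<in> carrier_mat N N" and e: "e \<in> carrier_mat N N" "e' \<in> carrier_mat N N"
    and inv: "e * e' = 1\<^sub>m N" "e' * e = 1\<^sub>m N" and det: "det e \<noteq> 0" and eg: "good (e * g)"
    and cov: "\<And>X A. X \<in> carrier_mat N N \<Longrightarrow> A \<in> carrier_mat n N \<Longrightarrow>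
      eval_poly f (e * X * e') (A * e') = det e powi (- int k) * eval_poly f X A" for g e e' :: "complex mat"
    unfolding good_def
  proof (intro ballI impI, elim conjE)
    fix h X A :: "complex mat"
    assume h: "h \<in> carrier_mat N N" "g * h = 1\<^sub>m N" "h * g = 1\<^sub>m N"
      and X: "X \<in> carrier_mat N N" and A: "A \<in> carrier_mat n N"
    have c: "h * e' \<in> carrier_mat N N" "e * g \<in> carrier_mat N N" "g * X * h \<in> carrier_mat N N"
      "A * h \<in> carrier_mat n N" "e' * (e * g) \<in> carrier_mat N N"
      using g e h X A by auto
    have "(e * g) * (h * e') = e * ((g * h) * e')"
      using g e h(1) by (simp add: assoc_mult_mat[of _ N N _ N _ N])
    then have 1: "(e * g) * (h * e') = 1\<^sub>m N" using e inv h by simp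
    have "(h * e') * (e * g) = h * ((e' * e) * g)"
      using g e h(1) by (simp add: assoc_mult_mat[of _ N N _ N _ N])
    then have 2: "(h * e') * (e * g) = 1\<^sub>m N" using g inv h by simp
    have 3: "e * g * X * (h * e') = e * (g * X * h) * e'"
      using g e h(1) X by (simp add: assoc_mult_mat[of _ N N _ N _ N])
    have 4: "A * (h * e') = A * h * e'"
      using e h(1) A by (simp add: assoc_mult_mat[of _ n N _ N _ N])
    have "det e powi (- int k) * eval_poly f (g * X * h) (A * h) = eval_poly f (e * g * X * (h * e')) (A * (h * e'))"
      unfolding 3 4 by (rule cov[symmetric]) (use c in auto)
    also have "\<dots> = det (e * g) powi (- int k) * eval_poly f X A"
      using eg 1 2 c X A by (simp add: good_def)
    also have "det (e * g) = det e * det g" using det_mult g e by blast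
    finally show "eval_poly f (g * X * h) (A * h) = det g powi (- int k) * eval_poly f X A"
      using det by (simp add: power_int_mult_distrib)
  qed
  have "good g" if g: "g \<in> carrier_mat N N" "det g \<noteq> 0" for g
  proof (rule GL_row_induct[OF _ _ _ g])
    show "good (1\<^sub>m N)"
      by (auto simp: good_def)
  next
    fix g t i j
    assume g: "g \<in> carrier_mat N N" "det g \<noteq> 0" and ij: "i < N" "j < N" "i \<noteq> j"
      and IH: "good (addrow_mat N t i j * g)"
    show "good g"
    proof (rule step[OF g(1) _ _ addrow_mat_inverse[OF ij] _ IH])
      fix X A :: "complex mat" assume XA: "X \<in> carrier_mat N N" "A \<in> carrier_mat n N"
      show "eval_poly f (addrow_mat N t i j * X * addrow_mat N (- t) i j) (A * addrow_mat N (- t) i j) =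
          det (addrow_mat N t i j) powi (- int k) * eval_poly f X A"
        using eval_poly_transv[OF f XA ij] ev_transv_invariant[OF lie f ij] ij
        by (simp add: det_addrow_mat eval_poly_ev)
    qed (use ij in \<open>auto simp: det_addrow_mat\<close>)
  next
    fix g s i
    assume g: "g \<in> carrier_mat N N" "det g \<noteq> 0" and i: "i < N" and s: "s \<noteq> 0"
      and IH: "good (multrow_mat N i s * g)"
    obtain z where z: "s = exp z" using exp_surj[OF s] by blast
    show "good g"
    proof (rule step[OF g(1) _ _ multrow_mat_inverse[OF i s] _ IH])
      fix X A :: "complex mat" assume XA: "X \<in> carrier_mat N N" "A \<in> carrier_mat n N"
      show "eval_poly f (multrow_mat N i s * X * multrow_mat N i (inverse s)) (A * multrow_mat N i (inverse s)) =
          det (multrow_mat N i s) powi (- int k) * eval_poly f X A"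
        using eval_poly_torus[OF f XA i, of z] ev_torus_covariant[OF lie f i] i
        by (simp add: z det_multrow_mat eval_poly_ev powi_exp exp_minus)
    qed (use i s in \<open>auto simp: det_multrow_mat\<close>)
  qed
  moreover have "det g \<noteq> 0" if "g \<in> carrier_mat N N" "h \<in> carrier_mat N N" "g * h = 1\<^sub>m N" for g h :: "complex mat"
    using det_mult[OF that(1,2)] that(3) by auto
  ultimately show ?thesis
    using f by (auto simp: cov_space_def good_def)
qed

lemma cov_space_iff: "f \<in> cov_space N n k \<longleftrightarrow> f \<in> poly_ring N n \<and> lie_cov k f"
  using cov_space_lie_cov lie_cov_cov_space by (auto simp: cov_space_def)

end


section \<open>Covariants in an isotypic component\<close>

context matrix_poly
begin

lemma E'_Iso: "x \<in> Iso lam \<Longrightarrow> p < N \<Longrightarrow> q < N \<Longrightarrow> E' p q x \<in> Iso lam"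
  by (simp add: E'_def Iso_E)

text \<open>\<open>T\<close> maps a decomposition to a decomposition, and that of 0 is trivial by
  \<open>Iso_independent\<close>.\<close>

lemma Iso_components_kernel:
  assumes T: "lin T" "\<And>lam x. x \<in> Iso lam \<Longrightarrow> T x \<in> Iso lam"
    and g: "finite L" "L \<subseteq> partitions N" "\<forall>lam\<in>L. g lam \<in> Iso lam" "T (sum g L) = 0" and mu: "mu \<in> L"
  shows "T (g mu) = 0"
  by (rule Iso_independent[OF g(1,2) _ _ mu, of "\<lambda>lam. T (g lam)"])
    (use T(2) g(3,4) in \<open>auto simp: lin_sum[OF T(1)]\<close>)

lemma lie_cov_components:
  assumes g: "finite L" "L \<subseteq> partitions N" "\<forall>lam\<in>L. g lam \<in> Iso lam" "lie_cov k (sum g L)" and mu: "mu \<in> L"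
  shows "lie_cov k (g mu)"
  unfolding lie_cov_def
proof (intro allI impI)
  fix i j assume ij: "i < N" "j < N"
  define T where "T x = F i j x - E' j i x - (if i = j then smult_poly (of_nat k) x else 0)" for x
  have "T (g mu) = 0"
  proof (rule Iso_components_kernel[OF _ _ g(1-3) _ mu])
    show "lin T"
      using F.lin_e[OF ij] E'.lin_e[OF ij(2,1)]
      by (intro linI) (auto simp: T_def lin_add lin_smult cpoly.scale_right_diff_distrib
          cpoly.scale_right_distrib mult.commute)
    show "T x \<in> Iso lam" if "x \<in> Iso lam" for lam x
      unfolding T_def using that ij
      by (intro cpoly.subspace_diff subspace_Iso)
        (auto simp: Iso_F E'_Iso cpoly.subspace_scale subspace_Iso cpoly.subspace_0)
    show "T (sum g L) = 0" using g(4) ij by (simp add: T_def lie_cov_def)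
  qed
  then show "F i j (g mu) = E' j i (g mu) + (if i = j then smult_poly (of_nat k) (g mu) else 0)"
    by (auto simp: T_def algebra_simps)
qed

text \<open>Each component of \<open>w\<close> satisfies the same F-conditions, while a nonzero
  F-highest vector in \<open>Iso mu\<close> has weight \<open>mu\<close>. This locates the product
  of minors, which is constructed as highest for F and not for E.\<close>

lemma Iso_of_F_hw:
  assumes lam: "lam \<in> partitions N" and w: "w \<in> poly_ring N n" "F.hw (\<lambda>p. of_nat (lam (Suc p))) w"
  shows "w \<in> Iso lam"
proof -
  obtain g L where g: "finite L" "L \<subseteq> partitions N" "\<forall>mu\<in>L. g mu \<in> Iso mu" "w = sum g L"
    using Iso_decomposition[OF w(1)] by blast
  have zero: "g mu = 0" if mu: "mu \<in> L" "mu \<noteq> lam" for mu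
  proof (rule ccontr)
    assume nz: "g mu \<noteq> 0"
    have "F p q (g mu) = 0" if "p < q" "q < N" for p q
      by (rule Iso_components_kernel[OF _ _ g(1-3) _ mu(1)])
        (use that F.lin_e Iso_F F.hw_raise[OF w(2) that] g(4) in auto)
    moreover have "F p p (g mu) = smult_poly (of_nat (lam (Suc p))) (g mu)" if p: "p < N" for p
    proof -
      define T where "T x = F p p x - smult_poly (of_nat (lam (Suc p))) x" for x
      have "T (g mu) = 0"
      proof (rule Iso_components_kernel[OF _ _ g(1-3) _ mu(1)])
        show "lin T"
          using F.lin_e[OF p p] by (intro linI) (auto simp: T_def lin_add lin_smult
              cpoly.scale_right_diff_distrib cpoly.scale_right_distrib mult.commute)
        show "T x \<in> Iso lam" if "x \<in> Iso lam" for lam x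
          unfolding T_def using that p
          by (intro cpoly.subspace_diff cpoly.subspace_scale subspace_Iso) (auto simp: Iso_F)
        show "T (sum g L) = 0" using g(4) F.hw_cartan[OF w(2) p] by (simp add: T_def)
      qed
      then show ?thesis by (simp add: T_def)
    qed
    ultimately have "F.hw (\<lambda>p. of_nat (lam (Suc p))) (g mu)" by (simp add: F.hw_def)
    then have eq: "lam (Suc p) = mu (Suc p)" if "p < N" for p
      using Iso_F_weight[of "g mu" mu "\<lambda>p. lam (Suc p)"] g(3) mu(1) nz that by blast
    have "lam i = mu i" for i
    proof (cases "i \<in> {1..N}")
      case True
      then show ?thesis using eq[of "i - 1"] by auto
    next
      case False
      then show ?thesis using lam g(2) mu(1) unfolding partitions_def by auto
    qed
    then show False using mu(2) by auto
  qed
  have "g mu \<in> Iso lam" if "mu \<in> L" for mu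
    using zero[OF that] g(3) that cpoly.subspace_0[OF subspace_Iso] by (cases "mu = lam") auto
  then show ?thesis unfolding g(4) by (intro cpoly.subspace_sum subspace_Iso)
qed

text \<open>The \<open>F\<close>-module generated by \<open>f\<close> is also \<open>E'\<close>-stable.  A joint highest weight vector \<open>w\<close> in it
  cannot be orthogonal to \<open>f\<close>, and pairing the diagonal operators with \<open>f\<close> relates its two weights.\<close>

lemma lie_cov_joint_hw:
  assumes lam: "lam \<in> partitions N" and f: "f \<in> Iso lam" "lie_cov k f" "f \<noteq> 0"
  shows "\<exists>w c. w \<in> Iso lam \<and> w \<noteq> 0 \<and> F.hw (\<lambda>p. of_nat (lam (Suc p))) w \<and>
    E'.hw (\<lambda>p. of_nat (c p)) w \<and> (\<forall>p<N. lam (Suc p) = c p + k)"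
proof -
  \<comment> \<open>As \<open>f\<close> need not be a highest weight vector, \<open>F.low\<close>
    does not describe the module it generates; \<open>W_min\<close> serves as induction
    principle.\<close>
  define W where "W = \<Inter>{W. cpoly.subspace W \<and> F.stable W \<and> f \<in> W}"
  have W_min: "W \<subseteq> U" if "cpoly.subspace U" "F.stable U" "f \<in> U" for U
    using that unfolding W_def by blast
  have subW: "cpoly.subspace W"
    unfolding W_def by (rule cpoly.subspace_Inter) blast
  have FW: "F.stable W" unfolding W_def F.stable_def by blast
  have fW: "f \<in> W" unfolding W_def by blast
  have WIso: "W \<subseteq> Iso lam"
    by (rule W_min) (auto simp: subspace_Iso F.stable_def Iso_F f(1))
  have FWD: "F p q x \<in> W" if "p < N" "q < N" "x \<in> W" for p q x
    using FW that by (simp add: F.stable_def)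
  have E'f: "E' j i f = F i j f - (if i = j then smult_poly (of_nat k) f else 0)" if "i < N" "j < N" for i j
    using f(2) that by (auto simp: lie_cov_def)
  have E'W: "E' p q x \<in> W" if "p < N" "q < N" "x \<in> W" for p q x
  proof -
    \<comment> \<open>Since E' commutes with F, the vectors that E' keeps in \<open>W\<close> form
      an F-stable subspace; by covariance it contains \<open>f\<close>.\<close>
    have "W \<subseteq> {x \<in> W. \<forall>p<N. \<forall>q<N. E' p q x \<in> W}"
    proof (rule W_min)
      show "cpoly.subspace {x \<in> W. \<forall>p<N. \<forall>q<N. E' p q x \<in> W}"
        using subW unfolding cpoly.subspace_def
        by (auto simp: lin_zero[OF E'.lin_e] lin_add[OF E'.lin_e] lin_smult[OF E'.lin_e])
      show "F.stable {x \<in> W. \<forall>p<N. \<forall>q<N. E' p q x \<in> W}"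
        by (auto simp: F.stable_def FWD E'F_commute)
      show "f \<in> {x \<in> W. \<forall>p<N. \<forall>q<N. E' p q x \<in> W}"
        using fW by (auto simp: E'f intro!: cpoly.subspace_diff subW FWD cpoly.subspace_scale cpoly.subspace_0)
    qed
    then show ?thesis using that by blast
  qed
  obtain w0 d where w0: "w0 \<in> W" "w0 \<noteq> 0" "F.hw (\<lambda>p. of_nat (d p)) w0"
    using F.hw_exists[OF subW FW] fW f(3) by blast
  let ?Q = "{x \<in> W. F.hw (\<lambda>p. of_nat (d p)) x}"
  have "cpoly.subspace ?Q"
    using subW unfolding cpoly.subspace_def F.hw_def
    by (auto simp: lin_add[OF F.lin_e] lin_smult[OF F.lin_e] lin_zero[OF F.lin_e]
        cpoly.scale_right_distrib mult.commute)
  moreover have "E'.stable ?Q"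
    by (auto simp: E'.stable_def E'W F.hw_def E'F_commute[symmetric] lin_zero[OF E'.lin_e] lin_smult[OF E'.lin_e])
  ultimately obtain w c where w: "w \<in> W" "F.hw (\<lambda>p. of_nat (d p)) w" "w \<noteq> 0" "E'.hw (\<lambda>p. of_nat (c p)) w"
    using E'.hw_exists[of ?Q] w0 by blast
  \<comment> \<open>Moved onto \<open>f\<close>, an F-lowering operator becomes an F-raising one, by
    covariance an E'-lowering one, and moved back an E'-raising one, which kills
    \<open>F.low w\<close>. So orthogonality to \<open>w\<close> would spread to
    \<open>F.low w\<close>, then from \<open>f\<close> to all of \<open>W\<close>, and
    \<open>w\<close> would be orthogonal to itself.\<close>
  have fw: "ip f w \<noteq> 0"
  proof
    assume 0: "ip f w = 0"
    have raise: "E' q p y = 0" if "q < p" "p < N" "y \<in> F.low w" for p q y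
    proof -
      have q: "q < N" using that by simp
      have "F.low w \<subseteq> {y. E' q p y = 0}"
      proof (rule F.low_subset)
        show "cpoly.subspace {y. E' q p y = 0}"
          using subspace_lin_vimage[OF E'.lin_e[OF q that(2)], of "{0}"]
          by (simp add: cpoly.subspace_single_0)
      qed (use E'.hw_raise[OF w(4) that(1,2)] q that in
          \<open>auto simp: F.stable_def E'F_commute lin_zero[OF F.lin_e]\<close>)
      then show ?thesis using that(3) by blast
    qed
    have low: "ip f y = 0" if "y \<in> F.low w" for y
      using that
    proof induction
      case (step y q p)
      have q: "q < N" using step.hyps by simp
      have "ip f (F p q y) = ip (F q p f) y" using F.adj[OF q step.hyps(3)] by simp
      also have "F q p f = E' p q f" using E'f[OF q step.hyps(3)] step.hyps(2) by simp
      also have "ip (E' p q f) y = ip f (E' q p y)" using E'.adj[OF step.hyps(3) q] .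
      also have "\<dots> = 0" using raise[OF step.hyps(2,3,1)] by simp
      finally show ?case .
    qed (simp_all add: 0 ip_add_right ip_smult_right)
    have "W \<subseteq> {x. \<forall>y\<in>F.low w. ip x y = 0}"
    proof (rule W_min)
      show "cpoly.subspace {x. \<forall>y\<in>F.low w. ip x y = 0}"
        by (auto simp: cpoly.subspace_def ip_add_left ip_smult_left)
      show "F.stable {x. \<forall>y\<in>F.low w. ip x y = 0}"
        using F.low_closed[OF w(2)] by (auto simp: F.stable_def F.adj)
    qed (use low in blast)
    then have "ip w w = 0" using w(1) F.low.base[of w] by blast
    then show False using w(3) by (simp add: ip_self_eq_0)
  qed
  have "d p = c p + k" if p: "p < N" for p
  proof -
    have "of_nat (d p) * ip f w = ip f (F p p w)"
      using F.hw_cartan[OF w(2) p] by (simp add: ip_smult_right)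
    also have "\<dots> = ip (F p p f) w" using F.adj[OF p p] by simp
    also have "F p p f = E' p p f + smult_poly (of_nat k) f" using E'f[OF p p] by simp
    also have "ip \<dots> w = ip f (E' p p w) + of_nat k * ip f w"
      using E'.adj[OF p p] by (simp add: ip_add_left ip_smult_left)
    also have "\<dots> = of_nat (c p + k) * ip f w"
      using E'.hw_cartan[OF w(4) p] by (simp add: ip_smult_right distrib_right)
    finally show ?thesis using fw by (metis mult_cancel_right of_nat_eq_iff)
  qed
  moreover have "d p = lam (Suc p)" if "p < N" for p
    using Iso_F_weight[OF _ w(3,2) that] w(1) WIso by blast
  moreover from this have "F.hw (\<lambda>p. of_nat (lam (Suc p))) w" using w(2) by (simp add: F.hw_def)
  ultimately show ?thesis using w WIso by (intro exI[of _ w] exI[of _ c]) auto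
qed

lemma lie_cov_admissible:
  assumes "lam \<in> partitions N" "f \<in> Iso lam" "lie_cov k f" "f \<noteq> 0"
  shows "admissible N n k lam"
proof -
  obtain w c where w: "w \<in> Iso lam" "w \<noteq> 0" "F.hw (\<lambda>p. of_nat (lam (Suc p))) w"
    "E'.hw (\<lambda>p. of_nat (c p)) w" and c: "\<And>p. p < N \<Longrightarrow> lam (Suc p) = c p + k"
    using lie_cov_joint_hw[OF assms] by blast
  have "lam (Suc (p + n)) + k \<le> lam (Suc p)" if "p + n < N" for p
    using interlacing[OF _ w(2,4,3) that] w(1) Iso_poly_ring c[of p] that by auto
  then have "lam (i + n) + k \<le> lam i" if "1 \<le> i" "i + n \<le> N" for i
    using that by (cases i) auto
  moreover have "k \<le> lam i" if "i \<in> {1..N}" for i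
    using c[of "i - 1"] that by auto
  ultimately show ?thesis by (auto simp: admissible_def)
qed

text \<open>\<open>E'\<close> twisted by \<open>det ^ k\<close>: covariance of \<open>f\<close> means that \<open>F i j f = Et k j i f\<close>.\<close>

definition Et :: "nat \<Rightarrow> nat \<Rightarrow> nat \<Rightarrow> cpoly \<Rightarrow> cpoly" where
  "Et k i j f = E' i j f + (if i = j then smult_poly (of_nat k) f else 0)"

text \<open>The twist adds a multiple of the trace of the matrix unit, and traces of commutators
  vanish.\<close>

lemma Et_action: "gl_action (Et k) N"
proof (rule gl_action.intro)
  show "lin (Et k p q)" if "p < N" "q < N" for p q
    using E'.lin_e[OF that] by (intro linI)
      (auto simp: Et_def lin_add lin_smult cpoly.scale_right_distrib mult.commute)
  show "ip (Et k p q f) g = ip f (Et k q p g)" if "p < N" "q < N" for p q f g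
    by (auto simp: Et_def E'.adj[OF that] ip_add_left ip_add_right ip_smult_left ip_smult_right)
  show "Et k p q (Et k r s f) = Et k r s (Et k p q f) + (if q = r then Et k p s f else 0)
      - (if s = p then Et k r q f else 0)" if "p < N" "q < N" "r < N" "s < N" for p q r s f
    using E'.comm[OF that, of f] that
    by (auto simp: Et_def lin_add[OF E'.lin_e] lin_smult[OF E'.lin_e] lin_zero[OF E'.lin_e]
        cpoly.scale_right_distrib)
qed

end

section \<open>A covariant from a pair of dual modules\<close>

context matrix_poly
begin

sublocale Et: gl_action "Et k" N for k
  by (rule Et_action)

lemma Et_F_commute: "p < N \<Longrightarrow> q < N \<Longrightarrow> i < N \<Longrightarrow> j < N \<Longrightarrow> Et k p q (F i j f) = F i j (Et k p q f)"
  by (auto simp: Et_def E'F_commute lin_add[OF F.lin_e] lin_smult[OF F.lin_e] lin_zero[OF F.lin_e])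

text \<open>\<open>corr k w\<close> is the graph of a conjugate-linear intertwiner from the \<open>Et k\<close>-module generated by
  \<open>w\<close> to the \<open>F\<close>-module generated by \<open>w\<close>; \<open>corr_op k w\<close> lifts it to operators \<open>a\<close> in the algebra
  generated by \<open>F\<close>, where \<open>a w\<close> is the image.\<close>

inductive_set corr :: "nat \<Rightarrow> cpoly \<Rightarrow> (cpoly \<times> cpoly) set" for k w where
  base: "(w, w) \<in> corr k w"
| step: "(x, y) \<in> corr k w \<Longrightarrow> q < p \<Longrightarrow> p < N \<Longrightarrow> (Et k p q x, F p q y) \<in> corr k w"
| add: "(x, y) \<in> corr k w \<Longrightarrow> (x', y') \<in> corr k w \<Longrightarrow> (x + x', y + y') \<in> corr k w"
| scale: "(x, y) \<in> corr k w \<Longrightarrow> (smult_poly c x, smult_poly (cnj c) y) \<in> corr k w"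

inductive_set corr_op :: "nat \<Rightarrow> cpoly \<Rightarrow> (cpoly \<times> (cpoly \<Rightarrow> cpoly)) set" for k w where
  base: "(w, \<lambda>y. y) \<in> corr_op k w"
| step: "(x, a) \<in> corr_op k w \<Longrightarrow> q < p \<Longrightarrow> p < N \<Longrightarrow> (Et k p q x, \<lambda>y. F p q (a y)) \<in> corr_op k w"
| add: "(x, a) \<in> corr_op k w \<Longrightarrow> (x', a') \<in> corr_op k w \<Longrightarrow> (x + x', \<lambda>y. a y + a' y) \<in> corr_op k w"
| scale: "(x, a) \<in> corr_op k w \<Longrightarrow> (smult_poly c x, \<lambda>y. smult_poly (cnj c) (a y)) \<in> corr_op k w"

lemma corr_op_corr: "(x, a) \<in> corr_op k w \<Longrightarrow> (x, a w) \<in> corr k w"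
  by (induction rule: corr_op.induct) (auto intro: corr.intros)

lemma corr_op_lin: "(x, a) \<in> corr_op k w \<Longrightarrow> lin a"
proof (induction rule: corr_op.induct)
  case (step x a q p)
  then show ?case using lin_comp[OF F.lin_e[of p q]] by simp
qed (auto intro!: linI simp: lin_add lin_smult cpoly.scale_right_distrib mult.commute)

lemma corr_op_commute:
  assumes "(x, a) \<in> corr_op k w" "i < N" "j < N" shows "a (Et k i j y) = Et k i j (a y)"
  using assms
  by (induction rule: corr_op.induct)
    (auto simp: Et_F_commute lin_add[OF Et.lin_e] lin_smult[OF Et.lin_e])

lemma corr_op_stable:
  assumes "(x, a) \<in> corr_op k w" "cpoly.subspace S" "F.stable S" "y \<in> S" shows "a y \<in> S"
  using assms
  by (induction rule: corr_op.induct)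
    (auto simp: F.stable_def cpoly.subspace_add cpoly.subspace_scale)

lemma corr_op_total: "x \<in> Et.low k w \<Longrightarrow> \<exists>a. (x, a) \<in> corr_op k w"
proof (induction rule: Et.low.induct)
  case base show ?case using corr_op.base by blast
next
  case step then show ?case using corr_op.step by blast
next
  case add then show ?case using corr_op.add by blast
next
  case scale then show ?case using corr_op.scale by blast
qed

lemma corr_low: "(x, y) \<in> corr k w \<Longrightarrow> x \<in> Et.low k w \<and> y \<in> F.low w"
  by (induction rule: corr.induct) (auto intro: Et.low.intros F.low.intros)

lemma corr_zero: "(0, 0) \<in> corr k w"
  using corr.scale[OF corr.base, of 0] by simp

lemma corr_diff:
  assumes "(x, y) \<in> corr k w" "(x', y') \<in> corr k w" shows "(x - x', y - y') \<in> corr k w"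
  using corr.add[OF assms(1) corr.scale[OF assms(2), of "- 1"]] by simp

lemma corr_sum:
  "(\<And>b. b \<in> B \<Longrightarrow> (x b, y b) \<in> corr k w) \<Longrightarrow> (sum x B, sum y B) \<in> corr k w"
  by (induction B rule: infinite_finite_induct) (auto simp: corr_zero intro: corr.add)

context
  fixes k :: nat and w :: cpoly and d :: "nat \<Rightarrow> nat"
  assumes Fw: "F.hw (\<lambda>p. of_nat (d p)) w" and Ew: "Et.hw k (\<lambda>p. of_nat (d p)) w"
begin

text \<open>The argument of \<open>low_closed\<close> carried out in both modules at once; its base
  case is where the two weights of \<open>w\<close> have to agree.\<close>

lemma corr_closed:
  assumes "(x, y) \<in> corr k w" shows "p < N \<Longrightarrow> q < N \<Longrightarrow> (Et k p q x, F p q y) \<in> corr k w"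
  using assms
proof (induction arbitrary: p q rule: corr.induct)
  case base
  consider "p < q" | "p = q" | "q < p" by linarith
  then show ?case
  proof cases
    case 1
    then show ?thesis using Et.hw_raise[OF Ew] F.hw_raise[OF Fw] base corr_zero by simp
  next
    case 2
    then show ?thesis
      using Et.hw_cartan[OF Ew] F.hw_cartan[OF Fw] base corr.scale[OF corr.base, of "of_nat (d p)"] by simp
  next
    case 3
    then show ?thesis using base by (auto intro: corr.intros)
  qed
next
  case (step x y s r)
  have s: "s < N" using step.hyps by simp
  have 1: "(Et k r s (Et k p q x), F r s (F p q y)) \<in> corr k w"
    using step.IH[OF step.prems] step.hyps by (auto intro: corr.step)
  have 2: "(if q = r then Et k p s x else 0, if q = r then F p s y else 0) \<in> corr k w"
    using step.IH[OF step.prems(1) s] corr_zero by simp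
  have 3: "(if s = p then Et k r q x else 0, if s = p then F r q y else 0) \<in> corr k w"
    using step.IH[OF step.hyps(3) step.prems(2)] corr_zero by simp
  show ?case
    unfolding Et.comm[OF step.prems step.hyps(3) s] F.comm[OF step.prems step.hyps(3) s]
    by (rule corr_diff[OF corr.add[OF 1 2] 3])
next
  case (add x y x' y')
  then show ?case using corr.add by (simp add: lin_add[OF Et.lin_e] lin_add[OF F.lin_e])
next
  case (scale x y c)
  then show ?case using corr.scale by (simp add: lin_smult[OF Et.lin_e] lin_smult[OF F.lin_e])
qed

lemma corr_ip: "(x, y) \<in> corr k w \<Longrightarrow> ip y w = cnj (ip x w)"
proof (induction rule: corr.induct)
  case base
  show ?case by (rule ip_commute)
next
  case (step x y q p)
  then show ?case
    using Et.adj[of p q k x w] F.adj[of p q y w] Et.hw_raise[OF Ew step.hyps(2,3)] F.hw_raise[OF Fw step.hyps(2,3)]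
    by simp
qed (simp_all add: ip_add_left ip_smult_left)

text \<open>By \<open>corr_ip\<close>, \<open>y\<close> is orthogonal to \<open>w\<close>; the same
  holds for all its F-images, which again correspond to 0. Hence \<open>y\<close> is orthogonal to
  \<open>F.low w\<close>, where it lies. So \<open>corr\<close> is single-valued.\<close>

lemma corr_zero_unique:
  assumes "(0, y) \<in> corr k w" shows "y = 0"
proof -
  have "ip y z = 0" if "z \<in> F.low w" "(0, y) \<in> corr k w" for y z
    using that
  proof (induction z arbitrary: y rule: F.low.induct)
    case base
    then show ?case using corr_ip by fastforce
  next
    case (step z q p)
    have q: "q < N" using step.hyps by simp
    have "(0, F q p y) \<in> corr k w"
      using corr_closed[OF step.prems q step.hyps(3)] lin_zero[OF Et.lin_e[OF q step.hyps(3)]] by simp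
    then have "ip (F q p y) z = 0" by (rule step.IH)
    then show ?case using F.adj[OF q step.hyps(3)] by simp
  qed (simp_all add: ip_add_right ip_smult_right)
  then have "ip y y = 0" using assms corr_low by blast
  then show ?thesis by (simp add: ip_self_eq_0)
qed

text \<open>Since \<open>a\<close> commutes with \<open>Et\<close>, both \<open>ip (a x) w\<close>
  and \<open>ip x w\<close> vanish on lowered vectors, so they are proportional as functions of x;
  the factor is read off at x = w.\<close>

lemma corr_op_ip:
  assumes a: "(x', a) \<in> corr_op k w" and x: "x \<in> Et.low k w"
  shows "ip (a x) w * ip w w = ip x w * ip (a w) w"
  using x
proof (induction x rule: Et.low.induct)
  case (step x q p)
  have q: "q < N" using step.hyps by simp
  have "ip (a (Et k p q x)) w = 0" "ip (Et k p q x) w = 0"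
    using Et.adj[OF step.hyps(3) q, of k] Et.hw_raise[OF Ew step.hyps(2,3)]
    by (simp_all add: corr_op_commute[OF a step.hyps(3) q])
  then show ?case by simp
qed (simp_all add: lin_add[OF corr_op_lin[OF a]] lin_smult[OF corr_op_lin[OF a]]
    ip_add_left ip_smult_left distrib_right)

text \<open>The invariant tensor \<open>\<Sum>b. b \<otimes> b\<^sup>*\<close> over an orthonormal basis of the \<open>Et k\<close>-module generated
  by \<open>w\<close>, realised as a polynomial.\<close>

lemma lie_cov_exists:
  assumes w: "w \<in> poly_ring N n" "w \<noteq> 0"
    and S: "cpoly.subspace S" "F.stable S" "Et.stable k S" "w \<in> S"
  shows "\<exists>f\<in>S. f \<noteq> 0 \<and> lie_cov k f"
proof -
  let ?V = "Et.low k w"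
  obtain D where D: "w \<in> polyD D" using poly_ring_polyD[OF w(1)] by blast
  have "?V \<subseteq> polyD D"
    by (rule Et.low_subset)
      (auto simp: subspace_polyD Et.stable_def Et_def E'_def E_polyD D
        intro!: cpoly.subspace_add cpoly.subspace_scale)
  then have "?V \<subseteq> {x. Poly_Mapping.keys x \<subseteq> mons D}" by (auto simp: polyD_def)
  from orthonormal_basis[OF finite_mons Et.subspace_low this] obtain B where
    B: "finite B" "B \<subseteq> ?V" "\<forall>x\<in>?V. x = (\<Sum>b\<in>B. smult_poly (ip x b) b)"
    by (elim exE conjE) (rule that)
  have "\<forall>b\<in>B. \<exists>a. (b, a) \<in> corr_op k w" using B(2) corr_op_total by blast
  then obtain a where a: "\<And>b. b \<in> B \<Longrightarrow> (b, a b) \<in> corr_op k w" by metis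
  \<comment> \<open>The tensor of x with the vector \<open>a w\<close> of the F-module is realised
    as \<open>a x\<close>; \<open>a b\<close> is any lift of the dual vector of
    \<open>b\<close>.\<close>
  define f where "f = (\<Sum>b\<in>B. a b b)"
  have VS: "?V \<subseteq> S" by (rule Et.low_subset) (use S in auto)
  have EtV: "Et k i j x \<in> ?V" if "i < N" "j < N" "x \<in> ?V" for i j x
    using Et.low_closed[OF Ew that(3,1,2)] .
  have fS: "f \<in> S"
    unfolding f_def using B(2) VS by (intro cpoly.subspace_sum S(1) corr_op_stable[OF a S(1,2)]) auto
  \<comment> \<open>At x = w both sides correspond to \<open>Et k i j b\<close> under the
    single-valued \<open>corr\<close>; since all operators involved commute with \<open>Et\<close>,
    the identity spreads over the module.\<close>
  have F_op: "F i j (a b x) = (\<Sum>b'\<in>B. smult_poly (ip (Et k j i b') b) (a b' x))"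
    if b: "b \<in> B" and ij: "i < N" "j < N" and x: "x \<in> ?V" for b i j x
    using x
  proof (induction x rule: Et.low.induct)
    case base
    have bV: "b \<in> ?V" using b B(2) by blast
    have eq: "Et k i j b = (\<Sum>b'\<in>B. smult_poly (ip (Et k i j b) b') b')"
      using B(3) EtV[OF ij bV] by blast
    have "cnj (ip (Et k i j b) b') = ip (Et k j i b') b" for b'
      using Et.adj[OF ij(2,1), of k b' b] ip_commute[of b' "Et k i j b"] by simp
    then have "(\<Sum>b'\<in>B. smult_poly (ip (Et k i j b) b') b',
        \<Sum>b'\<in>B. smult_poly (ip (Et k j i b') b) (a b' w)) \<in> corr k w"
      using corr.scale[OF corr_op_corr[OF a]] by (intro corr_sum) metis
    then have "(Et k i j b, \<Sum>b'\<in>B. smult_poly (ip (Et k j i b') b) (a b' w)) \<in> corr k w"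
      using eq by simp
    from corr_diff[OF corr_closed[OF corr_op_corr[OF a[OF b]] ij] this] show ?case
      using corr_zero_unique by (simp add: algebra_simps) force
  next
    case (step x q p)
    have q: "q < N" using step.hyps by simp
    have "F i j (a b (Et k p q x)) = Et k p q (F i j (a b x))"
      by (simp add: corr_op_commute[OF a[OF b] step.hyps(3) q] Et_F_commute step.hyps(3) q ij)
    also have "\<dots> = (\<Sum>b'\<in>B. smult_poly (ip (Et k j i b') b) (a b' (Et k p q x)))"
      unfolding step.IH lin_sum[OF Et.lin_e[OF step.hyps(3) q]] lin_smult[OF Et.lin_e[OF step.hyps(3) q]]
      by (rule sum.cong) (auto simp: corr_op_commute[OF a step.hyps(3) q])
    finally show ?case .
  next
    case (add x y)
    have "F i j (a b (x + y)) = F i j (a b x) + F i j (a b y)"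
      by (simp add: lin_add[OF corr_op_lin[OF a[OF b]]] lin_add[OF F.lin_e[OF ij]])
    also have "\<dots> = (\<Sum>b'\<in>B. smult_poly (ip (Et k j i b') b) (a b' (x + y)))"
      unfolding add.IH sum.distrib[symmetric]
      by (rule sum.cong) (auto simp: lin_add[OF corr_op_lin[OF a]] cpoly.scale_right_distrib)
    finally show ?case .
  next
    case (scale x c)
    have "F i j (a b (smult_poly c x)) = smult_poly c (F i j (a b x))"
      by (simp add: lin_smult[OF corr_op_lin[OF a[OF b]]] lin_smult[OF F.lin_e[OF ij]])
    also have "\<dots> = (\<Sum>b'\<in>B. smult_poly (ip (Et k j i b') b) (a b' (smult_poly c x)))"
      unfolding scale.IH cpoly.scale_sum_right
      by (rule sum.cong) (auto simp: lin_smult[OF corr_op_lin[OF a]] mult.commute)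
    finally show ?case .
  qed
  have "F i j f = Et k j i f" if ij: "i < N" "j < N" for i j
  proof -
    have "F i j f = (\<Sum>b\<in>B. \<Sum>b'\<in>B. smult_poly (ip (Et k j i b') b) (a b' b))"
      unfolding f_def lin_sum[OF F.lin_e[OF ij]]
      by (intro sum.cong refl) (use F_op[OF _ ij] B(2) in blast)
    \<comment> \<open>With the names b and b' exchanged, the inner sum is \<open>a b\<close> applied
      to the expansion of \<open>Et k j i b\<close>.\<close>
    also have "\<dots> = (\<Sum>b\<in>B. \<Sum>b'\<in>B. smult_poly (ip (Et k j i b) b') (a b b'))"
      by (rule sum.swap)
    also have "\<dots> = (\<Sum>b\<in>B. Et k j i (a b b))"
    proof (rule sum.cong[OF refl])
      fix b assume b: "b \<in> B"
      have lin_a: "lin (a b)" using corr_op_lin[OF a[OF b]] .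
      have "Et k j i b = (\<Sum>b'\<in>B. smult_poly (ip (Et k j i b) b') b')"
        using B(2,3) EtV[OF ij(2,1)] b by blast
      then have "a b (Et k j i b) = a b (\<Sum>b'\<in>B. smult_poly (ip (Et k j i b) b') b')" by metis
      then show "(\<Sum>b'\<in>B. smult_poly (ip (Et k j i b) b') (a b b')) = Et k j i (a b b)"
        by (simp add: corr_op_commute[OF a[OF b] ij(2,1)] lin_sum[OF lin_a] lin_smult[OF lin_a])
    qed
    also have "\<dots> = Et k j i f" by (simp add: f_def lin_sum[OF Et.lin_e[OF ij(2,1)]])
    finally show ?thesis .
  qed
  then have "lie_cov k f" by (auto simp: lie_cov_def Et_def)
  moreover have "f \<noteq> 0"
  proof
    assume "f = 0"
    \<comment> \<open>Up to the factor \<open>ip w w\<close>, the pairing of \<open>f\<close> with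
      \<open>w\<close> is the sum of |ip b w|^2; if it vanished, \<open>w\<close> would be
      orthogonal to the basis of its own module.\<close>
    have "ip (a b b) w * ip w w = ip b w * cnj (ip b w)" if "b \<in> B" for b
      using corr_op_ip[OF a[OF that], of b] corr_ip[OF corr_op_corr[OF a[OF that]]] that B(2) by auto
    then have "ip f w * ip w w = (\<Sum>b\<in>B. of_real ((cmod (ip b w))\<^sup>2))"
      unfolding f_def ip_sum_left sum_distrib_right
      by (intro sum.cong) (auto simp flip: complex_norm_square)
    then have "complex_of_real (\<Sum>b\<in>B. (cmod (ip b w))\<^sup>2) = 0" using \<open>f = 0\<close> by simp
    then have "(\<Sum>b\<in>B. (cmod (ip b w))\<^sup>2) = 0" by (simp only: of_real_eq_0_iff)
    then have "ip b w = 0" if "b \<in> B" for b using that B(1) by (simp add: sum_nonneg_eq_0_iff)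
    then have "ip w b = 0" if "b \<in> B" for b using that ip_commute[of w b] by simp
    then have "(\<Sum>b\<in>B. smult_poly (ip w b) b) = 0" by simp
    then show False using B(3) Et.low.base w(2) by metis
  qed
  ultimately show ?thesis using fS by blast
qed

end

end


section \<open>Products of minors\<close>

definition derivation :: "(cpoly \<Rightarrow> cpoly) \<Rightarrow> bool" where
  "derivation T \<longleftrightarrow> lin T \<and> (\<forall>f g. T (f * g) = T f * g + f * T g)"

lemma derivation_lin: "derivation T \<Longrightarrow> lin T"
  and derivation_mult: "derivation T \<Longrightarrow> T (f * g) = T f * g + f * T g"
  by (simp_all add: derivation_def)

lemma derivation_one: "derivation T \<Longrightarrow> T 1 = 0"
  using derivation_mult[of T 1 1] by simp

lemma derivation_dop: "derivation (dop a b)"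
  unfolding derivation_def by (auto simp: lin_dop) (simp add: dop_def pdiff_mult algebra_simps)

lemma derivation_matop: "derivation (matop z K p q)"
  unfolding derivation_def
  by (auto simp: lin_matop matop_def derivation_mult[OF derivation_dop] sum.distrib
      sum_distrib_left sum_distrib_right)

lemma derivation_prod:
  assumes T: "derivation T" and "finite I"
  shows "T (prod f I) = (\<Sum>a\<in>I. T (f a) * prod f (I - {a}))"
  using assms(2)
proof (induction I rule: finite_induct)
  case (insert x I)
  have "(\<Sum>a\<in>I. T (f a) * prod f (insert x I - {a})) = (\<Sum>a\<in>I. f x * (T (f a) * prod f (I - {a})))"
  proof (rule sum.cong[OF refl])
    fix a assume "a \<in> I"
    then have "insert x I - {a} = insert x (I - {a})" using insert.hyps by auto
    then show "T (f a) * prod f (insert x I - {a}) = f x * (T (f a) * prod f (I - {a}))"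
      using insert.hyps by (simp add: mult.left_commute)
  qed
  then show ?case
    using insert by (simp add: derivation_mult[OF T] sum_distrib_left)
qed (simp add: derivation_one[OF T])

lemma derivation_prod_weight:
  assumes T: "derivation T" and "finite I" and w: "\<And>c. c \<in> I \<Longrightarrow> T (h c) = of_nat (u c) * h c"
  shows "T (prod h I) = smult_poly (of_nat (sum u I)) (prod h I)"
proof -
  have "T (prod h I) = (\<Sum>a\<in>I. of_nat (u a) * prod h I)"
    unfolding derivation_prod[OF T \<open>finite I\<close>]
    by (rule sum.cong) (use assms in \<open>auto simp: w mult.assoc prod.remove[of I _ h]\<close>)
  also have "\<dots> = of_nat (sum u I) * prod h I" by (simp add: sum_distrib_right)
  finally show ?thesis by (simp only: of_nat_mult_smult)
qed

lemma lin_signof: "lin T \<Longrightarrow> T (signof p * x) = signof p * T x"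
  using lin_diff[of T 0 x] lin_zero[of T] by (simp add: sign_def)

lemma derivation_det:
  assumes T: "derivation T" and A: "A \<in> carrier_mat m m"
  shows "T (det A) = (\<Sum>a<m. det (mat m m (\<lambda>(i, b). if i = a then T (A $$ (a, b)) else A $$ (i, b))))"
proof -
  let ?P = "{p. p permutes {0..<m}}"
  have "T (det A) = (\<Sum>p\<in>?P. signof p * T (\<Prod>i = 0..<m. A $$ (i, p i)))"
    by (simp add: det_def'[OF A] lin_sum[OF derivation_lin[OF T]] lin_signof[OF derivation_lin[OF T]])
  also have "\<dots> = (\<Sum>p\<in>?P. \<Sum>a<m. signof p * (T (A $$ (a, p a)) * (\<Prod>i\<in>{0..<m} - {a}. A $$ (i, p i))))"
    by (simp add: derivation_prod[OF T] sum_distrib_left lessThan_atLeast0)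
  also have "\<dots> = (\<Sum>a<m. \<Sum>p\<in>?P. signof p * (T (A $$ (a, p a)) * (\<Prod>i\<in>{0..<m} - {a}. A $$ (i, p i))))"
    by (rule sum.swap)
  also have "\<dots> = (\<Sum>a<m. det (mat m m (\<lambda>(i, b). if i = a then T (A $$ (a, b)) else A $$ (i, b))))"
  proof (rule sum.cong[OF refl])
    fix a assume a: "a \<in> {..<m}"
    let ?B = "mat m m (\<lambda>(i, b). if i = a then T (A $$ (a, b)) else A $$ (i, b))"
    have "(\<Prod>i = 0..<m. ?B $$ (i, p i)) = T (A $$ (a, p a)) * (\<Prod>i\<in>{0..<m} - {a}. A $$ (i, p i))"
      if p: "p \<in> ?P" for p
    proof -
      have pi: "p i < m" if "i < m" for i using permutes_in_image[of p "{0..<m}" i] p that by simp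
      have "(\<Prod>i = 0..<m. ?B $$ (i, p i)) = ?B $$ (a, p a) * (\<Prod>i\<in>{0..<m} - {a}. ?B $$ (i, p i))"
        using a by (intro prod.remove) auto
      also have "(\<Prod>i\<in>{0..<m} - {a}. ?B $$ (i, p i)) = (\<Prod>i\<in>{0..<m} - {a}. A $$ (i, p i))"
        by (rule prod.cong) (auto simp: pi)
      finally show ?thesis using a pi by simp
    qed
    then show "(\<Sum>p\<in>?P. signof p * (T (A $$ (a, p a)) * (\<Prod>i\<in>{0..<m} - {a}. A $$ (i, p i)))) = det ?B"
      by (simp add: det_def'[of ?B m])
  qed
  finally show ?thesis .
qed

lemma det_zero_row:
  assumes A: "A \<in> carrier_mat m m" and a: "a < m" "\<And>b. b < m \<Longrightarrow> A $$ (a, b) = (0 :: cpoly)"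
  shows "det A = 0"
proof -
  have "(\<Prod>i = 0..<m. A $$ (i, p i)) = 0" if "p permutes {0..<m}" for p
    using a permutes_in_image[OF that, of a] by (intro prod_zero) (auto intro!: bexI[of _ a])
  then show ?thesis by (simp add: det_def'[OF A])
qed

text \<open>A derivation replacing row \<open>q\<close> by row \<open>p\<close> and killing the other rows: the minor on the rows
  \<open>rho\<close> is mapped to a determinant with a repeated row unless \<open>p = q\<close>.\<close>

lemma derivation_minor:
  fixes y :: "nat \<Rightarrow> nat \<Rightarrow> cpoly"
  assumes T: "derivation T" and inj: "inj_on rho {..<m}"
    and Ty: "\<And>a b. a < m \<Longrightarrow> b < m \<Longrightarrow> T (y (rho a) b) = (if rho a = q then y p b else 0)"
    and pq: "q \<in> rho ` {..<m} \<Longrightarrow> p \<in> rho ` {..<m}"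
  shows "T (det (mat m m (\<lambda>(a, b). y (rho a) b))) =
    of_nat (if p = q \<and> q \<in> rho ` {..<m} then 1 else 0) * det (mat m m (\<lambda>(a, b). y (rho a) b))"
proof -
  let ?A = "mat m m (\<lambda>(a, b). y (rho a) b)"
  let ?B = "\<lambda>a. mat m m (\<lambda>(i, b). if i = a then T (?A $$ (a, b)) else ?A $$ (i, b))"
  have TA: "T (det ?A) = (\<Sum>a<m. det (?B a))" by (rule derivation_det[OF T]) simp
  have other: "det (?B a) = 0" if "a < m" "rho a \<noteq> q" for a
    by (rule det_zero_row[of _ m a]) (use that Ty in auto)
  show ?thesis
  proof (cases "q \<in> rho ` {..<m}")
    case False
    then have "det (?B a) = 0" if "a < m" for a using other that by blast
    then show ?thesis using TA False by simp
  next
    case True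
    then obtain a where a: "a < m" "rho a = q" by auto
    have "det (?B a') = 0" if "a' < m" "a' \<noteq> a" for a'
      using other[OF that(1)] inj_onD[OF inj, of a' a] that a by auto
    then have TA': "T (det ?A) = det (?B a)"
      unfolding TA using a(1) by (subst sum.remove[of _ a]) auto
    show ?thesis
    proof (cases "p = q")
      case pq: True
      have "?B a = ?A" by (rule eq_matI) (use a pq Ty in auto)
      then show ?thesis using TA' True pq by simp
    next
      case False
      obtain a' where a': "a' < m" "rho a' = p" using pq True by auto
      then have ne: "a \<noteq> a'" using a False by auto
      have "det (?B a) = 0"
        by (rule det_identical_rows[of _ m a a'])
          (use a a' ne Ty in \<open>auto intro!: eq_vecI\<close>)
      then show ?thesis using TA' False by simp
    qed
  qed
qed

text \<open>A kernel vector would be the coefficient vector of a nonzero polynomial of degree below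
  m with m distinct roots.\<close>

lemma vandermonde_nonzero:
  fixes z :: "nat \<Rightarrow> complex"
  assumes inj: "inj_on z {..<m}"
  shows "det (mat m m (\<lambda>(a, b). z a ^ b)) \<noteq> 0"
proof
  let ?A = "mat m m (\<lambda>(a, b). z a ^ b)"
  assume "det ?A = 0"
  then obtain v where v: "v \<in> carrier_vec m" "v \<noteq> 0\<^sub>v m" "?A *\<^sub>v v = 0\<^sub>v m"
    using det_0_iff_vec_prod_zero[of ?A m] by auto
  obtain b where b: "b < m" "v $ b \<noteq> 0"
    using v(1,2) by (metis carrier_vecD eq_vecI index_zero_vec)
  have roots: "(\<Sum>i\<le>m - 1. v $ i * z a ^ i) = 0" if a: "a < m" for a
  proof -
    have "0 = (?A *\<^sub>v v) $ a" using v(3) a by simp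
    also have "\<dots> = (\<Sum>i = 0..<m. z a ^ i * v $ i)" using a v(1) by (simp add: scalar_prod_def)
    also have "{0..<m} = {..m - 1}" using b by auto
    finally show ?thesis by (simp add: mult.commute)
  qed
  let ?R = "{x. (\<Sum>i\<le>m - 1. v $ i * x ^ i) = 0}"
  have R: "finite ?R" "card ?R \<le> m - 1"
    using polyfun_rootbound[of "\<lambda>i. v $ i" b "m - 1"] b by auto
  have "z ` {..<m} \<subseteq> ?R" using roots by auto
  then have "card (z ` {..<m}) \<le> m - 1" using card_mono[OF R(1)] R(2) by (meson order_trans)
  then show False using card_image[OF inj] b by simp
qed

text \<open>Row p of the stacked matrix consists of the powers of p, so all the minors below become
  Vandermonde determinants. One point serves all factors, hence their product is nonzero.\<close>

fun vandermonde_point :: "nat \<Rightarrow> entry \<Rightarrow> complex" where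
  "vandermonde_point n (AV a b) = of_nat a ^ b"
| "vandermonde_point n (XV a b) = of_nat (n + a) ^ b"

lemma pdiff_var: "pdiff v (var w) = (if v = w then 1 else 0)"
proof -
  have "pdiff v 1 = 0" using pdiff_mult[of v 1 1] by simp
  then show ?thesis using pdiff_var_mult[of v w 1] by simp
qed

context matrix_poly
begin

lemma E_var: "b < N \<Longrightarrow> E p q (var (stk n a b)) = (if a = q then var (stk n p b) else 0)"
proof -
  assume b: "b < N"
  have "E p q (var (stk n a b)) = (\<Sum>i<N. if i = b then (if a = q then var (stk n p b) else 0) else 0)"
    unfolding gl_op_stk matop_def by (rule sum.cong) (auto simp: dop_def pdiff_var stk_inj)
  then show ?thesis using b by simp
qed

lemma F_var: "a < M \<Longrightarrow> F i j (var (stk n a b)) = (if b = j then var (stk n a i) else 0)"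
proof -
  assume a: "a < M"
  have "F i j (var (stk n a b)) = (\<Sum>p<M. if p = a then (if b = j then var (stk n a i) else 0) else 0)"
    unfolding F_def matop_def by (rule sum.cong) (auto simp: dop_def pdiff_var stk_inj)
  then show ?thesis using a by simp
qed

lemma derivation_E: "derivation (E p q)"
  unfolding gl_op_stk by (rule derivation_matop)

lemma derivation_F: "derivation (F i j)"
  unfolding F_def by (rule derivation_matop)

definition minor_rows :: "nat \<Rightarrow> nat \<Rightarrow> nat" where
  "minor_rows s a = (if a < s then a else n + (a - s))"

text \<open>A raising operator of E' or F replaces a row of X or a column by an earlier one, which
  is already present since the rows of X and the columns are initial. Rows of A enlarge the F-weight
  without affecting the E'-weight.\<close>

definition minor :: "nat \<Rightarrow> nat \<Rightarrow> cpoly" where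
  "minor s r = det (mat (s + r) (s + r) (\<lambda>(a, b). var (stk n (minor_rows s a) b)))"

lemma minor_rows_inj: "s \<le> n \<Longrightarrow> inj_on (minor_rows s) A"
  by (auto simp: inj_on_def minor_rows_def split: if_splits)

lemma minor_rows_X: "s \<le> n \<Longrightarrow> n + p \<in> minor_rows s ` {..<s + r} \<longleftrightarrow> p < r"
proof
  assume "s \<le> n" "n + p \<in> minor_rows s ` {..<s + r}"
  then show "p < r" by (auto simp: minor_rows_def split: if_splits)
next
  assume "p < r"
  then show "n + p \<in> minor_rows s ` {..<s + r}"
    by (intro image_eqI[of _ _ "s + p"]) (auto simp: minor_rows_def)
qed

lemma E'_minor:
  assumes s: "s \<le> n" "s + r \<le> N" and pq: "p \<le> q" "q < N"
  shows "E' p q (minor s r) = of_nat (if p = q \<and> q < r then 1 else 0) * minor s r"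
proof -
  have "E (n + p) (n + q) (minor s r) =
    of_nat (if n + p = n + q \<and> n + q \<in> minor_rows s ` {..<s + r} then 1 else 0) * minor s r"
    unfolding minor_def
    by (rule derivation_minor[OF derivation_E minor_rows_inj[OF s(1)], where y = "\<lambda>a b. var (stk n a b)"])
      (use s pq in \<open>simp_all add: E_var minor_rows_X\<close>)
  then show ?thesis using s by (simp add: E'_def minor_rows_X)
qed

lemma F_minor:
  assumes s: "s \<le> n" "s + r \<le> N" and ij: "i \<le> j" "j < N"
  shows "F i j (minor s r) = of_nat (if i = j \<and> j < s + r then 1 else 0) * minor s r"
proof -
  let ?A = "mat (s + r) (s + r) (\<lambda>(a, b). var (stk n (minor_rows s a) b))"
  \<comment> \<open>\<open>derivation_minor\<close> replaces rows, so column operators require the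
    transpose.\<close>
  have T: "minor s r = det (mat (s + r) (s + r) (\<lambda>(b, a). var (stk n (minor_rows s a) b)))"
  proof -
    have "minor s r = det (transpose_mat ?A)"
      unfolding minor_def by (subst det_transpose[of _ "s + r"]) simp_all
    also have "transpose_mat ?A = mat (s + r) (s + r) (\<lambda>(b, a). var (stk n (minor_rows s a) b))"
      by (rule eq_matI) auto
    finally show ?thesis .
  qed
  have "minor_rows s a < M" if "a < s + r" for a using that s by (auto simp: minor_rows_def)
  then have "F i j (minor s r) =
    of_nat (if i = j \<and> j \<in> (\<lambda>x. x) ` {..<s + r} then 1 else 0) * minor s r"
    unfolding T
    by (intro derivation_minor[OF derivation_F, where y = "\<lambda>b a. var (stk n (minor_rows s a) b)" and rho = "\<lambda>x. x"])
      (use ij in \<open>auto simp: F_var\<close>)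
  then show ?thesis by simp
qed

lemma ev_minor_nonzero:
  assumes "s \<le> n"
  shows "ev (minor s r) (vandermonde_point n) \<noteq> 0"
proof -
  let ?x = "vandermonde_point n"
  interpret ev: comm_ring_hom "\<lambda>f. ev f ?x"
    by unfold_locales (simp_all add: ev_add ev_mult ev_const[of 1, simplified])
  have x: "?x (stk n a b) = of_nat a ^ b" for a b by (simp add: stk_def)
  have "ev (minor s r) ?x = det (map_mat (\<lambda>f. ev f ?x) (mat (s + r) (s + r) (\<lambda>(a, b). var (stk n (minor_rows s a) b))))"
    unfolding minor_def by (rule ev.hom_det[symmetric])
  also have "map_mat (\<lambda>f. ev f ?x) (mat (s + r) (s + r) (\<lambda>(a, b). var (stk n (minor_rows s a) b))) =
      mat (s + r) (s + r) (\<lambda>(a, b). (of_nat (minor_rows s a)) ^ b)"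
    by (rule eq_matI) (auto simp: ev_var x)
  also have "det \<dots> \<noteq> 0"
    using minor_rows_inj[OF assms, of "{..<s + r}"] by (intro vandermonde_nonzero) (auto simp: inj_on_def)
  finally show ?thesis .
qed

lemma poly_ring_mult:
  assumes "f \<in> poly_ring N n" "g \<in> poly_ring N n" shows "f * g \<in> poly_ring N n"
proof -
  have "Poly_Mapping.keys m \<subseteq> entries N n" if "m \<in> Poly_Mapping.keys (f * g)" for m
  proof -
    obtain a b where "m = a + b" "a \<in> Poly_Mapping.keys f" "b \<in> Poly_Mapping.keys g"
      using subsetD[OF keys_mult \<open>m \<in> _\<close>] by blast
    then show ?thesis using assms keys_add[of a b] unfolding poly_ring_def by blast
  qed
  then show ?thesis by (auto simp: poly_ring_def)
qed

lemma poly_ring_prod: "(\<And>a. a \<in> I \<Longrightarrow> f a \<in> poly_ring N n) \<Longrightarrow> prod f I \<in> poly_ring N n"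
proof (induction I rule: infinite_finite_induct)
  case (insert a I)
  then show ?case by (simp add: poly_ring_mult)
qed (simp_all add: poly_ring_def)

lemma minor_poly_ring:
  assumes s: "s \<le> n" "s + r \<le> N"
  shows "minor s r \<in> poly_ring N n"
proof -
  let ?A = "mat (s + r) (s + r) (\<lambda>(a, b). var (stk n (minor_rows s a) b))"
  have var: "var (stk n (minor_rows s a) b) \<in> poly_ring N n" if "a < s + r" "b < s + r" for a b
  proof -
    have "stk n (minor_rows s a) b \<in> entries N n"
      using that s by (intro stk_entries) (auto simp: minor_rows_def)
    then show ?thesis by (simp add: poly_ring_def var_def)
  qed
  have "signof p * (\<Prod>i = 0..<s + r. ?A $$ (i, p i)) \<in> poly_ring N n" if p: "p permutes {0..<s + r}" for p
  proof -
    have "(\<Prod>i = 0..<s + r. ?A $$ (i, p i)) \<in> poly_ring N n"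
      using var permutes_in_image[OF p] by (intro poly_ring_prod) auto
    then show ?thesis using cpoly.subspace_neg[OF subspace_poly_ring] by (auto simp: sign_def)
  qed
  then show ?thesis
    unfolding minor_def det_def'[of ?A "s + r", simplified]
    by (intro cpoly.subspace_sum subspace_poly_ring) auto
qed

text \<open>The number of boxes in column \<open>c\<close> of the Young diagram.  The highest weight vector below is a
  product of one minor for each column \<open>c\<close> of \<open>lam\<close>, taking as many rows of \<open>X\<close> as there are boxes in
  the corresponding column of \<open>lam - k\<close>; admissibility ensures that \<open>A\<close> has enough rows to fill up.\<close>

definition col_height :: "(nat \<Rightarrow> nat) \<Rightarrow> nat \<Rightarrow> nat" where
  "col_height lam c = card {i \<in> {1..N}. c < lam i}"

lemma col_height_iff:
  assumes "lam \<in> partitions N" "i \<in> {1..N}"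
  shows "i \<le> col_height lam c \<longleftrightarrow> c < lam i"
proof
  assume "c < lam i"
  then have "{1..i} \<subseteq> {i \<in> {1..N}. c < lam i}"
    using assms by (fastforce simp: partitions_def)
  from card_mono[OF _ this] show "i \<le> col_height lam c" by (simp add: col_height_def)
next
  assume i: "i \<le> col_height lam c"
  show "c < lam i"
  proof (rule ccontr)
    assume nc: "\<not> c < lam i"
    have "{i \<in> {1..N}. c < lam i} \<subseteq> {1..<i}"
    proof
      fix j assume j: "j \<in> {i \<in> {1..N}. c < lam i}"
      have "\<not> i \<le> j"
      proof
        assume "i \<le> j"
        then have "lam j \<le> lam i" using assms j by (auto simp: partitions_def)
        then show False using j nc by simp
      qed
      then show "j \<in> {1..<i}" using j by simp
    qed
    from card_mono[OF _ this] have "col_height lam c \<le> i - 1" by (simp add: col_height_def)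
    moreover have "1 \<le> i" using assms(2) by simp
    ultimately show False using i by linarith
  qed
qed

lemma col_height_le: "col_height lam c \<le> N"
proof -
  have "col_height lam c \<le> card {1..N}" unfolding col_height_def by (intro card_mono) auto
  then show ?thesis by simp
qed

lemma col_height_mono: "c \<le> c' \<Longrightarrow> col_height lam c' \<le> col_height lam c"
  unfolding col_height_def by (intro card_mono) auto

text \<open>Otherwise the first row i missing in column c + k satisfies c < lam (i + n), hence c + k
  < lam i by admissibility, which puts i into that column.\<close>

lemma col_height_admissible:
  assumes lam: "lam \<in> partitions N" "admissible N n k lam"
  shows "col_height lam c \<le> col_height lam (c + k) + n"
proof (rule ccontr)
  let ?i = "Suc (col_height lam (c + k))"
  assume "\<not> ?thesis"
  then have le: "?i + n \<le> col_height lam c" by simp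
  then have N: "?i + n \<le> N" using col_height_le[of lam c] by simp
  then have "c < lam (?i + n)" using col_height_iff[OF lam(1), of "?i + n" c] le by simp
  moreover have "lam (?i + n) + k \<le> lam ?i"
  proof -
    have "\<forall>i. 1 \<le> i \<and> i + n \<le> N \<longrightarrow> lam (i + n) + k \<le> lam i"
      using lam(2) by (simp add: admissible_def)
    from this[rule_format, of ?i] show ?thesis using N by linarith
  qed
  ultimately have "?i \<le> col_height lam (c + k)" using col_height_iff[OF lam(1), of ?i "c + k"] N by simp
  then show False by simp
qed

lemma admissible_exists:
  assumes lam: "lam \<in> partitions N" "admissible N n k lam"
  shows "\<exists>f\<in>Iso lam. f \<noteq> 0 \<and> lie_cov k f"
proof -
  \<comment> \<open>Column c of lam - k is column c + k of lam, because every \<open>lam i\<close>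
    is at least k.\<close>
  define r where "r c = col_height lam (c + k)" for c
  define s where "s c = col_height lam c - r c" for c
  have sr: "s c + r c = col_height lam c" for c
    using col_height_mono[of c "c + k" lam] by (simp add: s_def r_def)
  have s: "s c \<le> n" "s c + r c \<le> N" for c
    using col_height_admissible[OF lam, of c] sr[of c] col_height_le by (auto simp: s_def r_def)
  define C where "C = lam 1"
  define w where "w = (\<Prod>c<C. minor (s c) (r c))"
  have lam_le: "lam (Suc i) \<le> C" if "i < N" for i
    using lam(1) that by (auto simp: partitions_def C_def)
  have k_le: "k \<le> lam (Suc i)" if "i < N" for i
    using lam(2) that by (auto simp: admissible_def)
  have F_w: "F i j w = smult_poly (of_nat (\<Sum>c<C. if i = j \<and> j < s c + r c then 1 else 0)) w"
    if "i \<le> j" "j < N" for i j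
    unfolding w_def by (rule derivation_prod_weight[OF derivation_F])
      (auto simp: F_minor[OF s that])
  have E'_w: "E' p q w = smult_poly (of_nat (\<Sum>c<C. if p = q \<and> q < r c then 1 else 0)) w"
    if "p \<le> q" "q < N" for p q
    unfolding w_def E'_def by (rule derivation_prod_weight[OF derivation_E])
      (auto simp: E'_minor[OF s that, unfolded E'_def])
  have "(\<Sum>c<C. if i < s c + r c then 1 else 0) = lam (Suc i)" if i: "i < N" for i
  proof -
    have "i < s c + r c \<longleftrightarrow> c < lam (Suc i)" for c
      using col_height_iff[OF lam(1), of "Suc i" c] i sr[of c] by (simp add: Suc_le_eq)
    then have "(\<Sum>c<C. if i < s c + r c then 1 else 0) = card {c \<in> {..<C}. c < lam (Suc i)}"
      by (simp add: sum.If_cases Int_def)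
    also have "{c \<in> {..<C}. c < lam (Suc i)} = {..<lam (Suc i)}" using lam_le[OF i] by auto
    finally show ?thesis by simp
  qed
  then have Fw: "F.hw (\<lambda>p. of_nat (lam (Suc p))) w"
    unfolding F.hw_def using F_w by (auto simp del: of_nat_sum)
  have "(\<Sum>c<C. if p < r c then 1 else 0) + k = lam (Suc p)" if p: "p < N" for p
  proof -
    have "p < r c \<longleftrightarrow> c + k < lam (Suc p)" for c
      using col_height_iff[OF lam(1), of "Suc p" "c + k"] p by (simp add: r_def Suc_le_eq)
    then have "(\<Sum>c<C. if p < r c then 1 else 0) = card {c \<in> {..<C}. c + k < lam (Suc p)}"
      by (simp add: sum.If_cases Int_def)
    also have "{c \<in> {..<C}. c + k < lam (Suc p)} = {..<lam (Suc p) - k}" using lam_le[OF p] by auto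
    finally show ?thesis using k_le[OF p] by simp
  qed
  then have "(of_nat (\<Sum>c<C. if p < r c then 1 else 0) :: complex) + of_nat k = of_nat (lam (Suc p))"
    if "p < N" for p
    using that by (metis of_nat_add)
  then have Ew: "Et.hw k (\<lambda>p. of_nat (lam (Suc p))) w"
    unfolding Et.hw_def Et_def using E'_w by (auto simp flip: cpoly.scale_left_distrib)
  have w: "w \<in> poly_ring N n"
    unfolding w_def by (intro poly_ring_prod minor_poly_ring s)
  have "w \<noteq> 0"
  proof -
    let ?x = "vandermonde_point n"
    have ev_prod: "ev (prod h I) ?x = (\<Prod>c\<in>I. ev (h c) ?x)" if "finite I" for h and I :: "nat set"
      using that by induction (simp_all add: ev_mult ev_const[of 1, simplified])
    have "ev w ?x \<noteq> 0"
      unfolding w_def ev_prod[OF finite_lessThan] using ev_minor_nonzero[OF s(1)] by simp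
    then show ?thesis by auto
  qed
  show ?thesis
  proof (rule lie_cov_exists[OF Fw Ew w \<open>w \<noteq> 0\<close> subspace_Iso])
    show "F.stable (Iso lam)" by (simp add: F.stable_def Iso_F)
    show "Et.stable k (Iso lam)"
      by (auto simp: Et.stable_def Et_def E'_Iso intro!: cpoly.subspace_add cpoly.subspace_scale subspace_Iso)
    show "w \<in> Iso lam" by (rule Iso_of_F_hw[OF lam(1) w Fw])
  qed
qed

section \<open>The direct sum of the covariant summands\<close>

lemma subspace_cov_space: "cpoly.subspace (cov_space N n k)"
proof -
  have "cov_space N n k = poly_ring N n \<inter> {f. lie_cov k f}" using cov_space_iff by auto
  moreover have "cpoly.subspace {f. lie_cov k f}"
    unfolding cpoly.subspace_def lie_cov_def
    by (auto simp: lin_zero[OF F.lin_e] lin_zero[OF E'.lin_e] lin_add[OF F.lin_e] lin_add[OF E'.lin_e]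
        lin_smult[OF F.lin_e] lin_smult[OF E'.lin_e] cpoly.scale_right_distrib mult.commute)
  ultimately show ?thesis by (simp add: cpoly.subspace_inter subspace_poly_ring)
qed

lemma cov_summand_iff: "f \<in> cov_summand N n k lam \<longleftrightarrow> f \<in> Iso lam \<and> lie_cov k f"
  using Iso_poly_ring by (auto simp: cov_summand_def cov_space_iff)

lemma subspace_cov_summand: "cpoly.subspace (cov_summand N n k lam)"
  unfolding cov_summand_def by (intro cpoly.subspace_inter subspace_cov_space subspace_Iso)

lemma cov_space_direct_sum:
  "is_direct_sum (cov_space N n k) {lam \<in> partitions N. admissible N n k lam} (cov_summand N n k)"
  unfolding is_direct_sum_def
proof (intro conjI ballI)
  let ?I = "{lam \<in> partitions N. admissible N n k lam}"
  fix f assume f: "f \<in> cov_space N n k"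
  obtain g L where g: "finite L" "L \<subseteq> partitions N" "\<forall>mu\<in>L. g mu \<in> Iso mu" "f = sum g L"
    using Iso_decomposition[of f] f cov_space_iff by blast
  have lie: "lie_cov k (g mu)" if "mu \<in> L" for mu
    using lie_cov_components[OF g(1-3) _ that] f g(4) cov_space_iff by blast
  define c where "c mu = (if mu \<in> L then g mu else 0)" for mu
  show "\<exists>!c. (\<forall>i\<in>?I. c i \<in> cov_summand N n k i) \<and> (\<forall>i. i \<notin> ?I \<longrightarrow> c i = 0) \<and>
        finite {i. c i \<noteq> 0} \<and> f = (\<Sum>i\<in>{i. c i \<noteq> 0}. c i)"
  proof (rule ex1I[of _ c], intro conjI ballI allI impI)
    fix i
    show "c i \<in> cov_summand N n k i"
      using lie g(3) cpoly.subspace_0[OF subspace_cov_summand] by (simp add: c_def cov_summand_iff)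
  next
    \<comment> \<open>Components outside the index set vanish because a nonzero covariant forces
      admissibility.\<close>
    fix i assume "i \<notin> ?I"
    then show "c i = 0"
      using lie_cov_admissible[of i "g i" k] lie[of i] g(2,3) by (auto simp: c_def)
  next
    show fin: "finite {i. c i \<noteq> 0}" by (rule finite_subset[OF _ g(1)]) (auto simp: c_def)
    show "f = (\<Sum>i\<in>{i. c i \<noteq> 0}. c i)"
      unfolding g(4) using g(1) by (intro sum.mono_neutral_cong_right) (auto simp: c_def)
  next
    fix c' assume c': "(\<forall>i\<in>?I. c' i \<in> cov_summand N n k i) \<and> (\<forall>i. i \<notin> ?I \<longrightarrow> c' i = 0) \<and>
        finite {i. c' i \<noteq> 0} \<and> f = (\<Sum>i\<in>{i. c' i \<noteq> 0}. c' i)"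
    let ?K = "L \<union> {i. c' i \<noteq> 0}"
    have K: "finite ?K" "?K \<subseteq> partitions N" using g(1,2) c' by auto
    have "sum c' ?K = f" using c' K(1) by (metis (mono_tags, lifting) Un_upper2 DiffD2 mem_Collect_eq sum.mono_neutral_right)
    moreover have "sum c ?K = f"
      unfolding g(4) using K(1) by (intro sum.mono_neutral_cong_right) (auto simp: c_def)
    ultimately have sum0: "(\<Sum>i\<in>?K. c' i - c i) = 0" by (simp add: sum_subtractf)
    have "c' i - c i \<in> Iso i" if "i \<in> ?K" for i
    proof (rule cpoly.subspace_diff[OF subspace_Iso])
      show "c' i \<in> Iso i"
        using c' cpoly.subspace_0[OF subspace_Iso] by (cases "i \<in> ?I") (auto simp: cov_summand_iff)
      show "c i \<in> Iso i" using g(3) cpoly.subspace_0[OF subspace_Iso] by (auto simp: c_def)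
    qed
    then have "c' i - c i = 0" if "i \<in> ?K" for i
      using Iso_independent[OF K _ sum0 that] by blast
    then have "c' i = c i" for i by (cases "i \<in> ?K") (auto simp: c_def)
    then show "c' = c" by blast
  qed
qed (use subspace_cov_space subspace_cov_summand in \<open>auto simp: cov_summand_iff cov_space_iff Iso_poly_ring[THEN subsetD]\<close>)

end

theorem theoremG:
  fixes N n k :: nat
  assumes "N \<ge> 1" and "n \<ge> 1" and "k \<ge> 1"
  shows "is_direct_sum (cov_space N n k) {lam \<in> partitions N. admissible N n k lam} (cov_summand N n k)
    \<and> (\<forall>lam \<in> partitions N. admissible N n k lam \<longrightarrow>
         has_eigenvalue_on (H_CS N) (cov_summand N n k lam)
           (of_int (\<Sum>i = 1..N. (int (lam i) - int k) * (int (lam i) - int k + int N + 1 - 2 * int i))))"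
proof (intro conjI ballI impI)
  interpret matrix_poly N n .
  show "is_direct_sum (cov_space N n k) {lam \<in> partitions N. admissible N n k lam} (cov_summand N n k)"
    by (rule cov_space_direct_sum)
  fix lam assume lam: "lam \<in> partitions N" "admissible N n k lam"
  obtain f where "f \<in> cov_summand N n k lam" "f \<noteq> 0"
    using admissible_exists[OF lam] cov_summand_iff by blast
  then show "has_eigenvalue_on (H_CS N) (cov_summand N n k lam)
      (of_int (\<Sum>i = 1..N. (int (lam i) - int k) * (int (lam i) - int k + int N + 1 - 2 * int i)))"
    unfolding has_eigenvalue_on_def using H_CS_eigenvalue[OF lam(1)] cov_summand_iff by blast
qed

end
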